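(* Let $A$ be a graded $K$-algebra and let $D$ be a central extension of $A$ by $z$ (the central extension associated to some deformation of $A$). Let the matrices $M_n$, $f_n$ and the sequence of graded $D$-modules $(\hat Q,\hat\delta)$ be as constructed in the context. Then the following statements are equivalent: (1) The central element $z\in D$ is regular in $D$. (2) The sequence of graded $D$-modules $(\hat Q,\hat\delta)$ is a complex. (3) The truncated sequence of graded $D$-modules $\hat Q^3\to\hat Q^2\to\hat Q^1\to\hat Q^0\to 0$ is a complex. (4) $\pi_D(M_3f_2+f_3M_1)=0$ in $D$. (5) The sequence of graded $D$-modules $(\hat Q,\hat\delta)$ is a minimal projective resolution of $K$.
   Context: $K$ is a field and $T=K\langle x_1,\ldots,x_n\rangle$ is the free algebra with its standard grading ($\deg x_i=1$). A graded $K$-algebra is $A=T/\langle r_1,\ldots,r_m\rangle$, where $r_1,\ldots,r_m$ are homogeneous elements of $T$ of degree at least $2$ (no linear relations) forming a minimal set of relations for $A$. A deformation of $A$ is an algebra $U=T/\langle r_1+l_1,\ldots,r_m+l_m\rangle$ where $l_1,\ldots,l_m\in T$ are (not necessarily homogeneous) elements with $\deg(l_i)<\deg(r_i)$ for all $i$. Let $T[z]=T\otimes_K K[z]$, graded with $\deg z=1$. For $f=\sum_{i=0}^p f_i\in T$ with $f_i\in T_i$, $f_p\neq 0$, put $h(f)=\sum_{i=0}^p z^{p-i}f_i$. The central extension of $A$ associated to $U$ is the graded algebra $D=T[z]/\langle h(r_1+l_1),\ldots,h(r_m+l_m)\rangle$; $z\in D_1$ is central and $A=D/Dz$. The element $z$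 is regular in $D$ if it is not a zero divisor. Let $\pi_A:T\to A$ and $\pi_D:T[z]\to D$ be the canonical epimorphisms (applied entrywise to matrices), with $T\subset T[z]$. For a graded vector space $V$, $V(j)$ is $V$ with shifted grading $V(j)_k=V_{j+k}$, and $A(j_1,\ldots,j_p)=\bigoplus_i A(j_i)$ (similarly for $D$). Let $(Q,\delta)$ be a fixed minimal projective resolution by graded-free modules of the trivial graded left $A$-module $K=A/A_+$, written $\cdots\to Q^3\xrightarrow{\delta_3}Q^2\xrightarrow{\delta_2}Q^1\xrightarrow{\delta_1}Q^0\to K\to 0$, with $Q^n=A(m_{1,n},\ldots,m_{t_n,n})$ ($t_n$ may be infinite for $n>2$, but there are finitely many generators in each degree). Choose graded bases and matrices $M_n$ ($t_n\times t_{n-1}$) with homogeneous entries in $T$, the $(i,j)$ entry having degree $m_{i,n}$-compatible degree $m_{j,n-1}-m_{i,n}$, with finitely many nonzero entries in each row, such that $\delta_n$ is right multiplication by $\pi_A(M_n)$. The choices are made so that $Q^0=A$, $Q^1=A(-1,\ldots,-1)$, $M_1=(x_1\,x_2\,\cdots\,x_n)^t$ and $M_2M_1=(r_1,\ldots,r_m)^t$. Let $\hat Q^0=D$ and, for $n\ge 1$, $\hat Q^n=D(m_{1,n},\ldots,m_{t_n,n})\oplus D(m_{1,n-1},\ldots,m_{t_{n-1},n-1})(-1)$. For each $n>1$, let $f_n$ be a $t_n\times t_{n-2}$ matrix with homogeneous entries in $T[z]$, the $(i,j)$ entry having degree $m_{j,n-2}-m_{i,n}-1$, with finitely many nonzero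 entries in each row, satisfying $\pi_D(M_nM_{n-1}-(-1)^{n-1}zf_n)=0$ (such $f_n$ exist; fix a choice). Define $$\hat M_1=\begin{pmatrix}M_1\\ z\end{pmatrix},\qquad \hat M_n=\begin{pmatrix}M_n & f_n\\ (-1)^{n-1}zI_{t_{n-1}} & M_{n-1}\end{pmatrix}\quad (n\ge 2),$$ where $I_t$ is the $t\times t$ identity matrix. Let $\hat\delta_n:\hat Q^n\to\hat Q^{n-1}$ be right multiplication by $\pi_D(\hat M_n)$ for $n\ge 1$, and $\hat\delta_0=0$. Put $\hat Q=\bigoplus_n\hat Q^n$, $\hat\delta=\sum_n\hat\delta_n$. The sequence is a complex if $\hat\delta_{n-1}\hat\delta_n=0$ for all $n$. In (5), $K$ is the trivial graded left $D$-module $D/D_+$. *)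

theory Defs
  imports
    "HOL-Algebra.Algebraic_Closure_Type"
    "HOL-Algebra.Generated_Groups"
    "HOL-Algebra.Module"
    "HOL-Algebra.QuotRing"
    "HOL-Library.Poly_Mapping"
    "HOL-Library.Product_Plus"
    "HOL-Library.Cardinality"
    "HOL-Library.Extended_Nat"
begin

section \<open>The free algebra and its polynomial extension\<close>

text \<open>Words form the free monoid, written additively because \<^typ>\<open>'a \<Rightarrow>\<^sub>0 'b\<close> multiplies by
  convolution over an additive (not necessarily commutative) monoid of exponents.\<close>

datatype 'x fword = FWord (letters: "'x list")

instantiation fword :: (type) monoid_add
begin
definition zero_fword :: "'a fword" where "0 = FWord []"
definition plus_fword :: "'a fword \<Rightarrow> 'a fword \<Rightarrow> 'a fword"
  where "u + v = FWord (letters u @ letters v)"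
instance
  by standard (simp_all add: zero_fword_def plus_fword_def)
end

text \<open>\<open>T = K\<langle>x\<^sub>1,\<dots>,x\<^sub>n\<rangle>\<close> is the monoid algebra of the free monoid on the finite alphabet \<open>'x\<close>;
  \<open>T[z] = T \<otimes> K[z]\<close> is the monoid algebra of the product of the free monoid with \<open>\<nat>\<close>,
  the pair \<open>(w, i)\<close> standing for \<open>w z\<^sup>i\<close>.\<close>

type_synonym ('x, 'k) falg = "'x fword \<Rightarrow>\<^sub>0 'k"
type_synonym ('x, 'k) falgz = "('x fword \<times> nat) \<Rightarrow>\<^sub>0 'k"

abbreviation T_ring :: "('x, 'k::field) falg ring"
  where "T_ring \<equiv> ring_of_type_algebra"

abbreviation Tz_ring :: "('x, 'k::field) falgz ring"
  where "Tz_ring \<equiv> ring_of_type_algebra"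

definition fgen :: "'x \<Rightarrow> ('x, 'k::field) falg"
  where "fgen a = Poly_Mapping.single (FWord [a]) 1"

definition zgen :: "('x, 'k::field) falgz"
  where "zgen = Poly_Mapping.single (0, 1) 1"

definition emb :: "('x, 'k::field) falg \<Rightarrow> ('x, 'k) falgz"
  where "emb f = (\<Sum>w\<in>Poly_Mapping.keys f. Poly_Mapping.single (w, 0) (Poly_Mapping.lookup f w))"

definition T_comp :: "int \<Rightarrow> ('x, 'k::field) falg set"
  where "T_comp d = {f. \<forall>w\<in>Poly_Mapping.keys f. int (length (letters w)) = d}"

definition Tz_comp :: "int \<Rightarrow> ('x, 'k::field) falgz set"
  where "Tz_comp d = {g. \<forall>(w, i)\<in>Poly_Mapping.keys g. int (length (letters w) + i) = d}"

text \<open>The degree, with the convention \<open>deg 0 = 0\<close>; next to relations of degree at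
  least \<open>2\<close>, \<open>deg l < deg r\<close> then holds for \<open>l = 0\<close>, as it should.\<close>

definition fdeg :: "('x, 'k::field) falg \<Rightarrow> nat"
  where "fdeg f = (if f = 0 then 0 else Max ((\<lambda>w. length (letters w)) ` Poly_Mapping.keys f))"

definition fpart :: "nat \<Rightarrow> ('x, 'k::field) falg \<Rightarrow> ('x, 'k) falg"
  where "fpart i f = (\<Sum>w\<in>{w \<in> Poly_Mapping.keys f. length (letters w) = i}.
           Poly_Mapping.single w (Poly_Mapping.lookup f w))"

definition homogenize :: "('x, 'k::field) falg \<Rightarrow> ('x, 'k) falgz"
  where "homogenize f = (\<Sum>i\<le>fdeg f. zgen ^ (fdeg f - i) * emb (fpart i f))"

section \<open>Presented algebras\<close>

definition presented :: "('a, 'm) ring_scheme \<Rightarrow> 'a set \<Rightarrow> 'a set ring"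
  where "presented R S = R Quot (Idl\<^bsub>R\<^esub> S)"

definition pres_proj :: "('a, 'm) ring_scheme \<Rightarrow> 'a set \<Rightarrow> 'a \<Rightarrow> 'a set"
  where "pres_proj R S f = (Idl\<^bsub>R\<^esub> S) +>\<^bsub>R\<^esub> f"

text \<open>\<open>minimal_relations m r\<close>: no \<open>r\<^sub>i\<close> lies in the two-sided ideal generated by the
  others; this also makes the \<open>r\<^sub>i\<close> pairwise distinct.\<close>

definition minimal_relations :: "nat \<Rightarrow> (nat \<Rightarrow> ('x, 'k::field) falg) \<Rightarrow> bool"
  where "minimal_relations m r \<longleftrightarrow> (\<forall>i<m. r i \<notin> Idl\<^bsub>T_ring\<^esub> (r ` ({..<m} - {i})))"

definition A_alg :: "nat \<Rightarrow> (nat \<Rightarrow> ('x, 'k::field) falg) \<Rightarrow> ('x, 'k) falg set ring"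
  where "A_alg m r = presented T_ring (r ` {..<m})"

definition pi_A :: "nat \<Rightarrow> (nat \<Rightarrow> ('x, 'k::field) falg) \<Rightarrow> ('x, 'k) falg \<Rightarrow> ('x, 'k) falg set"
  where "pi_A m r = pres_proj T_ring (r ` {..<m})"

definition A_comp :: "nat \<Rightarrow> (nat \<Rightarrow> ('x, 'k::field) falg) \<Rightarrow> int \<Rightarrow> ('x, 'k) falg set set"
  where "A_comp m r d = pi_A m r ` T_comp d"

definition D_alg :: "nat \<Rightarrow> (nat \<Rightarrow> ('x, 'k::field) falg) \<Rightarrow> (nat \<Rightarrow> ('x, 'k) falg)
    \<Rightarrow> ('x, 'k) falgz set ring"
  where "D_alg m r l = presented Tz_ring ((\<lambda>i. homogenize (r i + l i)) ` {..<m})"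

definition pi_D :: "nat \<Rightarrow> (nat \<Rightarrow> ('x, 'k::field) falg) \<Rightarrow> (nat \<Rightarrow> ('x, 'k) falg)
    \<Rightarrow> ('x, 'k) falgz \<Rightarrow> ('x, 'k) falgz set"
  where "pi_D m r l = pres_proj Tz_ring ((\<lambda>i. homogenize (r i + l i)) ` {..<m})"

definition D_comp :: "nat \<Rightarrow> (nat \<Rightarrow> ('x, 'k::field) falg) \<Rightarrow> (nat \<Rightarrow> ('x, 'k) falg)
    \<Rightarrow> int \<Rightarrow> ('x, 'k) falgz set set"
  where "D_comp m r l d = pi_D m r l ` Tz_comp d"

definition ring_regular :: "('a, 'm) ring_scheme \<Rightarrow> 'a \<Rightarrow> bool"
  where "ring_regular R a \<longleftrightarrow> a \<in> carrier R \<and>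
    (\<forall>b\<in>carrier R. a \<otimes>\<^bsub>R\<^esub> b = \<zero>\<^bsub>R\<^esub> \<or> b \<otimes>\<^bsub>R\<^esub> a = \<zero>\<^bsub>R\<^esub> \<longrightarrow> b = \<zero>\<^bsub>R\<^esub>)"

section \<open>Graded left modules\<close>

text \<open>The locale \<open>module\<close> of \<open>HOL-Algebra\<close> is restricted to commutative rings, so left modules
  are introduced here on top of its record type. The fields \<open>mult\<close> and \<open>one\<close> inherited from
  the ring record carry no meaning for a module. Throughout, \<open>R\<close> is a ring and
  \<open>G k\<close> its homogeneous component of degree \<open>k\<close>.\<close>

record ('a, 'b) graded_module = "('a, 'b) module" +
  mcomp :: "int \<Rightarrow> 'b set"

locale left_module = R?: ring R + M?: abelian_group M
  for R :: "('a, 'r) ring_scheme" (structure) and M :: "('a, 'b, 'm) module_scheme" (structure) +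
  assumes lsmult_closed: "\<lbrakk>a \<in> carrier R; x \<in> carrier M\<rbrakk> \<Longrightarrow> a \<odot>\<^bsub>M\<^esub> x \<in> carrier M"
    and lsmult_l_distr: "\<lbrakk>a \<in> carrier R; b \<in> carrier R; x \<in> carrier M\<rbrakk> \<Longrightarrow>
      (a \<oplus>\<^bsub>R\<^esub> b) \<odot>\<^bsub>M\<^esub> x = a \<odot>\<^bsub>M\<^esub> x \<oplus>\<^bsub>M\<^esub> b \<odot>\<^bsub>M\<^esub> x"
    and lsmult_r_distr: "\<lbrakk>a \<in> carrier R; x \<in> carrier M; y \<in> carrier M\<rbrakk> \<Longrightarrow>
      a \<odot>\<^bsub>M\<^esub> (x \<oplus>\<^bsub>M\<^esub> y) = a \<odot>\<^bsub>M\<^esub> x \<oplus>\<^bsub>M\<^esub> a \<odot>\<^bsub>M\<^esub> y"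
    and lsmult_assoc: "\<lbrakk>a \<in> carrier R; b \<in> carrier R; x \<in> carrier M\<rbrakk> \<Longrightarrow>
      (a \<otimes>\<^bsub>R\<^esub> b) \<odot>\<^bsub>M\<^esub> x = a \<odot>\<^bsub>M\<^esub> (b \<odot>\<^bsub>M\<^esub> x)"
    and lsmult_one: "x \<in> carrier M \<Longrightarrow> \<one>\<^bsub>R\<^esub> \<odot>\<^bsub>M\<^esub> x = x"

text \<open>\<open>M\<close> is the internal direct sum of the additive subgroups \<open>H k\<close>.\<close>

definition direct_grading :: "('b, 'm) ring_scheme \<Rightarrow> (int \<Rightarrow> 'b set) \<Rightarrow> bool"
  where "direct_grading M H \<longleftrightarrow>
    (\<forall>k. subgroup (H k) (add_monoid M)) \<and>
    (\<forall>x\<in>carrier M. \<exists>!c. (\<forall>k. c k \<in> H k) \<and> finite {k. c k \<noteq> \<zero>\<^bsub>M\<^esub>} \<and>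
       x = (\<Oplus>\<^bsub>M\<^esub>k\<in>{k. c k \<noteq> \<zero>\<^bsub>M\<^esub>}. c k))"

definition graded_left_module ::
    "('a, 'm) ring_scheme \<Rightarrow> (int \<Rightarrow> 'a set) \<Rightarrow> ('a, 'b) graded_module \<Rightarrow> bool"
  where "graded_left_module R G M \<longleftrightarrow> left_module R M \<and> direct_grading M (mcomp M) \<and>
    (\<forall>i j. \<forall>a\<in>G i. \<forall>x\<in>mcomp M j. a \<odot>\<^bsub>M\<^esub> x \<in> mcomp M (i + j))"

definition graded_hom :: "('a, 'm) ring_scheme \<Rightarrow> ('a, 'b) graded_module \<Rightarrow> ('a, 'c) graded_module
    \<Rightarrow> ('b \<Rightarrow> 'c) set"
  where "graded_hom R M N = {f. f \<in> carrier M \<rightarrow> carrier N \<and>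
    (\<forall>x\<in>carrier M. \<forall>y\<in>carrier M. f (x \<oplus>\<^bsub>M\<^esub> y) = f x \<oplus>\<^bsub>N\<^esub> f y) \<and>
    (\<forall>a\<in>carrier R. \<forall>x\<in>carrier M. f (a \<odot>\<^bsub>M\<^esub> x) = a \<odot>\<^bsub>N\<^esub> f x) \<and>
    (\<forall>k. f ` mcomp M k \<subseteq> mcomp N k)}"

text \<open>The graded-free module \<open>\<Oplus>\<^sub>i\<^sub>\<in>\<^sub>I R(s\<^sub>i)\<close>, where \<open>R(s)\<^sub>k = R\<^sub>s\<^sub>+\<^sub>k\<close>: row vectors of finite
  support, extended by zero outside the index set.\<close>

definition graded_free :: "('a, 'm) ring_scheme \<Rightarrow> (int \<Rightarrow> 'a set) \<Rightarrow> 'i set \<Rightarrow> ('i \<Rightarrow> int)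
    \<Rightarrow> ('a, 'i \<Rightarrow> 'a) graded_module"
  where "graded_free R G I s =
    (let V = {v. (\<forall>i\<in>I. v i \<in> carrier R) \<and> (\<forall>i. i \<notin> I \<longrightarrow> v i = \<zero>\<^bsub>R\<^esub>) \<and>
                 finite {i. v i \<noteq> \<zero>\<^bsub>R\<^esub>}}
     in \<lparr>carrier = V, monoid.mult = undefined, one = undefined,
         ring.zero = (\<lambda>_. \<zero>\<^bsub>R\<^esub>), add = (\<lambda>v w i. v i \<oplus>\<^bsub>R\<^esub> w i),
         module.smult = (\<lambda>a v i. a \<otimes>\<^bsub>R\<^esub> v i),
         mcomp = (\<lambda>k. {v \<in> V. \<forall>i\<in>I. v i \<in> G (s i + k)})\<rparr>)"

text \<open>Right multiplication of a row vector of finite support by a matrix.\<close>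

definition right_mult :: "('a, 'm) ring_scheme \<Rightarrow> ('i \<Rightarrow> 'j \<Rightarrow> 'a) \<Rightarrow> ('i \<Rightarrow> 'a) \<Rightarrow> 'j \<Rightarrow> 'a"
  where "right_mult R N v = (\<lambda>j. \<Oplus>\<^bsub>R\<^esub>i\<in>{i. v i \<noteq> \<zero>\<^bsub>R\<^esub>}. v i \<otimes>\<^bsub>R\<^esub> N i j)"

text \<open>The augmentation ideal \<open>R\<^sub>+\<close>, the product \<open>R\<^sub>+ M\<close>, and the trivial module \<open>R / R\<^sub>+\<close>.\<close>

definition plus_ideal :: "('a, 'm) ring_scheme \<Rightarrow> (int \<Rightarrow> 'a set) \<Rightarrow> 'a set"
  where "plus_ideal R G = generate (add_monoid R) (\<Union>k\<in>{0<..}. G k)"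

definition plus_submodule ::
    "('a, 'm) ring_scheme \<Rightarrow> (int \<Rightarrow> 'a set) \<Rightarrow> ('a, 'b) graded_module \<Rightarrow> 'b set"
  where "plus_submodule R G M =
    generate (add_monoid M) {a \<odot>\<^bsub>M\<^esub> x | a x. a \<in> plus_ideal R G \<and> x \<in> carrier M}"

definition trivial_module ::
    "('a, 'm) ring_scheme \<Rightarrow> (int \<Rightarrow> 'a set) \<Rightarrow> ('a, 'a set) graded_module"
  where "trivial_module R G =
    (let P = plus_ideal R G; Q = R Quot P
     in \<lparr>carrier = carrier Q, monoid.mult = undefined, one = undefined,
         ring.zero = \<zero>\<^bsub>Q\<^esub>, add = add Q,
         module.smult = (\<lambda>a y. (P +>\<^bsub>R\<^esub> a) \<otimes>\<^bsub>Q\<^esub> y),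
         mcomp = (\<lambda>k. (\<lambda>a. P +>\<^bsub>R\<^esub> a) ` G k)\<rparr>)"

text \<open>Projective means: a direct summand of a graded-free module. Indexing the free module by a
  set of elements of type \<open>'b\<close> is no restriction, since a set of homogeneous
  generators of \<open>M\<close> suffices.\<close>

definition graded_projective ::
    "('a, 'm) ring_scheme \<Rightarrow> (int \<Rightarrow> 'a set) \<Rightarrow> ('a, 'b) graded_module \<Rightarrow> bool"
  where "graded_projective R G M \<longleftrightarrow>
    (\<exists>(I :: 'b set) s. \<exists>f \<in> graded_hom R M (graded_free R G I s).
       \<exists>g \<in> graded_hom R (graded_free R G I s) M. \<forall>x\<in>carrier M. g (f x) = x)"

text \<open>\<open>\<cdots> \<rightarrow> P 1 \<rightarrow> P 0 \<rightarrow> N \<rightarrow> 0\<close> is exact, with \<open>d n : P n \<rightarrow> P (n - 1)\<close> for \<open>n \<ge> 1\<close>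
  (the value \<open>d 0\<close> is not used). It is minimal if the image of
  each \<open>d n\<close> lies in \<open>R\<^sub>+ P (n - 1)\<close>.\<close>

definition projective_resolution :: "('a, 'm) ring_scheme \<Rightarrow> (int \<Rightarrow> 'a set)
    \<Rightarrow> (nat \<Rightarrow> ('a, 'b) graded_module) \<Rightarrow> (nat \<Rightarrow> 'b \<Rightarrow> 'b) \<Rightarrow> ('a, 'c) graded_module \<Rightarrow> bool"
  where "projective_resolution R G P d N \<longleftrightarrow>
    (\<forall>n. graded_left_module R G (P n) \<and> graded_projective R G (P n)) \<and>
    (\<forall>n\<ge>1. d n \<in> graded_hom R (P n) (P (n - 1))) \<and>
    (\<forall>n\<ge>1. d (n + 1) ` carrier (P (n + 1)) =
       {x \<in> carrier (P n). d n x = \<zero>\<^bsub>P (n - 1)\<^esub>}) \<and>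
    (\<exists>\<epsilon> \<in> graded_hom R (P 0) N. \<epsilon> ` carrier (P 0) = carrier N \<and>
       d 1 ` carrier (P 1) = {x \<in> carrier (P 0). \<epsilon> x = \<zero>\<^bsub>N\<^esub>})"

definition minimal_projective_resolution :: "('a, 'm) ring_scheme \<Rightarrow> (int \<Rightarrow> 'a set)
    \<Rightarrow> (nat \<Rightarrow> ('a, 'b) graded_module) \<Rightarrow> (nat \<Rightarrow> 'b \<Rightarrow> 'b) \<Rightarrow> ('a, 'c) graded_module \<Rightarrow> bool"
  where "minimal_projective_resolution R G P d N \<longleftrightarrow>
    projective_resolution R G P d N \<and>
    (\<forall>n\<ge>1. d n ` carrier (P n) \<subseteq> plus_submodule R G (P (n - 1)))"

section \<open>Matrices and the two sequences\<close>

text \<open>A \<open>p \<times> q\<close> matrix (with \<open>p\<close>, \<open>q\<close> possibly infinite, indices starting at \<open>0\<close>) having finitely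
  many nonzero entries in each row, extended by zero outside its index range.\<close>

definition row_finite_matrix :: "enat \<Rightarrow> enat \<Rightarrow> (nat \<Rightarrow> nat \<Rightarrow> 'a::zero) \<Rightarrow> bool"
  where "row_finite_matrix p q N \<longleftrightarrow>
    (\<forall>i j. N i j \<noteq> 0 \<longrightarrow> enat i < p \<and> enat j < q) \<and> (\<forall>i. finite {j. N i j \<noteq> 0})"

definition mat_mult :: "('i \<Rightarrow> 'j \<Rightarrow> 'a) \<Rightarrow> ('j \<Rightarrow> 'k \<Rightarrow> 'a) \<Rightarrow> 'i \<Rightarrow> 'k \<Rightarrow> 'a::semiring_0"
  where "mat_mult N N' = (\<lambda>i k. \<Sum>j\<in>{j. N i j \<noteq> 0}. N i j * N' j k)"

definition emb_mat :: "('i \<Rightarrow> 'j \<Rightarrow> ('x, 'k::field) falg) \<Rightarrow> 'i \<Rightarrow> 'j \<Rightarrow> ('x, 'k) falgz"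
  where "emb_mat N = (\<lambda>i j. emb (N i j))"

text \<open>\<open>t n\<close> is the rank of \<open>Q\<^sup>n\<close> and \<open>s n i\<close> is the shift \<open>m\<^sub>i\<^sub>,\<^sub>n\<close>.\<close>

definition Q_mod :: "nat \<Rightarrow> (nat \<Rightarrow> ('x, 'k::field) falg) \<Rightarrow> (nat \<Rightarrow> enat) \<Rightarrow> (nat \<Rightarrow> nat \<Rightarrow> int)
    \<Rightarrow> nat \<Rightarrow> (('x, 'k) falg set, nat \<Rightarrow> ('x, 'k) falg set) graded_module"
  where "Q_mod m r t s n = graded_free (A_alg m r) (A_comp m r) {i. enat i < t n} (s n)"

definition Q_delta :: "nat \<Rightarrow> (nat \<Rightarrow> ('x, 'k::field) falg)
    \<Rightarrow> (nat \<Rightarrow> nat \<Rightarrow> nat \<Rightarrow> ('x, 'k) falg)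
    \<Rightarrow> nat \<Rightarrow> (nat \<Rightarrow> ('x, 'k) falg set) \<Rightarrow> nat \<Rightarrow> ('x, 'k) falg set"
  where "Q_delta m r M n = right_mult (A_alg m r) (\<lambda>i j. pi_A m r (M n i j))"

text \<open>The basis of \<open>D(m\<^sub>1\<^sub>,\<^sub>n, \<dots>) \<oplus> D(m\<^sub>1\<^sub>,\<^sub>n\<^sub>-\<^sub>1, \<dots>)(-1)\<close> is indexed by a disjoint sum, \<open>Inl\<close> for the
  first and \<open>Inr\<close> for the second block; the second block is absent for \<open>n = 0\<close>.\<close>

definition hatQ_mod :: "nat \<Rightarrow> (nat \<Rightarrow> ('x, 'k::field) falg) \<Rightarrow> (nat \<Rightarrow> ('x, 'k) falg)
    \<Rightarrow> (nat \<Rightarrow> enat) \<Rightarrow> (nat \<Rightarrow> nat \<Rightarrow> int)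
    \<Rightarrow> nat \<Rightarrow> (('x, 'k) falgz set, nat + nat \<Rightarrow> ('x, 'k) falgz set) graded_module"
  where "hatQ_mod m r l t s n = graded_free (D_alg m r l) (D_comp m r l)
    ({i. enat i < t n} <+> (if n = 0 then {} else {i. enat i < t (n - 1)}))
    (case_sum (s n) (\<lambda>i. s (n - 1) i - 1))"

text \<open>The left blocks of \<open>hat_mat\<close> cover \<open>n = 1\<close> as well, where there is no right block.\<close>

definition hat_mat :: "(nat \<Rightarrow> enat) \<Rightarrow> (nat \<Rightarrow> nat \<Rightarrow> nat \<Rightarrow> ('x, 'k::field) falg)
    \<Rightarrow> (nat \<Rightarrow> nat \<Rightarrow> nat \<Rightarrow> ('x, 'k) falgz)
    \<Rightarrow> nat \<Rightarrow> nat + nat \<Rightarrow> nat + nat \<Rightarrow> ('x, 'k) falgz"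
  where "hat_mat t M f n = (\<lambda>a b. case (a, b) of
      (Inl i, Inl j) \<Rightarrow> emb (M n i j)
    | (Inr i, Inl j) \<Rightarrow> if i = j \<and> enat i < t (n - 1) then (- 1) ^ (n - 1) * zgen else 0
    | (Inl i, Inr j) \<Rightarrow> if n \<ge> 2 then f n i j else 0
    | (Inr i, Inr j) \<Rightarrow> if n \<ge> 2 then emb (M (n - 1) i j) else 0)"

definition hat_delta :: "nat \<Rightarrow> (nat \<Rightarrow> ('x, 'k::field) falg) \<Rightarrow> (nat \<Rightarrow> ('x, 'k) falg)
    \<Rightarrow> (nat \<Rightarrow> enat) \<Rightarrow> (nat \<Rightarrow> nat \<Rightarrow> nat \<Rightarrow> ('x, 'k) falg)
    \<Rightarrow> (nat \<Rightarrow> nat \<Rightarrow> nat \<Rightarrow> ('x, 'k) falgz)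
    \<Rightarrow> nat \<Rightarrow> (nat + nat \<Rightarrow> ('x, 'k) falgz set) \<Rightarrow> nat + nat \<Rightarrow> ('x, 'k) falgz set"
  where "hat_delta m r l t M f n =
    (if n = 0 then (\<lambda>_ _. \<zero>\<^bsub>D_alg m r l\<^esub>)
     else right_mult (D_alg m r l) (\<lambda>a b. pi_D m r l (hat_mat t M f n a b)))"

end

theory Submission
  imports Defs
begin

text \<open>
  Modulo the defining ideal of \<open>D\<close>, the block product \<open>H n * H (n - 1)\<close> of consecutive matrices of
  the sequence \<open>Q^\<close> vanishes in three of its four blocks, by the choice of the \<open>f n\<close> and because \<open>z\<close> is central. The remaining
  block is the \<^emph>\<open>obstruction\<close> \<open>M n * f (n - 1) + f n * M (n - 2)\<close>. Comparing the two ways of bracketing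
  \<open>H n * H (n - 1) * H (n - 2)\<close> shows that \<open>z\<close> annihilates every obstruction. Hence, if \<open>z\<close> is regular,
  all obstructions vanish and \<open>Q^\<close> is a complex; and the obstruction for \<open>n = 3\<close> is the matrix
  of \<open>S4\<close>.

  Exactness rests on one reduction (\<open>cycle_reduction\<close>). If \<open>(a, b)\<close> is a cycle in \<open>Q^\<close> of degree
  \<open>n \<ge> 1\<close>, then \<open>a\<close> becomes a cycle of \<open>Q\<close> over \<open>A = D / D z\<close>, so \<open>a = c * M (n + 1) + z * e\<close>, because \<open>Q\<close>
  is exact. Subtracting \<open>(c, \<plusminus> e) * H (n + 1)\<close>, which is itself a cycle as soon as the obstruction
  vanishes, leaves a cycle \<open>(0, b')\<close>, and this forces \<open>z * b' = 0\<close>. If \<open>z\<close> is regular, \<open>b'\<close> is zero,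
  and \<open>(a, b)\<close> is a boundary. Minimality amounts to the entries of \<open>H n\<close> having no constant term.
  For \<open>f n\<close> this uses regularity once more: where the degree of an entry is zero, the corresponding
  entry of \<open>M n * M (n - 1)\<close> is zero for degree reasons, so \<open>z\<close> annihilates that entry of \<open>f n\<close>.

  The same reduction shows that \<open>S4\<close> implies \<open>S1\<close>. The algebra \<open>D\<close> is presented by the generators \<open>x\<^sub>i, z\<close>, and the rows
  of \<open>H 2\<close> are its relations, so \<open>Q^\<close> is exact in degree \<open>1\<close> whether \<open>z\<close> is regular or not
  (\<open>exact_at_hatQ_1\<close>). Let \<open>y\<close> be homogeneous of degree \<open>k\<close> with \<open>z * y = 0\<close>, and assume that \<open>z\<close> annihilates
  no nonzero element of smaller degree. Then \<open>(0, y)\<close> is a cycle in degree \<open>1\<close>, hence the image of some \<open>w\<close>. The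
  left coordinates of this image vanish, which is all that the reduction asks of \<open>w\<close>; it replaces \<open>w\<close> by some \<open>(0, b')\<close>
  with \<open>z * b' = 0\<close> and \<open>y = \<Sum>\<^sub>i b'\<^sub>i x\<^sub>i\<close>. The \<open>b'\<^sub>i\<close> may be taken of degree \<open>k - 1\<close>, so they vanish, and \<open>y = 0\<close>.

  Exactness in degree \<open>1\<close> needs the elements \<open>r\<^sub>i + z * f 2 i 0\<close> given by the rows of \<open>H 2\<close> to generate the
  same ideal as the homogenized relations. This is where minimality of the relations enters
  (\<open>zero_symbol_in_lower_ideal\<close>).

  All computations take place in the free algebras, with membership in an ideal in place of
  equality in the quotient, so that matrices and rows have entries in a type class of rings.
\<close>

section \<open>Ideals, rows and presented algebras\<close>

definition two_sided :: "'a::ring_1 set \<Rightarrow> bool"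
  where "two_sided J \<longleftrightarrow> 0 \<in> J \<and> (\<forall>a\<in>J. \<forall>b\<in>J. a + b \<in> J) \<and> (\<forall>a\<in>J. \<forall>u. u * a \<in> J \<and> a * u \<in> J)"

lemma ring_of_type_ring: "ring (ring_of_type_algebra :: 'a::ring_1 ring)"
proof -
  have "\<exists>y. x + y = 0" for x :: 'a
    using add.right_inverse by blast
  thus ?thesis
    unfolding ring_of_type_algebra_def using add.right_inverse
    by unfold_locales (auto simp: algebra_simps Units_def)
qed

lemma ring_of_type_simps [simp]:
  "carrier ring_of_type_algebra = UNIV"
  "x \<otimes>\<^bsub>ring_of_type_algebra\<^esub> y = x * y"
  "x \<oplus>\<^bsub>ring_of_type_algebra\<^esub> y = x + y"
  "\<one>\<^bsub>ring_of_type_algebra\<^esub> = 1"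
  "\<zero>\<^bsub>ring_of_type_algebra\<^esub> = 0"
  by (simp_all add: ring_of_type_algebra_def)

lemma two_sidedI:
  assumes "0 \<in> J" "\<And>a b. a \<in> J \<Longrightarrow> b \<in> J \<Longrightarrow> a + b \<in> J"
    "\<And>u a. a \<in> J \<Longrightarrow> u * a \<in> J" "\<And>u a. a \<in> J \<Longrightarrow> a * u \<in> J"
  shows "two_sided J"
  using assms by (auto simp: two_sided_def)

context
  fixes J :: "'a::ring_1 set"
  assumes J: "two_sided J"
begin

lemma two_sided_0: "0 \<in> J" using J by (auto simp: two_sided_def)
lemma two_sided_add: "a \<in> J \<Longrightarrow> b \<in> J \<Longrightarrow> a + b \<in> J" using J by (auto simp: two_sided_def)
lemma two_sided_left: "a \<in> J \<Longrightarrow> u * a \<in> J" using J by (auto simp: two_sided_def)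
lemma two_sided_right: "a \<in> J \<Longrightarrow> a * u \<in> J" using J by (auto simp: two_sided_def)
lemma two_sided_uminus: "a \<in> J \<Longrightarrow> - a \<in> J" using two_sided_left[of a "-1"] by simp
lemma two_sided_diff: "a \<in> J \<Longrightarrow> b \<in> J \<Longrightarrow> a - b \<in> J"
  using two_sided_add[of a "- b"] two_sided_uminus by simp
lemma two_sided_sum: "(\<And>i. i \<in> A \<Longrightarrow> g i \<in> J) \<Longrightarrow> sum g A \<in> J"
  by (induction A rule: infinite_finite_induct) (auto intro: two_sided_0 two_sided_add)

end

text \<open>The library ideals of the ring record of a type are two-sided, also over a noncommutative ring;
  this makes its generated ideals and quotients available to elements of the type.\<close>

lemma ideal_type_iff: "ideal J (ring_of_type_algebra :: 'a::ring_1 ring) \<longleftrightarrow> two_sided J"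
proof
  assume "ideal J (ring_of_type_algebra :: 'a ring)"
  then interpret ideal J "ring_of_type_algebra :: 'a ring" .
  show "two_sided J"
    using I_l_closed I_r_closed additive_subgroup.zero_closed[OF is_additive_subgroup]
      additive_subgroup.a_closed[OF is_additive_subgroup] by (auto simp: two_sided_def)
next
  assume J: "two_sided J"
  have inv: "\<ominus>\<^bsub>ring_of_type_algebra\<^esub> x = - x" for x :: 'a
    by (metis (no_types, lifting) UNIV_I abelian_group.minus_equality add.left_inverse
        ring.is_abelian_group ring_of_type_ring ring_of_type_simps(1,3,5))
  show "ideal J (ring_of_type_algebra :: 'a ring)"
  proof (rule idealI[OF ring_of_type_ring])
    show "subgroup J (add_monoid (ring_of_type_algebra :: 'a ring))"
    proof (rule subgroup.intro)
      fix x assume "x \<in> J"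
      then show "inv\<^bsub>add_monoid (ring_of_type_algebra :: 'a ring)\<^esub> x \<in> J"
        using inv two_sided_uminus[OF J] unfolding a_inv_def by (simp only:)
    qed (use J in \<open>auto simp: two_sided_0 two_sided_add\<close>)
  qed (use J in \<open>auto simp: two_sided_left two_sided_right\<close>)
qed

abbreviation gen_ideal :: "'a::ring_1 set \<Rightarrow> 'a set"
  where "gen_ideal S \<equiv> Idl\<^bsub>ring_of_type_algebra\<^esub> S"

lemma two_sided_gen_ideal: "two_sided (gen_ideal S)"
  using ring.genideal_ideal[OF ring_of_type_ring, of S] by (simp add: ideal_type_iff)

lemma gen_ideal_base: "s \<in> S \<Longrightarrow> s \<in> gen_ideal S"
  using ring.genideal_self[OF ring_of_type_ring, of S] by auto

lemma gen_ideal_least: "two_sided J \<Longrightarrow> S \<subseteq> J \<Longrightarrow> gen_ideal S \<subseteq> J"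
  using ring.genideal_minimal[OF ring_of_type_ring] by (simp add: ideal_type_iff)

definition row_mult :: "('i \<Rightarrow> 'a) \<Rightarrow> ('i \<Rightarrow> 'j \<Rightarrow> 'a) \<Rightarrow> 'j \<Rightarrow> 'a::semiring_0"
  where "row_mult v N = (\<lambda>j. \<Sum>i\<in>{i. v i \<noteq> 0}. v i * N i j)"

definition fin_supp :: "('i \<Rightarrow> 'a::zero) \<Rightarrow> bool"
  where "fin_supp v \<longleftrightarrow> finite {i. v i \<noteq> 0}"

lemma mat_mult_row: "mat_mult N N' i = row_mult (N i) N'"
  by (simp add: mat_mult_def row_mult_def)

text \<open>The sum defining a product ranges over the support of the row; to add rows, it must be taken over a
  common finite set.\<close>

lemma row_mult_sum:
  assumes "finite B" "{i. v i \<noteq> 0} \<subseteq> B"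
  shows "row_mult v N j = (\<Sum>i\<in>B. v i * N i j)"
  unfolding row_mult_def by (rule sum.mono_neutral_left) (use assms in auto)

lemma fin_supp_add: "fin_supp v \<Longrightarrow> fin_supp w \<Longrightarrow> fin_supp (\<lambda>i. v i + w i :: 'a::monoid_add)"
  unfolding fin_supp_def by (rule finite_subset[of _ "{i. v i \<noteq> 0} \<union> {i. w i \<noteq> 0}"]) auto

lemma fin_supp_diff: "fin_supp v \<Longrightarrow> fin_supp w \<Longrightarrow> fin_supp (\<lambda>i. v i - w i :: 'a::ab_group_add)"
  unfolding fin_supp_def by (rule finite_subset[of _ "{i. v i \<noteq> 0} \<union> {i. w i \<noteq> 0}"]) auto

lemma fin_supp_mult: "fin_supp v \<Longrightarrow> fin_supp (\<lambda>i. u * v i :: 'a::semiring_0)"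
  unfolding fin_supp_def by (rule finite_subset[of _ "{i. v i \<noteq> 0}"]) auto

lemma row_mult_add:
  assumes "fin_supp v" "fin_supp w"
  shows "row_mult (\<lambda>i. v i + w i) N j = row_mult v N j + row_mult w N j"
proof -
  let ?B = "{i. v i \<noteq> 0} \<union> {i. w i \<noteq> 0}"
  have "finite ?B" using assms by (simp add: fin_supp_def)
  then show ?thesis
    by (subst (1 2 3) row_mult_sum[of ?B]) (auto simp: sum.distrib distrib_right)
qed

lemma row_mult_diff:
  fixes v :: "'i \<Rightarrow> 'a::ring"
  assumes "fin_supp v" "fin_supp w"
  shows "row_mult (\<lambda>i. v i - w i) N j = row_mult v N j - row_mult w N j"
proof -
  let ?B = "{i. v i \<noteq> 0} \<union> {i. w i \<noteq> 0}"
  have "finite ?B" using assms by (simp add: fin_supp_def)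
  then show ?thesis
    by (subst (1 2 3) row_mult_sum[of ?B]) (auto simp: sum_subtractf left_diff_distrib)
qed

lemma row_mult_scale:
  assumes "fin_supp v"
  shows "row_mult (\<lambda>i. u * v i) N j = u * row_mult v N j"
proof -
  have "finite {i. v i \<noteq> 0}" using assms by (simp add: fin_supp_def)
  then show ?thesis
    by (subst (1 2) row_mult_sum[of "{i. v i \<noteq> 0}"]) (auto simp: sum_distrib_left mult.assoc)
qed

lemma fin_supp_row_mult:
  assumes "fin_supp v" "\<And>i. fin_supp (N i)"
  shows "fin_supp (row_mult v N)"
proof -
  have "{j. row_mult v N j \<noteq> 0} \<subseteq> (\<Union>i\<in>{i. v i \<noteq> 0}. {j. N i j \<noteq> 0})"
    unfolding row_mult_def by (auto elim!: sum.not_neutral_contains_not_neutral)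
  moreover have "finite (\<Union>i\<in>{i. v i \<noteq> 0}. {j. N i j \<noteq> 0})"
    using assms by (auto simp: fin_supp_def)
  ultimately show ?thesis unfolding fin_supp_def by (rule finite_subset)
qed

lemma row_mult_assoc:
  assumes "fin_supp v" "\<And>i. fin_supp (N i)"
  shows "row_mult (row_mult v N) N' k = row_mult v (mat_mult N N') k"
proof -
  let ?A = "{i. v i \<noteq> 0}" and ?B = "(\<Union>i\<in>{i. v i \<noteq> 0}. {j. N i j \<noteq> 0})"
  have fin: "finite ?A" "finite ?B" using assms by (auto simp: fin_supp_def)
  have sub: "{j. row_mult v N j \<noteq> 0} \<subseteq> ?B"
    unfolding row_mult_def by (auto elim!: sum.not_neutral_contains_not_neutral)
  have "row_mult (row_mult v N) N' k = (\<Sum>j\<in>?B. (\<Sum>i\<in>?A. v i * N i j) * N' j k)"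
    by (subst row_mult_sum[OF fin(2) sub]) (simp add: row_mult_def)
  also have "\<dots> = (\<Sum>i\<in>?A. \<Sum>j\<in>?B. v i * (N i j * N' j k))"
    by (subst sum.swap) (simp add: sum_distrib_right mult.assoc)
  also have "\<dots> = (\<Sum>i\<in>?A. v i * row_mult (N i) N' k)"
    by (intro sum.cong refl, subst row_mult_sum[OF fin(2)]) (auto simp: sum_distrib_left)
  finally show ?thesis by (simp add: row_mult_def[of v] mat_mult_row)
qed

lemma row_mult_in_ideal_left:
  assumes "two_sided J" "\<And>i. v i \<in> J"
  shows "row_mult v N j \<in> J"
  unfolding row_mult_def using assms by (auto intro!: two_sided_sum two_sided_right)

lemma row_mult_in_ideal_right:
  assumes "two_sided J" "\<And>i. v i \<noteq> 0 \<Longrightarrow> N i j \<in> J"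
  shows "row_mult v N j \<in> J"
  unfolding row_mult_def using assms by (auto intro!: two_sided_sum two_sided_left)

lemma row_mult_outside:
  assumes "\<And>i j. N i j \<noteq> 0 \<Longrightarrow> j \<in> I'" "j \<notin> I'"
  shows "row_mult p N j = 0"
proof -
  have "N i j = 0" for i using assms by blast
  then show ?thesis by (simp add: row_mult_def)
qed

lemma row_mult_unit:
  fixes N :: "'i \<Rightarrow> 'j \<Rightarrow> 'a::semiring_1"
  shows "row_mult (\<lambda>k. if k = i then u else 0) N j = u * N i j"
  by (subst row_mult_sum[of "{i}"]) auto

lemma fin_supp_unit: "fin_supp (\<lambda>k. if k = i then u else 0)"
  unfolding fin_supp_def by (rule finite_subset[of _ "{i}"]) auto

text \<open>One generating set \<open>S\<close> at a time: the locale is used for both \<open>A\<close> and \<open>D\<close>, and moves every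
  question about the quotient to elements of the type and membership in \<open>J\<close>.\<close>

locale presentation =
  fixes S :: "'a::ring_1 set"
begin

abbreviation J where "J \<equiv> gen_ideal S"
abbreviation R where "R \<equiv> presented (ring_of_type_algebra :: 'a ring) S"
abbreviation \<pi> where "\<pi> \<equiv> pres_proj (ring_of_type_algebra :: 'a ring) S"

lemma two_sided_J: "two_sided J" by (rule two_sided_gen_ideal)

sublocale idl: ideal J "ring_of_type_algebra :: 'a ring"
  by (simp add: ideal_type_iff two_sided_J)

sublocale ring R
  unfolding presented_def by (rule idl.quotient_is_ring)

lemma carrier_R: "carrier R = range \<pi>"
  by (auto simp: presented_def pres_proj_def FactRing_def A_RCOSETS_def' )

lemma \<pi>_closed [simp, intro]: "\<pi> p \<in> carrier R" by (simp add: carrier_R)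

lemma \<pi>_add: "\<pi> (p + q) = \<pi> p \<oplus>\<^bsub>R\<^esub> \<pi> q"
  using ring_hom_add[OF idl.rcos_ring_hom, of p q] by (simp add: presented_def pres_proj_def)
lemma \<pi>_mult: "\<pi> (p * q) = \<pi> p \<otimes>\<^bsub>R\<^esub> \<pi> q"
  using ring_hom_mult[OF idl.rcos_ring_hom, of p q] by (simp add: presented_def pres_proj_def)
lemma \<pi>_zero_iff: "\<pi> p = \<zero>\<^bsub>R\<^esub> \<longleftrightarrow> p \<in> J"
proof -
  have "\<pi> p = \<zero>\<^bsub>R\<^esub> \<longleftrightarrow> J +>\<^bsub>ring_of_type_algebra\<^esub> p = J"
    by (simp add: pres_proj_def presented_def FactRing_def)
  also have "\<dots> \<longleftrightarrow> p \<in> J"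
    using idl.a_rcos_const idl.a_rcos_self[of p] by auto
  finally show ?thesis .
qed

lemma \<pi>_0 [simp]: "\<pi> 0 = \<zero>\<^bsub>R\<^esub>"
  by (simp add: \<pi>_zero_iff two_sided_0[OF two_sided_J])

lemma \<pi>_uminus: "\<pi> (- p) = \<ominus>\<^bsub>R\<^esub> \<pi> p"
  by (metis \<pi>_0 \<pi>_add \<pi>_closed add.left_inverse minus_equality)

lemma \<pi>_eq_iff: "\<pi> p = \<pi> q \<longleftrightarrow> p - q \<in> J"
proof -
  have "p - q \<in> J \<longleftrightarrow> \<pi> p \<oplus>\<^bsub>R\<^esub> (\<ominus>\<^bsub>R\<^esub> \<pi> q) = \<zero>\<^bsub>R\<^esub>"
    by (simp add: \<pi>_add \<pi>_uminus flip: \<pi>_zero_iff) (metis \<pi>_add \<pi>_uminus diff_conv_add_uminus)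
  also have "\<dots> \<longleftrightarrow> \<pi> p = \<pi> q"
    by (metis \<pi>_closed a_inv_closed minus_equality minus_minus r_neg)
  finally show ?thesis by simp
qed

lemma \<pi>_sum: "\<pi> (sum g A) = (\<Oplus>\<^bsub>R\<^esub>i\<in>A. \<pi> (g i))"
proof (induction A rule: infinite_finite_induct)
  case (insert a A)
  then show ?case by (simp add: \<pi>_add Pi_I)
qed (auto simp: finsum_infinite)

text \<open>Zero is lifted to zero, so that a lift of a row of finite support has finite support.\<close>

lemma obtain_lift:
  assumes "\<And>i. v i \<in> carrier R"
  obtains p where "\<And>i. \<pi> (p i) = v i" "\<And>i. v i = \<zero>\<^bsub>R\<^esub> \<Longrightarrow> p i = 0"
proof -
  have "\<exists>q. \<pi> q = v i \<and> (v i = \<zero>\<^bsub>R\<^esub> \<longrightarrow> q = 0)" for i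
    using assms[of i] \<pi>_0 by (cases "v i = \<zero>\<^bsub>R\<^esub>") (auto simp: carrier_R simp del: \<pi>_0)
  then have "\<exists>p. \<forall>i. \<pi> (p i) = v i \<and> (v i = \<zero>\<^bsub>R\<^esub> \<longrightarrow> p i = 0)" by metis
  then show ?thesis using that by blast
qed

lemma right_mult_\<pi>:
  assumes "fin_supp p"
  shows "right_mult R (\<lambda>i j. \<pi> (N i j)) (\<lambda>i. \<pi> (p i)) j = \<pi> (row_mult p N j)"
proof -
  have "\<pi> (row_mult p N j) = (\<Oplus>\<^bsub>R\<^esub>i\<in>{i. p i \<noteq> 0}. \<pi> (p i) \<otimes>\<^bsub>R\<^esub> \<pi> (N i j))"
    by (simp add: row_mult_def \<pi>_sum \<pi>_mult)
  also have "\<dots> = (\<Oplus>\<^bsub>R\<^esub>i\<in>{i. \<pi> (p i) \<noteq> \<zero>\<^bsub>R\<^esub>}. \<pi> (p i) \<otimes>\<^bsub>R\<^esub> \<pi> (N i j))"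
    by (rule add.finprod_mono_neutral_cong_right)
      (use assms in \<open>auto simp: fin_supp_def\<close>)
  finally show ?thesis by (simp add: right_mult_def)
qed

end

section \<open>Graded presentations\<close>

lemma monomial_induct [case_names zero single add]:
  assumes "P 0" "\<And>w c. P (Poly_Mapping.single w c)" "\<And>p q. P p \<Longrightarrow> P q \<Longrightarrow> P (p + q)"
  shows "P (p :: 'w \<Rightarrow>\<^sub>0 'a::comm_monoid_add)"
proof -
  have eq: "p = (\<Sum>w\<in>Poly_Mapping.keys p. Poly_Mapping.single w (Poly_Mapping.lookup p w))"
  proof (rule poly_mapping_eqI)
    fix k
    show "Poly_Mapping.lookup p k
      = Poly_Mapping.lookup (\<Sum>w\<in>Poly_Mapping.keys p. Poly_Mapping.single w (Poly_Mapping.lookup p w)) k"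
      by (simp add: lookup_sum lookup_single when_def in_keys_iff)
  qed
  have "P (\<Sum>w\<in>A. Poly_Mapping.single w (g w))" for A and g :: "'w \<Rightarrow> 'a"
    by (induction A rule: infinite_finite_induct) (auto intro: assms)
  then show ?thesis using eq by metis
qed

definition wt_comp :: "('w \<Rightarrow> nat) \<Rightarrow> int \<Rightarrow> ('w \<Rightarrow>\<^sub>0 'k::field) set"
  where "wt_comp wt d = {f. \<forall>w\<in>Poly_Mapping.keys f. int (wt w) = d}"

definition hpart :: "('w \<Rightarrow> nat) \<Rightarrow> int \<Rightarrow> ('w \<Rightarrow>\<^sub>0 'k::field) \<Rightarrow> 'w \<Rightarrow>\<^sub>0 'k"
  where "hpart wt d f = Abs_poly_mapping (\<lambda>w. Poly_Mapping.lookup f w when int (wt w) = d)"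

lemma lookup_hpart: "Poly_Mapping.lookup (hpart wt d f) w = (Poly_Mapping.lookup f w when int (wt w) = d)"
proof -
  have "finite {w. (Poly_Mapping.lookup f w when int (wt w) = d) \<noteq> 0}"
    by (rule finite_subset[OF _ finite_keys[of f]]) (auto simp: in_keys_iff)
  then show ?thesis by (simp add: hpart_def)
qed

lemma hpart_comp: "hpart wt d f \<in> wt_comp wt d"
  by (auto simp: wt_comp_def in_keys_iff lookup_hpart when_def split: if_splits)

lemma hpart_add: "hpart wt d (f + g) = hpart wt d f + hpart wt d g"
  by (rule poly_mapping_eqI) (simp add: lookup_hpart lookup_add when_def)
lemma hpart_diff: "hpart wt d (f - g) = hpart wt d f - hpart wt d g"
  by (rule poly_mapping_eqI) (simp add: lookup_hpart lookup_minus when_def)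
lemma hpart_0 [simp]: "hpart wt d 0 = 0"
  by (rule poly_mapping_eqI) (simp add: lookup_hpart when_def)
lemma hpart_sum: "hpart wt d (sum g A) = (\<Sum>i\<in>A. hpart wt d (g i))"
  by (induction A rule: infinite_finite_induct) (auto simp: hpart_add)
lemma hpart_single: "hpart wt d (Poly_Mapping.single w c) = (Poly_Mapping.single w c when int (wt w) = d)"
  by (rule poly_mapping_eqI) (auto simp: lookup_hpart lookup_single when_def)
lemma hpart_homogeneous: "f \<in> wt_comp wt e \<Longrightarrow> hpart wt d f = (f when d = e)"
  by (rule poly_mapping_eqI) (auto simp: lookup_hpart wt_comp_def in_keys_iff when_def)

lemma wt_comp_0: "0 \<in> wt_comp wt d" by (simp add: wt_comp_def)
lemma wt_comp_add: "f \<in> wt_comp wt d \<Longrightarrow> g \<in> wt_comp wt d \<Longrightarrow> f + g \<in> wt_comp wt d"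
  using keys_add[of f g] by (auto simp: wt_comp_def)
lemma wt_comp_uminus: "f \<in> wt_comp wt d \<Longrightarrow> - f \<in> wt_comp wt d"
  by (auto simp: wt_comp_def in_keys_iff)
lemma wt_comp_diff: "f \<in> wt_comp wt d \<Longrightarrow> g \<in> wt_comp wt d \<Longrightarrow> f - g \<in> wt_comp wt d"
  using wt_comp_add[of f wt d "- g"] wt_comp_uminus[of g wt d] by simp
lemma wt_comp_sum: "(\<And>i. i \<in> A \<Longrightarrow> g i \<in> wt_comp wt d) \<Longrightarrow> sum g A \<in> wt_comp wt d"
  by (induction A rule: infinite_finite_induct) (auto intro: wt_comp_0 wt_comp_add)
lemma wt_comp_single: "int (wt w) = d \<Longrightarrow> Poly_Mapping.single w c \<in> wt_comp wt d"
  by (auto simp: wt_comp_def)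
lemma wt_comp_neg: "d < 0 \<Longrightarrow> f \<in> wt_comp wt d \<Longrightarrow> f = 0"
  by (auto simp: wt_comp_def in_keys_iff intro!: poly_mapping_eqI)

lemma lookup_0_homogeneous:
  assumes "f \<in> wt_comp wt d" "d > 0" "wt 0 = 0"
  shows "Poly_Mapping.lookup f 0 = 0"
  using assms by (force simp: wt_comp_def in_keys_iff)

lemma hpart_support:
  "finite {d. hpart wt d f \<noteq> 0}"
proof (rule finite_subset)
  show "{d. hpart wt d f \<noteq> 0} \<subseteq> (\<lambda>w. int (wt w)) ` Poly_Mapping.keys f"
  proof
    fix d assume "d \<in> {d. hpart wt d f \<noteq> 0}"
    then obtain w where "Poly_Mapping.lookup (hpart wt d f) w \<noteq> 0"
      by (metis (mono_tags) lookup_zero mem_Collect_eq poly_mapping_eqI)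
    then show "d \<in> (\<lambda>w. int (wt w)) ` Poly_Mapping.keys f"
      by (auto simp: lookup_hpart in_keys_iff when_def split: if_splits)
  qed
qed simp

lemma hpart_decomposition:
  assumes "finite B" "{d. hpart wt d f \<noteq> 0} \<subseteq> B"
  shows "f = (\<Sum>d\<in>B. hpart wt d f)"
proof (rule poly_mapping_eqI)
  fix w
  have "Poly_Mapping.lookup f w = 0" if "int (wt w) \<notin> B"
    proof -
    have "hpart wt (int (wt w)) f = 0" using that assms(2) by blast
    then show ?thesis using lookup_hpart[of wt "int (wt w)" f w] by simp
  qed
  then show "Poly_Mapping.lookup f w = Poly_Mapping.lookup (\<Sum>d\<in>B. hpart wt d f) w"
    by (auto simp: lookup_sum lookup_hpart when_def assms(1))
qed

text \<open>A monoid algebra graded by an additive weight. As only the neutral element has weight zero,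
  the coefficient at \<open>0\<close> is the augmentation onto the field.\<close>

locale weighted =
  fixes wt :: "'w::monoid_add \<Rightarrow> nat"
  assumes wt_add: "wt (u + v) = wt u + wt v" and wt_0_iff: "wt w = 0 \<longleftrightarrow> w = 0"
begin

lemma wt_comp_mult:
  assumes "f \<in> wt_comp wt d" "g \<in> wt_comp wt e"
  shows "f * g \<in> wt_comp wt (d + e)"
  using assms keys_mult[of f g] by (fastforce simp: wt_comp_def wt_add)

lemma hpart_single_mult:
  "hpart wt d (Poly_Mapping.single w c * f) = Poly_Mapping.single w c * hpart wt (d - int (wt w)) f"
proof (induction f rule: monomial_induct)
  case (single u b)
  then show ?case by (auto simp: mult_single hpart_single wt_add when_def)
qed (auto simp: distrib_left hpart_add)

lemma hpart_mult_single:
  "hpart wt d (f * Poly_Mapping.single w c) = hpart wt (d - int (wt w)) f * Poly_Mapping.single w c"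
proof (induction f rule: monomial_induct)
  case (single u b)
  then show ?case by (auto simp: mult_single hpart_single wt_add when_def)
qed (auto simp: distrib_right hpart_add)

lemma hpart_mult_homogeneous_left:
  assumes "f \<in> wt_comp wt e"
  shows "hpart wt d (f * g) = f * hpart wt (d - e) g"
proof (induction g rule: monomial_induct)
  case (single u b)
  show ?case
    by (auto simp: hpart_single hpart_mult_single hpart_homogeneous[OF assms] when_def)
qed (auto simp: distrib_left hpart_add)

lemma hpart_mult_homogeneous_right:
  assumes "g \<in> wt_comp wt e"
  shows "hpart wt d (f * g) = hpart wt (d - e) f * g"
proof (induction f rule: monomial_induct)
  case (single u b)
  show ?case
    by (auto simp: hpart_single hpart_single_mult hpart_homogeneous[OF assms] when_def)
qed (auto simp: distrib_right hpart_add)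

lemma two_sidedI_monomial:
  fixes J :: "('w \<Rightarrow>\<^sub>0 'k::field) set"
  assumes "0 \<in> J" "\<And>a b. a \<in> J \<Longrightarrow> b \<in> J \<Longrightarrow> a + b \<in> J"
    "\<And>w c a. a \<in> J \<Longrightarrow> Poly_Mapping.single w c * a \<in> J"
    "\<And>w c a. a \<in> J \<Longrightarrow> a * Poly_Mapping.single w c \<in> J"
  shows "two_sided J"
proof (rule two_sidedI)
  fix u a assume "a \<in> J"
  then show "u * a \<in> J"
    by (induction u rule: monomial_induct) (use assms in \<open>auto simp: distrib_right\<close>)
next
  fix u a assume "a \<in> J"
  then show "a * u \<in> J"
    by (induction u rule: monomial_induct) (use assms in \<open>auto simp: distrib_left\<close>)
qed (use assms in auto)

text \<open>The elements of the ideal all of whose homogeneous parts lie in it form an ideal again: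
  multiplication by a monomial only shifts these parts.\<close>

lemma hpart_gen_ideal:
  fixes S :: "('w \<Rightarrow>\<^sub>0 'k::field) set"
  assumes hom: "\<And>s. s \<in> S \<Longrightarrow> \<exists>d. s \<in> wt_comp wt d" and f: "f \<in> gen_ideal S"
  shows "hpart wt d f \<in> gen_ideal S"
proof -
  note ts = two_sided_gen_ideal[of S]
  let ?H = "{f. \<forall>d. hpart wt d f \<in> gen_ideal S}"
  have "two_sided ?H"
    by (rule two_sidedI_monomial)
      (auto simp: hpart_add hpart_single_mult hpart_mult_single two_sided_0[OF ts]
        two_sided_add[OF ts] two_sided_left[OF ts] two_sided_right[OF ts])
  moreover have "S \<subseteq> ?H"
  proof
    fix s assume "s \<in> S"
    then obtain e where "s \<in> wt_comp wt e" using hom by blast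
    then show "s \<in> ?H"
      using gen_ideal_base[OF \<open>s \<in> S\<close>] two_sided_0[OF ts]
      by (simp add: hpart_homogeneous when_def)
  qed
  ultimately show ?thesis using gen_ideal_least[of ?H S] f by blast
qed

text \<open>A product of monomials is constant only if both factors are, so taking the constant term is
  multiplicative.\<close>

lemma lookup_mult_0:
  fixes f g :: "'w \<Rightarrow>\<^sub>0 'k::field"
  shows "Poly_Mapping.lookup (f * g) 0 = Poly_Mapping.lookup f 0 * Poly_Mapping.lookup g 0"
proof -
  have z: "u + v = 0 \<longleftrightarrow> u = 0 \<and> v = 0" for u v :: 'w
    by (metis add_is_0 wt_0_iff wt_add)
  show ?thesis
  proof (induction f rule: monomial_induct)
    case f: (single u b)
    show ?case
    proof (induction g rule: monomial_induct)
      case (single v c)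
      have "u + v = 0 \<longleftrightarrow> u = 0 \<and> v = 0" by (rule z)
      then show ?case by (simp add: mult_single lookup_single when_def)
    qed (auto simp: distrib_left lookup_add)
  qed (auto simp: distrib_right lookup_add)
qed

lemma two_sided_augmentation: "two_sided {p :: 'w \<Rightarrow>\<^sub>0 'k::field. Poly_Mapping.lookup p 0 = 0}"
  by (rule two_sidedI) (auto simp: lookup_add lookup_mult_0)

end

locale graded_presentation = weighted wt + presentation S
  for wt :: "'w::monoid_add \<Rightarrow> nat" and S :: "('w \<Rightarrow>\<^sub>0 'k::field) set" +
  assumes homogeneous: "s \<in> S \<Longrightarrow> \<exists>d. s \<in> wt_comp wt d"
    and no_constants: "s \<in> S \<Longrightarrow> Poly_Mapping.lookup s 0 = 0"
begin

definition G :: "int \<Rightarrow> ('w \<Rightarrow>\<^sub>0 'k) set set"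
  where "G d = \<pi> ` wt_comp wt d"

text \<open>Homogeneous parts of elements of the quotient; the choice of the lift is immaterial since the
  ideal is homogeneous.\<close>

definition dpart :: "int \<Rightarrow> ('w \<Rightarrow>\<^sub>0 'k) set \<Rightarrow> ('w \<Rightarrow>\<^sub>0 'k) set"
  where "dpart d a = \<pi> (hpart wt d (SOME p. \<pi> p = a))"

lemma hpart_J: "f \<in> J \<Longrightarrow> hpart wt d f \<in> J"
  using hpart_gen_ideal homogeneous by blast

lemma J_augmentation: "f \<in> J \<Longrightarrow> Poly_Mapping.lookup f 0 = 0"
  using gen_ideal_least[OF two_sided_augmentation, of S] no_constants by blast

lemma dpart_\<pi>: "dpart d (\<pi> p) = \<pi> (hpart wt d p)"
proof -
  have "\<pi> (SOME q. \<pi> q = \<pi> p) = \<pi> p" by (rule someI) simp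
  then have "(SOME q. \<pi> q = \<pi> p) - p \<in> J" by (simp add: \<pi>_eq_iff)
  then have "hpart wt d (SOME q. \<pi> q = \<pi> p) - hpart wt d p \<in> J"
    using hpart_J by (simp flip: hpart_diff)
  then show ?thesis by (simp add: dpart_def \<pi>_eq_iff)
qed

lemma G_carrier: "G d \<subseteq> carrier R" by (auto simp: G_def)
lemma G_zero: "\<zero>\<^bsub>R\<^esub> \<in> G d" using wt_comp_0[of wt d] \<pi>_0 by (force simp: G_def simp del: \<pi>_0)
lemma G_add: "a \<in> G d \<Longrightarrow> b \<in> G d \<Longrightarrow> a \<oplus>\<^bsub>R\<^esub> b \<in> G d"
  using wt_comp_add by (force simp: G_def simp flip: \<pi>_add)
lemma G_uminus: "a \<in> G d \<Longrightarrow> \<ominus>\<^bsub>R\<^esub> a \<in> G d"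
  using wt_comp_uminus by (force simp: G_def simp flip: \<pi>_uminus)
lemma G_mult: "a \<in> G d \<Longrightarrow> b \<in> G e \<Longrightarrow> a \<otimes>\<^bsub>R\<^esub> b \<in> G (d + e)"
  using wt_comp_mult by (force simp: G_def simp flip: \<pi>_mult)
lemma G_finsum: "(\<And>i. i \<in> A \<Longrightarrow> g i \<in> G d) \<Longrightarrow> finsum R g A \<in> G d"
proof (induction A rule: infinite_finite_induct)
  case (insert a A)
  then show ?case using G_carrier[of d] by (subst finsum_insert) (auto intro!: G_add)
qed (auto simp: G_zero finsum_infinite)

lemma dpart_G: "dpart d a \<in> G d"
  by (auto simp: dpart_def G_def hpart_comp)
lemma dpart_closed [simp, intro]: "dpart d a \<in> carrier R"
  by (simp add: dpart_def)
lemma dpart_homogeneous: "a \<in> G e \<Longrightarrow> dpart d a = (if d = e then a else \<zero>\<^bsub>R\<^esub>)"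
  by (auto simp: G_def dpart_\<pi> hpart_homogeneous)
lemma dpart_zero [simp]: "dpart d \<zero>\<^bsub>R\<^esub> = \<zero>\<^bsub>R\<^esub>"
  using dpart_\<pi>[of d 0] by simp
lemma dpart_add: "a \<in> carrier R \<Longrightarrow> b \<in> carrier R \<Longrightarrow> dpart d (a \<oplus>\<^bsub>R\<^esub> b) = dpart d a \<oplus>\<^bsub>R\<^esub> dpart d b"
  by (auto simp: carrier_R dpart_\<pi> hpart_add simp flip: \<pi>_add)
lemma dpart_finsum:
  assumes "\<And>i. i \<in> A \<Longrightarrow> g i \<in> carrier R"
  shows "dpart d (finsum R g A) = (\<Oplus>\<^bsub>R\<^esub>i\<in>A. dpart d (g i))"
  using assms
proof (induction A rule: infinite_finite_induct)
  case (insert a A)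
  then show ?case by (simp add: Pi_iff dpart_add)
qed (auto simp: finsum_infinite)
lemma dpart_support:
  assumes "a \<in> carrier R"
  shows "finite {d. dpart d a \<noteq> \<zero>\<^bsub>R\<^esub>}"
proof -
  obtain p where "a = \<pi> p" using assms by (auto simp: carrier_R)
  then show ?thesis
    by (intro finite_subset[OF _ hpart_support[of wt p]]) (auto simp: dpart_\<pi>)
qed
lemma dpart_decomposition:
  assumes "a \<in> carrier R" "finite B" "{d. dpart d a \<noteq> \<zero>\<^bsub>R\<^esub>} \<subseteq> B"
  shows "a = (\<Oplus>\<^bsub>R\<^esub>d\<in>B. dpart d a)"
proof -
  obtain p where p: "a = \<pi> p" using assms(1) by (auto simp: carrier_R)
  let ?C = "B \<union> {d. hpart wt d p \<noteq> 0}"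
  have fin: "finite ?C" using assms(2) hpart_support by auto
  have "p = (\<Sum>d\<in>?C. hpart wt d p)"
    by (rule hpart_decomposition) (use fin in auto)
  then have "a = (\<Oplus>\<^bsub>R\<^esub>d\<in>?C. dpart d a)"
    unfolding p dpart_\<pi> by (metis \<pi>_sum)
  also have "\<dots> = (\<Oplus>\<^bsub>R\<^esub>d\<in>B. dpart d a)"
    by (rule add.finprod_mono_neutral_cong_right) (use fin assms in auto)
  finally show ?thesis .
qed

text \<open>Generators of positive degree have no constant term; conversely an element without constant term
  is the sum of its parts of positive degree.\<close>

lemma plus_ideal_eq: "plus_ideal R G = \<pi> ` {p. Poly_Mapping.lookup p 0 = 0}"
proof
  let ?A = "\<pi> ` {p. Poly_Mapping.lookup p 0 = 0}"
  have "(\<Union>k\<in>{0<..}. G k) \<subseteq> ?A"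
  proof
    fix a assume "a \<in> (\<Union>k\<in>{0<..}. G k)"
    then obtain k p where p: "k > 0" "p \<in> wt_comp wt k" "a = \<pi> p" by (auto simp: G_def)
    have "wt 0 = 0" by (simp add: wt_0_iff)
    then have "Poly_Mapping.lookup p 0 = 0"
      using p(1,2) by (force simp: wt_comp_def in_keys_iff)
    then show "a \<in> ?A" using p(3) by blast
  qed
  moreover have "subgroup ?A (add_monoid R)"
  proof (rule add.subgroupI)
    show "?A \<noteq> {}" by (auto intro!: exI[of _ 0])
    fix a assume "a \<in> ?A"
    then obtain p where p: "a = \<pi> p" "Poly_Mapping.lookup p 0 = 0" by blast
    show "\<ominus>\<^bsub>R\<^esub> a \<in> ?A" unfolding p(1) \<pi>_uminus[symmetric] by (rule imageI) (simp add: p)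
  next
    fix a b assume "a \<in> ?A" "b \<in> ?A"
    then obtain p where p: "a = \<pi> p" "Poly_Mapping.lookup p 0 = 0" by blast
    from \<open>b \<in> ?A\<close>
    obtain q where q: "b = \<pi> q" "Poly_Mapping.lookup q 0 = 0" by blast
    show "a \<oplus>\<^bsub>R\<^esub> b \<in> ?A"
      unfolding p(1) q(1) \<pi>_add[symmetric] by (rule imageI) (simp add: p q lookup_add)
  qed auto
  ultimately show "plus_ideal R G \<subseteq> ?A"
    unfolding plus_ideal_def by (rule add.generate_subgroup_incl)
next
  have sg: "subgroup (plus_ideal R G) (add_monoid R)"
    unfolding plus_ideal_def by (rule add.generate_is_subgroup) (use G_carrier in auto)
  have "\<pi> p \<in> plus_ideal R G" if "Poly_Mapping.lookup p 0 = 0" for p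
  proof -
    have *: "\<pi> (hpart wt d p) \<in> plus_ideal R G" for d
    proof (cases "d \<le> 0")
      case True
      have "hpart wt d p = 0"
        using that True by (intro poly_mapping_eqI)
          (auto simp: lookup_hpart when_def wt_0_iff dest: order.antisym)
      then show ?thesis using subgroup.one_closed[OF sg] by simp
    next
      case False
      then show ?thesis unfolding plus_ideal_def
        by (intro generate.incl) (auto simp: G_def hpart_comp intro!: bexI[of _ d])
    qed
    have "\<pi> (sum (\<lambda>d. hpart wt d p) B) \<in> plus_ideal R G" for B
    proof (induction B rule: infinite_finite_induct)
      case (insert a A)
      then show ?case using subgroup.m_closed[OF sg * insert.IH, of a] by (simp add: \<pi>_add)
    qed (use subgroup.one_closed[OF sg] in auto)
    then show ?thesis
      using hpart_decomposition[of "{d. hpart wt d p \<noteq> 0}" wt p, OF hpart_support order.refl] by metis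
  qed
  then show "\<pi> ` {p. Poly_Mapping.lookup p 0 = 0} \<subseteq> plus_ideal R G" by auto
qed

lemma \<pi>_plus_ideal_iff: "\<pi> p \<in> plus_ideal R G \<longleftrightarrow> Poly_Mapping.lookup p 0 = 0"
proof
  assume "\<pi> p \<in> plus_ideal R G"
  then obtain q where q: "Poly_Mapping.lookup q 0 = 0" "\<pi> p = \<pi> q"
    by (auto simp: plus_ideal_eq)
  then have "Poly_Mapping.lookup (p - q) 0 = 0"
    by (intro J_augmentation) (simp add: \<pi>_eq_iff)
  then show "Poly_Mapping.lookup p 0 = 0" using q by (simp add: lookup_minus)
qed (auto simp: plus_ideal_eq)

lemma ideal_plus_ideal: "ideal (plus_ideal R G) R"
proof (rule idealI)
  show "ring R" by (rule ring_axioms)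
  show "subgroup (plus_ideal R G) (add_monoid R)"
    unfolding plus_ideal_def by (rule add.generate_is_subgroup) (use G_carrier in auto)
qed (auto simp: plus_ideal_eq carrier_R lookup_mult_0 simp flip: \<pi>_mult)

section \<open>Graded-free modules\<close>

abbreviation F :: "'i set \<Rightarrow> ('i \<Rightarrow> int) \<Rightarrow> (('w \<Rightarrow>\<^sub>0 'k) set, 'i \<Rightarrow> ('w \<Rightarrow>\<^sub>0 'k) set) graded_module"
  where "F I s \<equiv> graded_free R G I s"

lemma free_simps [simp]:
  "\<zero>\<^bsub>F I s\<^esub> = (\<lambda>_. \<zero>\<^bsub>R\<^esub>)"
  "v \<oplus>\<^bsub>F I s\<^esub> w = (\<lambda>i. v i \<oplus>\<^bsub>R\<^esub> w i)"
  "a \<odot>\<^bsub>F I s\<^esub> v = (\<lambda>i. a \<otimes>\<^bsub>R\<^esub> v i)"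
  by (simp_all add: graded_free_def Let_def)

lemma carrier_free_iff:
  "v \<in> carrier (F I s) \<longleftrightarrow> (\<forall>i. v i \<in> carrier R) \<and> (\<forall>i. i \<notin> I \<longrightarrow> v i = \<zero>\<^bsub>R\<^esub>) \<and> finite {i. v i \<noteq> \<zero>\<^bsub>R\<^esub>}"
  by (auto simp: graded_free_def Let_def)

lemma mcomp_free_iff:
  "v \<in> mcomp (F I s) k \<longleftrightarrow> v \<in> carrier (F I s) \<and> (\<forall>i\<in>I. v i \<in> G (s i + k))"
  by (auto simp: graded_free_def Let_def)

lemma free_zero: "(\<lambda>_. \<zero>\<^bsub>R\<^esub>) \<in> carrier (F I s)"
  by (simp add: carrier_free_iff)
lemma free_add:
  assumes "v \<in> carrier (F I s)" "w \<in> carrier (F I s)"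
  shows "(\<lambda>i. v i \<oplus>\<^bsub>R\<^esub> w i) \<in> carrier (F I s)"
proof -
  have "finite {i. v i \<oplus>\<^bsub>R\<^esub> w i \<noteq> \<zero>\<^bsub>R\<^esub>}"
    by (rule finite_subset[of _ "{i. v i \<noteq> \<zero>\<^bsub>R\<^esub>} \<union> {i. w i \<noteq> \<zero>\<^bsub>R\<^esub>}"])
      (use assms in \<open>auto simp: carrier_free_iff\<close>)
  then show ?thesis using assms by (auto simp: carrier_free_iff)
qed
lemma free_smult:
  assumes "a \<in> carrier R" "v \<in> carrier (F I s)"
  shows "(\<lambda>i. a \<otimes>\<^bsub>R\<^esub> v i) \<in> carrier (F I s)"
proof -
  have "finite {i. a \<otimes>\<^bsub>R\<^esub> v i \<noteq> \<zero>\<^bsub>R\<^esub>}"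
    by (rule finite_subset[of _ "{i. v i \<noteq> \<zero>\<^bsub>R\<^esub>}"])
      (use assms in \<open>auto simp: carrier_free_iff\<close>)
  then show ?thesis using assms by (auto simp: carrier_free_iff)
qed
lemma free_uminus:
  assumes "v \<in> carrier (F I s)"
  shows "(\<lambda>i. \<ominus>\<^bsub>R\<^esub> v i) \<in> carrier (F I s)"
proof -
  have "finite {i. \<ominus>\<^bsub>R\<^esub> v i \<noteq> \<zero>\<^bsub>R\<^esub>}"
    by (rule finite_subset[of _ "{i. v i \<noteq> \<zero>\<^bsub>R\<^esub>}"])
      (use assms in \<open>auto simp: carrier_free_iff\<close>)
  then show ?thesis using assms by (auto simp: carrier_free_iff)
qed

lemma free_abelian_group: "abelian_group (F I s)"
proof (rule abelian_groupI)
  fix v assume v: "v \<in> carrier (F I s)"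
  show "\<exists>w\<in>carrier (F I s). w \<oplus>\<^bsub>F I s\<^esub> v = \<zero>\<^bsub>F I s\<^esub>"
    by (rule bexI[OF _ free_uminus[OF v]]) (use v in \<open>auto simp: carrier_free_iff l_neg\<close>)
qed (auto simp: free_zero free_add, auto simp: carrier_free_iff a_ac)

lemma free_left_module: "left_module R (F I s)"
proof (intro left_module.intro left_module_axioms.intro free_abelian_group ring_axioms)
qed (auto simp: free_smult, auto simp: carrier_free_iff l_distr r_distr m_assoc)

lemma free_finsum:
  assumes "\<And>k. k \<in> A \<Longrightarrow> c k \<in> carrier (F I s)"
  shows "finsum (F I s) c A = (\<lambda>i. \<Oplus>\<^bsub>R\<^esub>k\<in>A. c k i)"
  using assms
proof (induction A rule: infinite_finite_induct)
  case (insert a A)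
  interpret M: abelian_group "F I s" by (rule free_abelian_group)
  have "finsum (F I s) c (insert a A) = c a \<oplus>\<^bsub>F I s\<^esub> finsum (F I s) c A"
    using insert by (intro M.finsum_insert) auto
  also have "\<dots> = (\<lambda>i. \<Oplus>\<^bsub>R\<^esub>k\<in>insert a A. c k i)"
    using insert by (auto simp: carrier_free_iff Pi_iff)
  finally show ?case .
next
  case (infinite A)
  interpret M: abelian_group "F I s" by (rule free_abelian_group)
  show ?case using infinite M.finsum_infinite[of A c] by (auto simp: finsum_infinite)
next
  case empty
  interpret M: abelian_group "F I s" by (rule free_abelian_group)
  show ?case using M.finsum_empty[of c] by auto
qed

text \<open>Coordinate \<open>i\<close> of the component of degree \<open>k\<close> is forced to be the part of degree \<open>s i + k\<close> of
  coordinate \<open>i\<close>; only finitely many of these rows are nonzero as the support is finite.\<close>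

lemma free_direct_grading: "direct_grading (F I s) (mcomp (F I s))"
  unfolding direct_grading_def
proof (intro conjI allI ballI)
  interpret M: abelian_group "F I s" by (rule free_abelian_group)
  fix k
  show "subgroup (mcomp (F I s) k) (add_monoid (F I s))"
  proof (rule M.add.subgroupI)
    show "mcomp (F I s) k \<subseteq> carrier (F I s)" by (auto simp: mcomp_free_iff)
    have "(\<lambda>_. \<zero>\<^bsub>R\<^esub>) \<in> mcomp (F I s) k" using free_zero G_zero by (simp add: mcomp_free_iff)
    then show "mcomp (F I s) k \<noteq> {}" by blast
    fix v assume v: "v \<in> mcomp (F I s) k"
    then have vc: "v \<in> carrier (F I s)" by (simp add: mcomp_free_iff)
    have "\<ominus>\<^bsub>F I s\<^esub> v = (\<lambda>i. \<ominus>\<^bsub>R\<^esub> v i)"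
      by (rule M.minus_equality[OF _ vc free_uminus[OF vc]])
        (use vc in \<open>auto simp: carrier_free_iff l_neg\<close>)
    then show "\<ominus>\<^bsub>F I s\<^esub> v \<in> mcomp (F I s) k"
      using v free_uminus[OF vc] by (auto simp: mcomp_free_iff G_uminus)
  next
    fix v w assume "v \<in> mcomp (F I s) k" "w \<in> mcomp (F I s) k"
    then show "v \<oplus>\<^bsub>F I s\<^esub> w \<in> mcomp (F I s) k"
      using free_add by (auto simp: mcomp_free_iff G_add)
  qed
next
  interpret M: abelian_group "F I s" by (rule free_abelian_group)
  fix v assume v: "v \<in> carrier (F I s)"
  define c where "c = (\<lambda>k i. if i \<in> I then dpart (s i + k) (v i) else \<zero>\<^bsub>R\<^esub>)"
  have fin_v: "finite {i. v i \<noteq> \<zero>\<^bsub>R\<^esub>}" and v_R: "v i \<in> carrier R" and v_0: "i \<notin> I \<Longrightarrow> v i = \<zero>\<^bsub>R\<^esub>" for i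
    using v by (auto simp: carrier_free_iff)
  have c_0: "c k i = \<zero>\<^bsub>R\<^esub>" if "v i = \<zero>\<^bsub>R\<^esub>" for k i
    using that by (simp add: c_def)
  have c_comp: "c k \<in> mcomp (F I s) k" for k
  proof -
    have "finite {i. c k i \<noteq> \<zero>\<^bsub>R\<^esub>}"
      by (rule finite_subset[OF _ fin_v]) (use c_0 in blast)
    moreover have "c k i \<in> carrier R" "i \<notin> I \<Longrightarrow> c k i = \<zero>\<^bsub>R\<^esub>" "i \<in> I \<Longrightarrow> c k i \<in> G (s i + k)" for i
      by (simp_all add: c_def dpart_G)
    ultimately show ?thesis by (simp add: mcomp_free_iff carrier_free_iff)
  qed
  have fin_c: "finite {k. c k \<noteq> \<zero>\<^bsub>F I s\<^esub>}"
  proof (rule finite_subset)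
    show "{k. c k \<noteq> \<zero>\<^bsub>F I s\<^esub>}
      \<subseteq> (\<Union>i\<in>{i. v i \<noteq> \<zero>\<^bsub>R\<^esub>}. (\<lambda>d. d - s i) ` {d. dpart d (v i) \<noteq> \<zero>\<^bsub>R\<^esub>})"
    proof
      fix k assume "k \<in> {k. c k \<noteq> \<zero>\<^bsub>F I s\<^esub>}"
      then have "\<exists>i. c k i \<noteq> \<zero>\<^bsub>R\<^esub>" by (auto simp: fun_eq_iff)
      then obtain i where "c k i \<noteq> \<zero>\<^bsub>R\<^esub>" by blast
      moreover from this have "v i \<noteq> \<zero>\<^bsub>R\<^esub>" using c_0 by blast
      moreover have "c k i = \<zero>\<^bsub>R\<^esub>" if "dpart (s i + k) (v i) = \<zero>\<^bsub>R\<^esub>"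
        using that by (simp add: c_def)
      ultimately have "v i \<noteq> \<zero>\<^bsub>R\<^esub>" "k \<in> (\<lambda>d. d - s i) ` {d. dpart d (v i) \<noteq> \<zero>\<^bsub>R\<^esub>}"
        by (blast, intro image_eqI[of _ _ "s i + k"]) auto
      then show "k \<in> (\<Union>i\<in>{i. v i \<noteq> \<zero>\<^bsub>R\<^esub>}. (\<lambda>d. d - s i) ` {d. dpart d (v i) \<noteq> \<zero>\<^bsub>R\<^esub>})"
        by blast
    qed
    show "finite (\<Union>i\<in>{i. v i \<noteq> \<zero>\<^bsub>R\<^esub>}. (\<lambda>d. d - s i) ` {d. dpart d (v i) \<noteq> \<zero>\<^bsub>R\<^esub>})"
      using fin_v dpart_support[OF v_R] by auto
  qed
  have sum_c: "v = (\<Oplus>\<^bsub>F I s\<^esub>k\<in>{k. c k \<noteq> \<zero>\<^bsub>F I s\<^esub>}. c k)"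
  proof -
    have "v i = (\<Oplus>\<^bsub>R\<^esub>k\<in>{k. c k \<noteq> \<zero>\<^bsub>F I s\<^esub>}. c k i)" for i
    proof (cases "i \<in> I")
      case True
      let ?B = "(\<lambda>k. s i + k) ` {k. c k \<noteq> \<zero>\<^bsub>F I s\<^esub>}"
      have "v i = (\<Oplus>\<^bsub>R\<^esub>d\<in>?B. dpart d (v i))"
      proof (rule dpart_decomposition[OF v_R])
        show "finite ?B" using fin_c by simp
        show "{d. dpart d (v i) \<noteq> \<zero>\<^bsub>R\<^esub>} \<subseteq> ?B"
        proof
          fix d assume "d \<in> {d. dpart d (v i) \<noteq> \<zero>\<^bsub>R\<^esub>}"
          then have "c (d - s i) i \<noteq> \<zero>\<^bsub>R\<^esub>" using True by (simp add: c_def)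
          then have "c (d - s i) \<noteq> \<zero>\<^bsub>F I s\<^esub>" by auto
          then show "d \<in> ?B" by (intro image_eqI[of _ _ "d - s i"]) auto
        qed
      qed
      also have "\<dots> = (\<Oplus>\<^bsub>R\<^esub>k\<in>{k. c k \<noteq> \<zero>\<^bsub>F I s\<^esub>}. dpart (s i + k) (v i))"
        by (rule finsum_reindex) auto
      finally show ?thesis using True by (simp add: c_def)
    qed (auto simp: v_0 c_def)
    then show ?thesis using c_comp by (subst free_finsum) (auto simp: mcomp_free_iff)
  qed
  show "\<exists>!c. (\<forall>k. c k \<in> mcomp (F I s) k) \<and> finite {k. c k \<noteq> \<zero>\<^bsub>F I s\<^esub>} \<and>
       v = (\<Oplus>\<^bsub>F I s\<^esub>k\<in>{k. c k \<noteq> \<zero>\<^bsub>F I s\<^esub>}. c k)"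
  proof (rule ex1I[of _ c])
    show "(\<forall>k. c k \<in> mcomp (F I s) k) \<and> finite {k. c k \<noteq> \<zero>\<^bsub>F I s\<^esub>} \<and>
       v = (\<Oplus>\<^bsub>F I s\<^esub>k\<in>{k. c k \<noteq> \<zero>\<^bsub>F I s\<^esub>}. c k)"
      using c_comp fin_c sum_c by blast
  next
    fix b assume b: "(\<forall>k. b k \<in> mcomp (F I s) k) \<and> finite {k. b k \<noteq> \<zero>\<^bsub>F I s\<^esub>} \<and>
       v = (\<Oplus>\<^bsub>F I s\<^esub>k\<in>{k. b k \<noteq> \<zero>\<^bsub>F I s\<^esub>}. b k)"
    let ?B = "{k. b k \<noteq> \<zero>\<^bsub>F I s\<^esub>}"
    have bc: "b k \<in> carrier (F I s)" for k using b by (auto simp: mcomp_free_iff)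
    have bR: "b k i \<in> carrier R" for k i using bc[of k] by (auto simp: carrier_free_iff)
    have bG: "i \<in> I \<Longrightarrow> b k i \<in> G (s i + k)" for k i using b by (auto simp: mcomp_free_iff)
    have v_b: "v i = (\<Oplus>\<^bsub>R\<^esub>k\<in>?B. b k i)" for i
      using conjunct2[OF conjunct2[OF b]] by (subst (asm) free_finsum) (auto simp: bc)
    show "b = c"
    proof (intro ext)
      fix k i
      show "b k i = c k i"
      proof (cases "i \<in> I")
        case True
        have "c k i = (\<Oplus>\<^bsub>R\<^esub>e\<in>?B. dpart (s i + k) (b e i))"
          using True bR by (simp add: c_def v_b dpart_finsum)
        also have "\<dots> = (\<Oplus>\<^bsub>R\<^esub>e\<in>?B. if k = e then b e i else \<zero>\<^bsub>R\<^esub>)"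
          by (rule finsum_cong') (use dpart_homogeneous[OF bG[OF True]] bR in auto)
        also have "\<dots> = b k i"
        proof (cases "k \<in> ?B")
          case True
          then show ?thesis using b bR by (intro add.finprod_singleton) auto
        next
          case False
          then have "b k i = \<zero>\<^bsub>R\<^esub>" by auto
          moreover have "(\<Oplus>\<^bsub>R\<^esub>e\<in>?B. if k = e then b e i else \<zero>\<^bsub>R\<^esub>) = (\<Oplus>\<^bsub>R\<^esub>e\<in>?B. \<zero>\<^bsub>R\<^esub>)"
            by (rule finsum_cong') (use False in auto)
          ultimately show ?thesis by simp
        qed
        finally show ?thesis by simp
      next
        case False
        then show ?thesis using bc[of k] by (auto simp: carrier_free_iff c_def)
      qed
    qed
  qed
qed

lemma free_graded_left_module: "graded_left_module R G (F I s)"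
  unfolding graded_left_module_def
proof (intro conjI allI ballI free_left_module free_direct_grading)
  fix i j a v assume a: "a \<in> G i" and v: "v \<in> mcomp (F I s) j"
  have "a \<otimes>\<^bsub>R\<^esub> v u \<in> G (s u + (i + j))" if "u \<in> I" for u
    using G_mult[OF a, of "v u" "s u + j"] v that by (auto simp: mcomp_free_iff algebra_simps)
  then show "a \<odot>\<^bsub>F I s\<^esub> v \<in> mcomp (F I s) (i + j)"
    using a G_carrier v by (auto simp: mcomp_free_iff intro!: free_smult)
qed

lemma free_graded_projective:
  fixes I :: "'i set"
  shows "graded_projective R G (F I s)"
proof -
  \<comment> \<open>The index set of the free module has to consist of module elements, so indices are encoded as
    functions; any injection will do.\<close>
  define \<phi> :: "'i \<Rightarrow> 'i \<Rightarrow> ('w \<Rightarrow>\<^sub>0 'k) set" where "\<phi> = (\<lambda>i j. if j = i then {} else UNIV)"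
  have inj: "inj \<phi>" by (rule injI) (auto simp: \<phi>_def fun_eq_iff split: if_splits)
  define s' where "s' = s \<circ> inv_into UNIV \<phi>"
  define f :: "('i \<Rightarrow> ('w \<Rightarrow>\<^sub>0 'k) set) \<Rightarrow> ('i \<Rightarrow> ('w \<Rightarrow>\<^sub>0 'k) set) \<Rightarrow> ('w \<Rightarrow>\<^sub>0 'k) set"
    where "f = (\<lambda>v u. if u \<in> range \<phi> then v (inv_into UNIV \<phi> u) else \<zero>\<^bsub>R\<^esub>)"
  define g :: "(('i \<Rightarrow> ('w \<Rightarrow>\<^sub>0 'k) set) \<Rightarrow> ('w \<Rightarrow>\<^sub>0 'k) set) \<Rightarrow> 'i \<Rightarrow> ('w \<Rightarrow>\<^sub>0 'k) set"
    where "g = (\<lambda>w i. w (\<phi> i))"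
  have inv: "inv_into UNIV \<phi> (\<phi> i) = i" for i by (simp add: inj)
  have f_closed: "f v \<in> carrier (F (\<phi> ` I) s')" if v: "v \<in> carrier (F I s)" for v
  proof -
    have "finite {u. f v u \<noteq> \<zero>\<^bsub>R\<^esub>}"
      by (rule finite_subset[of _ "\<phi> ` {i. v i \<noteq> \<zero>\<^bsub>R\<^esub>}"])
        (use v in \<open>auto simp: f_def inv carrier_free_iff split: if_splits\<close>)
    then show ?thesis using v by (auto simp: f_def inv carrier_free_iff image_iff)
  qed
  have g_closed: "g w \<in> carrier (F I s)" if w: "w \<in> carrier (F (\<phi> ` I) s')" for w
  proof -
    have "finite (\<phi> -` {u. w u \<noteq> \<zero>\<^bsub>R\<^esub>})"
      by (rule finite_vimageI) (use w inj in \<open>auto simp: carrier_free_iff\<close>)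
    then have "finite {i. g w i \<noteq> \<zero>\<^bsub>R\<^esub>}" by (simp add: g_def vimage_def)
    then show ?thesis using w by (auto simp: g_def carrier_free_iff inj_image_mem_iff[OF inj])
  qed
  have f: "f \<in> graded_hom R (F I s) (F (\<phi> ` I) s')"
    unfolding graded_hom_def
    by (auto simp: f_closed mcomp_free_iff, auto simp: f_def carrier_free_iff fun_eq_iff inv s'_def)
  have g: "g \<in> graded_hom R (F (\<phi> ` I) s') (F I s)"
    unfolding graded_hom_def
    by (auto simp: g_closed mcomp_free_iff, auto simp: g_def carrier_free_iff fun_eq_iff inv s'_def)
  have "g (f v) = v" for v
    by (simp add: f_def g_def inv)
  then show ?thesis unfolding graded_projective_def
    by (intro exI[of _ "\<phi> ` I"] exI[of _ s'] bexI[OF _ f] bexI[OF _ g] ballI)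
qed

lemma free_lift:
  assumes "v \<in> carrier (F I s)"
  obtains p where "fin_supp p" "v = (\<lambda>i. \<pi> (p i))" "\<And>i. i \<notin> I \<Longrightarrow> p i = 0"
proof -
  obtain p where p: "\<And>i. \<pi> (p i) = v i" "\<And>i. v i = \<zero>\<^bsub>R\<^esub> \<Longrightarrow> p i = 0"
    using obtain_lift[of v] assms by (auto simp: carrier_free_iff)
  have "fin_supp p" unfolding fin_supp_def
    by (rule finite_subset[of _ "{i. v i \<noteq> \<zero>\<^bsub>R\<^esub>}"])
      (use assms p(2) in \<open>auto simp: carrier_free_iff\<close>)
  then show ?thesis using that p assms by (auto simp: carrier_free_iff fun_eq_iff)
qed

lemma free_lift_closed:
  assumes "fin_supp p" "\<And>i. i \<notin> I \<Longrightarrow> p i = 0"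
  shows "(\<lambda>i. \<pi> (p i)) \<in> carrier (F I s)"
proof -
  have "finite {i. \<pi> (p i) \<noteq> \<zero>\<^bsub>R\<^esub>}"
    by (rule finite_subset[of _ "{i. p i \<noteq> 0}"]) (use assms in \<open>auto simp: fin_supp_def\<close>)
  then show ?thesis using assms(2) by (auto simp: carrier_free_iff)
qed

lemma right_mult_graded_hom:
  assumes fin: "\<And>i. fin_supp (N i)" and ran: "\<And>i j. N i j \<noteq> 0 \<Longrightarrow> j \<in> I'"
    and deg: "\<And>i j. i \<in> I \<Longrightarrow> j \<in> I' \<Longrightarrow> N i j \<in> wt_comp wt (s' j - s i)"
  shows "right_mult R (\<lambda>i j. \<pi> (N i j)) \<in> graded_hom R (F I s) (F I' s')"
proof -
  let ?d = "right_mult R (\<lambda>i j. \<pi> (N i j))"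
  have closed: "?d v \<in> carrier (F I' s')" if "v \<in> carrier (F I s)" for v
  proof -
    obtain p where p: "fin_supp p" "v = (\<lambda>i. \<pi> (p i))" using free_lift[OF \<open>v \<in> _\<close>] by metis
    have "?d v = (\<lambda>j. \<pi> (row_mult p N j))" using p by (auto simp: right_mult_\<pi>)
    moreover have "row_mult p N j = 0" if "j \<notin> I'" for j
      using row_mult_outside[of N I' j p] ran that by blast
    ultimately show ?thesis
      using free_lift_closed[of "row_mult p N" I' s'] fin_supp_row_mult[OF p(1) fin] by simp
  qed
  have add: "?d (v \<oplus>\<^bsub>F I s\<^esub> w) = ?d v \<oplus>\<^bsub>F I' s'\<^esub> ?d w" if "v \<in> carrier (F I s)" "w \<in> carrier (F I s)" for v w
  proof -
    obtain p where p: "fin_supp p" "v = (\<lambda>i. \<pi> (p i))" using free_lift[OF \<open>v \<in> _\<close>] by metis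
    obtain q where q: "fin_supp q" "w = (\<lambda>i. \<pi> (q i))" using free_lift[OF \<open>w \<in> _\<close>] by metis
    have sum: "v \<oplus>\<^bsub>F I s\<^esub> w = (\<lambda>i. \<pi> (p i + q i))" by (simp add: p q \<pi>_add)
    have "?d (v \<oplus>\<^bsub>F I s\<^esub> w) j = ?d v j \<oplus>\<^bsub>R\<^esub> ?d w j" for j
      unfolding sum unfolding p(2) q(2) right_mult_\<pi>[OF p(1)] right_mult_\<pi>[OF q(1)]
        right_mult_\<pi>[OF fin_supp_add[OF p(1) q(1)]] row_mult_add[OF p(1) q(1)] by (rule \<pi>_add)
    then show ?thesis by (simp add: fun_eq_iff)
  qed
  have scale: "?d (a \<odot>\<^bsub>F I s\<^esub> v) = a \<odot>\<^bsub>F I' s'\<^esub> ?d v" if "a \<in> carrier R" "v \<in> carrier (F I s)" for a v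
  proof -
    obtain p where p: "fin_supp p" "v = (\<lambda>i. \<pi> (p i))" using free_lift[OF \<open>v \<in> _\<close>] by metis
    obtain u where u: "a = \<pi> u" using \<open>a \<in> carrier R\<close> by (auto simp: carrier_R)
    have scaled: "a \<odot>\<^bsub>F I s\<^esub> v = (\<lambda>i. \<pi> (u * p i))" by (simp add: p u \<pi>_mult)
    have "?d (a \<odot>\<^bsub>F I s\<^esub> v) j = a \<otimes>\<^bsub>R\<^esub> ?d v j" for j
      unfolding scaled unfolding p(2) u right_mult_\<pi>[OF p(1)]
        right_mult_\<pi>[OF fin_supp_mult[OF p(1)]] row_mult_scale[OF p(1)] by (rule \<pi>_mult)
    then show ?thesis by (simp add: fun_eq_iff)
  qed
  have "?d v \<in> mcomp (F I' s') k" if v: "v \<in> mcomp (F I s) k" for v k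
  proof -
    have vc: "v \<in> carrier (F I s)" and vG: "\<And>i. i \<in> I \<Longrightarrow> v i \<in> G (s i + k)"
      using v by (auto simp: mcomp_free_iff)
    have "?d v j \<in> G (s' j + k)" if "j \<in> I'" for j
      unfolding right_mult_def
    proof (rule G_finsum)
      fix i assume "i \<in> {i. v i \<noteq> \<zero>\<^bsub>R\<^esub>}"
      then have i: "i \<in> I" using vc by (auto simp: carrier_free_iff)
      have "\<pi> (N i j) \<in> G (s' j - s i)" using deg[OF i that] by (simp add: G_def)
      from G_mult[OF vG[OF i] this] show "v i \<otimes>\<^bsub>R\<^esub> \<pi> (N i j) \<in> G (s' j + k)"
        by (simp add: algebra_simps)
    qed
    then show ?thesis using closed[OF vc] by (simp add: mcomp_free_iff)
  qed
  then show ?thesis unfolding graded_hom_def using closed add scale by auto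
qed

text \<open>The coordinates of a product \<open>a \<odot> v\<close> with \<open>a\<close> in the augmentation ideal lie in that ideal. Conversely
  a row is the sum of its coordinates times unit rows.\<close>

lemma plus_submodule_free:
  "plus_submodule R G (F I s) = {v \<in> carrier (F I s). \<forall>i. v i \<in> plus_ideal R G}"
proof
  interpret M: abelian_group "F I s" by (rule free_abelian_group)
  interpret P: ideal "plus_ideal R G" R by (rule ideal_plus_ideal)
  let ?X = "{a \<odot>\<^bsub>F I s\<^esub> x |a x. a \<in> plus_ideal R G \<and> x \<in> carrier (F I s)}"
  have P_R: "a \<in> plus_ideal R G \<Longrightarrow> a \<in> carrier R" for a using P.a_subset by blast
  have X: "?X \<subseteq> carrier (F I s)" by (auto intro!: free_smult P_R)
  let ?V = "{v \<in> carrier (F I s). \<forall>i. v i \<in> plus_ideal R G}"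
  have "?X \<subseteq> ?V"
  proof
    fix y assume "y \<in> ?X"
    then obtain a v where a: "a \<in> plus_ideal R G" and v: "v \<in> carrier (F I s)" and y: "y = a \<odot>\<^bsub>F I s\<^esub> v"
      by blast
    have "v i \<in> carrier R" for i using v by (simp add: carrier_free_iff)
    then have "y i \<in> plus_ideal R G" for i using P.I_r_closed[OF a] by (simp add: y)
    then show "y \<in> ?V" using \<open>y \<in> ?X\<close> X by blast
  qed
  moreover have "subgroup ?V (add_monoid (F I s))"
  proof (rule M.add.subgroupI)
    have "(\<lambda>_. \<zero>\<^bsub>R\<^esub>) \<in> ?V"
      using free_zero additive_subgroup.zero_closed[OF P.is_additive_subgroup] by simp
    then show "?V \<noteq> {}" by blast
    fix v assume v: "v \<in> ?V"
    then have vc: "v \<in> carrier (F I s)" by simp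
    have "\<ominus>\<^bsub>F I s\<^esub> v = (\<lambda>i. \<ominus>\<^bsub>R\<^esub> v i)"
      by (rule M.minus_equality[OF _ vc free_uminus[OF vc]])
        (use vc in \<open>auto simp: carrier_free_iff l_neg\<close>)
    then show "\<ominus>\<^bsub>F I s\<^esub> v \<in> ?V" using v free_uminus[OF vc] by auto
  next
    fix v w assume "v \<in> ?V" "w \<in> ?V"
    then show "v \<oplus>\<^bsub>F I s\<^esub> w \<in> ?V" using free_add by auto
  qed auto
  ultimately show "plus_submodule R G (F I s) \<subseteq> ?V"
    unfolding plus_submodule_def by (rule M.add.generate_subgroup_incl)
  have sg: "subgroup (plus_submodule R G (F I s)) (add_monoid (F I s))"
    unfolding plus_submodule_def by (rule M.add.generate_is_subgroup) (use X in auto)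
  show "?V \<subseteq> plus_submodule R G (F I s)"
  proof
    fix v assume v: "v \<in> ?V"
    let ?r = "\<lambda>B i. if i \<in> B then v i else \<zero>\<^bsub>R\<^esub>"
    have r: "?r B \<in> plus_submodule R G (F I s)" if "finite B" for B
      using that
    proof (induction B)
      case empty
      then show ?case using subgroup.one_closed[OF sg] by simp
    next
      case (insert j B)
      let ?e = "\<lambda>i. if i = j \<and> j \<in> I then \<one>\<^bsub>R\<^esub> else \<zero>\<^bsub>R\<^esub>"
      have "?e \<in> carrier (F I s)"
        by (auto simp: carrier_free_iff intro!: finite_subset[of _ "{j}"])
      then have "v j \<odot>\<^bsub>F I s\<^esub> ?e \<in> plus_submodule R G (F I s)"
        unfolding plus_submodule_def by (intro generate.incl) (use v in blast)
      from subgroup.m_closed[OF sg this insert.IH]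
      have "(\<lambda>i. (v j \<odot>\<^bsub>F I s\<^esub> ?e) i \<oplus>\<^bsub>R\<^esub> ?r B i) \<in> plus_submodule R G (F I s)" by simp
      moreover have "(\<lambda>i. (v j \<odot>\<^bsub>F I s\<^esub> ?e) i \<oplus>\<^bsub>R\<^esub> ?r B i) = ?r (insert j B)"
        using v insert.hyps by (auto simp: carrier_free_iff fun_eq_iff)
      ultimately show ?case by simp
    qed
    have "?r {i. v i \<noteq> \<zero>\<^bsub>R\<^esub>} = v" by (simp add: fun_eq_iff)
    moreover have "?r {i. v i \<noteq> \<zero>\<^bsub>R\<^esub>} \<in> plus_submodule R G (F I s)"
      using v by (intro r) (simp add: carrier_free_iff)
    ultimately show "v \<in> plus_submodule R G (F I s)" by (simp only:)
  qed
qed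

end

section \<open>The free algebra, its polynomial extension and deformations\<close>

definition wlen :: "'x fword \<Rightarrow> nat" where "wlen w = length (letters w)"
definition wlenz :: "'x fword \<times> nat \<Rightarrow> nat" where "wlenz wi = length (letters (fst wi)) + snd wi"

lemma letters_0 [simp]: "letters 0 = []" by (simp add: zero_fword_def)
lemma letters_add [simp]: "letters (u + v) = letters u @ letters v" by (simp add: plus_fword_def)
lemma fword_eq_0_iff: "w = 0 \<longleftrightarrow> letters w = []" by (cases w) (simp add: zero_fword_def)

interpretation wlen: weighted wlen
  by unfold_locales (auto simp: wlen_def fword_eq_0_iff)

interpretation wlenz: weighted wlenz
  by unfold_locales (auto simp: wlenz_def fword_eq_0_iff prod_eq_iff)

lemma T_comp_wt: "T_comp = wt_comp wlen"
  by (auto simp: fun_eq_iff T_comp_def wt_comp_def wlen_def)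

lemma Tz_comp_wt: "Tz_comp = wt_comp wlenz"
  by (fastforce simp: fun_eq_iff Tz_comp_def wt_comp_def wlenz_def)

text \<open>The substitution \<open>z = 0\<close>, a ring homomorphism onto the free algebra with section \<^const>\<open>emb\<close>.\<close>

definition zerosub :: "('x, 'k::field) falgz \<Rightarrow> ('x, 'k) falg"
  where "zerosub = Poly_Mapping.map_key (\<lambda>w. (w, 0))"

lemma inj_zerosub: "inj (\<lambda>w. (w, 0::nat))" by (rule injI) simp

lemma lookup_zerosub: "Poly_Mapping.lookup (zerosub g) w = Poly_Mapping.lookup g (w, 0)"
  by (simp add: zerosub_def map_key.rep_eq[OF inj_zerosub])

lemma zerosub_add: "zerosub (p + q) = zerosub p + zerosub q"
  by (rule poly_mapping_eqI) (simp add: lookup_zerosub lookup_add)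
lemma zerosub_diff: "zerosub (p - q) = zerosub p - zerosub q"
  by (rule poly_mapping_eqI) (simp add: lookup_zerosub lookup_minus)
lemma zerosub_0 [simp]: "zerosub 0 = 0"
  by (rule poly_mapping_eqI) (simp add: lookup_zerosub)
lemma zerosub_sum: "zerosub (sum g A) = (\<Sum>i\<in>A. zerosub (g i))"
  by (induction A rule: infinite_finite_induct) (auto simp: zerosub_add)
lemma zerosub_single: "zerosub (Poly_Mapping.single wi c) = (Poly_Mapping.single (fst wi) c when snd wi = 0)"
  by (rule poly_mapping_eqI) (auto simp: lookup_zerosub lookup_single when_def prod_eq_iff)
lemma zerosub_mult: "zerosub (p * q) = zerosub p * zerosub q"
proof (induction p rule: monomial_induct)
  case s: (single u b)
  show ?case
    by (induction q rule: monomial_induct)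
      (auto simp: distrib_left zerosub_add zerosub_single mult_single when_def)
qed (auto simp: distrib_right zerosub_add)

lemma lookup_emb: "Poly_Mapping.lookup (emb f) (w, i) = (Poly_Mapping.lookup f w when i = 0)"
  by (auto simp: emb_def lookup_sum lookup_single when_def in_keys_iff sum.delta)

lemma emb_add: "emb (p + q) = emb p + emb q"
  by (rule poly_mapping_eqI) (auto simp: lookup_emb lookup_add when_def split_paired_all)
lemma emb_0 [simp]: "emb 0 = 0"
  by (rule poly_mapping_eqI) (auto simp: lookup_emb when_def split_paired_all)
lemma emb_single: "emb (Poly_Mapping.single w c) = Poly_Mapping.single (w, 0) c"
  by (rule poly_mapping_eqI) (auto simp: lookup_emb lookup_single when_def split_paired_all)
lemma emb_mult: "emb (p * q) = emb p * emb q"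
proof (induction p rule: monomial_induct)
  case s: (single u b)
  show ?case
    by (induction q rule: monomial_induct)
      (auto simp: distrib_left emb_add emb_single mult_single)
qed (auto simp: distrib_right emb_add)
lemma emb_sum: "emb (sum g A) = (\<Sum>i\<in>A. emb (g i))"
  by (induction A rule: infinite_finite_induct) (auto simp: emb_add)

lemma zerosub_emb [simp]: "zerosub (emb f) = f"
  by (rule poly_mapping_eqI) (simp add: lookup_zerosub lookup_emb)

lemma emb_eq_0_iff [simp]: "emb f = 0 \<longleftrightarrow> f = 0"
  by (metis emb_0 zerosub_emb)

lemma emb_comp: "f \<in> wt_comp wlen d \<Longrightarrow> emb f \<in> wt_comp wlenz d"
  by (auto simp: wt_comp_def in_keys_iff lookup_emb wlen_def wlenz_def when_def split: if_splits)

lemma zgen_comp: "zgen \<in> wt_comp wlenz 1"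
  by (simp add: zgen_def wt_comp_single wlenz_def)

lemma zgen_single: "zgen * Poly_Mapping.single (w, i) c = Poly_Mapping.single (w, Suc i) c"
  by (simp add: zgen_def mult_single zero_prod_def)

lemma zgen_central: "p * zgen = zgen * p"
proof (induction p rule: monomial_induct)
  case (single w c)
  then show ?case by (cases w) (simp add: zgen_def mult_single)
qed (auto simp: distrib_left distrib_right)

lemma zerosub_zgen [simp]: "zerosub (zgen * p) = 0"
  by (simp add: zerosub_mult) (simp add: zgen_def zerosub_single)

text \<open>Collect the monomials without \<open>z\<close>; all others are divisible by \<open>z\<close>.\<close>

lemma z_decomposition:
  obtains y where "p = emb (zerosub p) + zgen * y"
proof -
  have "\<exists>y. p = emb (zerosub p) + zgen * y"
  proof (induction p rule: monomial_induct)
    case zero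
    show ?case by (rule exI[of _ 0]) simp
  next
    case (single wi c)
    obtain w i where wi: "wi = (w, i)" by (cases wi)
    show ?case
    proof (cases i)
      case 0
      then show ?thesis by (intro exI[of _ 0]) (simp add: wi zerosub_single emb_single)
    next
      case (Suc j)
      then show ?thesis
        by (intro exI[of _ "Poly_Mapping.single (w, j) c"]) (simp add: wi zerosub_single zgen_single)
    qed
  next
    case (add p q)
    then obtain y y' where y: "p = emb (zerosub p) + zgen * y" and y': "q = emb (zerosub q) + zgen * y'" by blast
    have "emb (zerosub (p + q)) + zgen * (y + y')
      = (emb (zerosub p) + zgen * y) + (emb (zerosub q) + zgen * y')"
      by (simp add: zerosub_add emb_add distrib_left ac_simps)
    also have "\<dots> = p + q" by (simp only: y[symmetric] y'[symmetric])
    finally show ?case by (intro exI[of _ "y + y'"]) (rule sym)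
  qed
  then show ?thesis using that by blast
qed

lemma zerosub_hpart: "zerosub (hpart wlenz d p) = hpart wlen d (zerosub p)"
  by (rule poly_mapping_eqI) (simp add: lookup_zerosub lookup_hpart wlen_def wlenz_def)

lemma lookup_fpart: "Poly_Mapping.lookup (fpart i f) w = (Poly_Mapping.lookup f w when wlen w = i)"
  by (auto simp: fpart_def lookup_sum lookup_single when_def in_keys_iff wlen_def sum.delta)

lemma fpart_hpart: "fpart i f = hpart wlen (int i) f"
  by (rule poly_mapping_eqI) (simp add: lookup_fpart lookup_hpart)

lemma zgen_power_comp: "zgen ^ k \<in> wt_comp wlenz (int k)"
proof (induction k)
  case 0
  show ?case by (auto simp: wt_comp_def wlenz.wt_0_iff)
next
  case (Suc k)
  then show ?case using wlenz.wt_comp_mult[OF zgen_comp Suc] by (simp add: add.commute)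
qed

lemma homogenize_comp: "homogenize f \<in> wt_comp wlenz (int (fdeg f))"
  unfolding homogenize_def
proof (rule wt_comp_sum)
  fix i assume "i \<in> {..fdeg f}"
  then show "zgen ^ (fdeg f - i) * emb (fpart i f) \<in> wt_comp wlenz (int (fdeg f))"
    using wlenz.wt_comp_mult[OF zgen_power_comp[of "fdeg f - i"] emb_comp[OF hpart_comp[of wlen "int i" f]]]
    by (simp add: fpart_hpart of_nat_diff)
qed

text \<open>Only the leading part of an element is not multiplied by a positive power of \<open>z\<close> when it is homogenized.\<close>

lemma zerosub_homogenize: "zerosub (homogenize f) = fpart (fdeg f) f"
proof -
  have "zerosub (zgen ^ (fdeg f - i) * emb (fpart i f)) = (fpart i f when i = fdeg f)" if le: "i \<le> fdeg f" for i
  proof (cases "i = fdeg f")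
    case False
    then obtain k where k: "fdeg f - i = Suc k" using le by (cases "fdeg f - i") auto
    show ?thesis using False by (simp add: k mult.assoc when_def)
  qed simp
  then have "zerosub (homogenize f) = (\<Sum>i\<le>fdeg f. fpart i f when i = fdeg f)"
    unfolding homogenize_def zerosub_sum by (intro sum.cong) auto
  also have "\<dots> = fpart (fdeg f) f" by (simp add: when_def)
  finally show ?thesis .
qed

lemma fdeg_less_iff: "d > 0 \<Longrightarrow> fdeg f < d \<longleftrightarrow> (\<forall>w\<in>Poly_Mapping.keys f. wlen w < d)"
  by (auto simp: fdeg_def wlen_def)

text \<open>A perturbation of lower degree changes neither the degree nor the leading part.\<close>

lemma fdeg_leading:
  assumes r: "r \<in> wt_comp wlen (int (fdeg r))" and l: "fdeg l < fdeg r"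
  shows "fdeg (r + l) = fdeg r" and "fpart (fdeg (r + l)) (r + l) = r"
proof -
  have lk: "Poly_Mapping.lookup l w = 0" if "wlen w \<ge> fdeg r" for w
    using fdeg_less_iff[of "fdeg r" l] l that by (force simp: in_keys_iff)
  have rk: "Poly_Mapping.lookup r w = 0" if "wlen w \<noteq> fdeg r" for w
    using r that by (auto simp: wt_comp_def in_keys_iff)
  have "r \<noteq> 0" using l by (auto simp: fdeg_def)
  then obtain w where w: "Poly_Mapping.lookup r w \<noteq> 0" by (metis lookup_zero poly_mapping_eqI)
  have wl: "wlen w = fdeg r" using rk w by blast
  have "fdeg (r + l) < Suc (fdeg r)"
  proof (subst fdeg_less_iff)
    show "\<forall>w\<in>Poly_Mapping.keys (r + l). wlen w < Suc (fdeg r)"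
    proof
      fix v assume "v \<in> Poly_Mapping.keys (r + l)"
      then have "Poly_Mapping.lookup r v + Poly_Mapping.lookup l v \<noteq> 0" by (simp add: in_keys_iff lookup_add)
      then show "wlen v < Suc (fdeg r)" using lk[of v] rk[of v] by (cases "wlen v \<le> fdeg r") auto
    qed
  qed simp
  moreover have "\<not> fdeg (r + l) < fdeg r"
  proof
    assume "fdeg (r + l) < fdeg r"
    moreover from this have "fdeg r > 0" by simp
    moreover have "w \<in> Poly_Mapping.keys (r + l)"
      using w lk[of w] wl by (simp add: in_keys_iff lookup_add)
    ultimately show False using wl fdeg_less_iff[of "fdeg r" "r + l"] by auto
  qed
  ultimately show deg: "fdeg (r + l) = fdeg r" by simp
  show "fpart (fdeg (r + l)) (r + l) = r"
    by (rule poly_mapping_eqI) (auto simp: deg lookup_fpart lookup_add when_def lk rk)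
qed

locale deformation =
  fixes m :: nat and r l :: "nat \<Rightarrow> ('x, 'k::field) falg"
  assumes r_hom: "\<And>i. i < m \<Longrightarrow> 2 \<le> fdeg (r i) \<and> r i \<in> T_comp (int (fdeg (r i)))"
    and l_deg: "\<And>i. i < m \<Longrightarrow> fdeg (l i) < fdeg (r i)"
begin

definition h :: "nat \<Rightarrow> ('x, 'k) falgz" where "h i = homogenize (r i + l i)"

lemma r_comp: "i < m \<Longrightarrow> r i \<in> wt_comp wlen (int (fdeg (r i)))"
  using r_hom by (simp add: T_comp_wt)

lemma h_comp: "i < m \<Longrightarrow> h i \<in> wt_comp wlenz (int (fdeg (r i)))"
  unfolding h_def using homogenize_comp[of "r i + l i"] fdeg_leading(1)[OF r_comp l_deg] by simp

lemma zerosub_h: "i < m \<Longrightarrow> zerosub (h i) = r i"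
  unfolding h_def zerosub_homogenize using fdeg_leading(2)[OF r_comp l_deg] by simp

sublocale A: graded_presentation wlen "r ` {..<m}"
proof
  fix s assume "s \<in> r ` {..<m}"
  then obtain i where i: "i < m" "s = r i" by auto
  then show "\<exists>d. s \<in> wt_comp wlen d" using r_comp by blast
  show "Poly_Mapping.lookup s 0 = 0"
    using i r_comp[of i] r_hom[of i] by (intro lookup_0_homogeneous[of s wlen "int (fdeg (r i))"]) (auto simp: wlen.wt_0_iff)
qed

sublocale D: graded_presentation wlenz "h ` {..<m}"
proof
  fix s assume "s \<in> h ` {..<m}"
  then obtain i where i: "i < m" "s = h i" by auto
  then show "\<exists>d. s \<in> wt_comp wlenz d" using h_comp by blast
  show "Poly_Mapping.lookup s 0 = 0"
    using i h_comp[of i] r_hom[of i] by (intro lookup_0_homogeneous[of s wlenz "int (fdeg (r i))"]) (auto simp: wlenz.wt_0_iff)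
qed

lemma A_alg_eq: "A_alg m r = A.R" by (simp add: A_alg_def)
lemma pi_A_eq: "pi_A m r = A.\<pi>" by (simp add: pi_A_def)
lemma A_comp_eq: "A_comp m r = A.G" by (simp add: fun_eq_iff A_comp_def A.G_def pi_A_eq T_comp_wt)
lemma D_alg_eq: "D_alg m r l = D.R" by (simp add: D_alg_def h_def[abs_def])
lemma pi_D_eq: "pi_D m r l = D.\<pi>" by (simp add: pi_D_def h_def[abs_def])
lemma D_comp_eq: "D_comp m r l = D.G" by (simp add: fun_eq_iff D_comp_def D.G_def pi_D_eq Tz_comp_wt)

text \<open>Together with the following lemma this is the identity \<open>A = D / D z\<close>: setting \<open>z = 0\<close> turns the defining ideal
  of \<open>D\<close> into that of \<open>A\<close>, since \<open>zerosub (h i) = r i\<close>.\<close>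

lemma zerosub_J: "p \<in> D.J \<Longrightarrow> zerosub p \<in> A.J"
proof -
  have "two_sided {p :: ('x, 'k) falgz. zerosub p \<in> A.J}"
    by (rule two_sidedI) (auto simp: zerosub_add zerosub_mult two_sided_0[OF A.two_sided_J]
      two_sided_add[OF A.two_sided_J] two_sided_left[OF A.two_sided_J] two_sided_right[OF A.two_sided_J])
  moreover have "h ` {..<m} \<subseteq> {p. zerosub p \<in> A.J}"
    by (auto simp: zerosub_h intro: gen_ideal_base)
  ultimately have "D.J \<subseteq> {p. zerosub p \<in> A.J}" by (rule gen_ideal_least)
  then show "p \<in> D.J \<Longrightarrow> zerosub p \<in> A.J" by blast
qed

text \<open>The elements that embed into \<open>D.J\<close> up to a multiple of \<open>z\<close> form an ideal, as \<open>z\<close> is central, and this ideal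
  contains the relations \<open>r i\<close>.\<close>

lemma J_lift:
  assumes "zerosub p \<in> A.J"
  obtains y where "p - zgen * y \<in> D.J"
proof -
  note ts = D.two_sided_J
  let ?H = "{q. \<exists>y. emb q - zgen * y \<in> D.J}"
  have "two_sided ?H"
  proof (rule two_sidedI)
    show "0 \<in> ?H" using two_sided_0[OF ts] by (auto intro!: exI[of _ 0])
  next
    fix a b assume "a \<in> ?H" "b \<in> ?H"
    then obtain y y' where "emb a - zgen * y \<in> D.J" "emb b - zgen * y' \<in> D.J" by blast
    from two_sided_add[OF ts this] have "emb (a + b) - zgen * (y + y') \<in> D.J"
      by (simp add: emb_add algebra_simps)
    then show "a + b \<in> ?H" by blast
  next
    fix u a assume "a \<in> ?H"
    then obtain y where y: "emb a - zgen * y \<in> D.J" by blast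
    have "emb (u * a) - zgen * (emb u * y) \<in> D.J"
      using two_sided_left[OF ts y, of "emb u"]
      by (simp add: emb_mult right_diff_distrib) (metis mult.assoc zgen_central)
    then show "u * a \<in> ?H" by blast
    have "emb (a * u) - zgen * (y * emb u) \<in> D.J"
      using two_sided_right[OF ts y, of "emb u"] by (simp add: emb_mult left_diff_distrib mult.assoc)
    then show "a * u \<in> ?H" by blast
  qed
  moreover have "r ` {..<m} \<subseteq> ?H"
  proof
    fix s assume "s \<in> r ` {..<m}"
    then obtain i where i: "i < m" "s = r i" by auto
    obtain y where y: "h i = emb (zerosub (h i)) + zgen * y" by (rule z_decomposition)
    then have "emb s - zgen * (- y) = h i" using i by (simp add: zerosub_h)
    moreover have "h i \<in> D.J" using i by (auto intro: gen_ideal_base)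
    ultimately show "s \<in> ?H" by (metis (mono_tags) mem_Collect_eq)
  qed
  ultimately have "A.J \<subseteq> ?H" by (rule gen_ideal_least)
  then obtain y where y: "emb (zerosub p) - zgen * y \<in> D.J" using assms by blast
  obtain y' where y': "p = emb (zerosub p) + zgen * y'" by (rule z_decomposition)
  have "p - zgen * (y + y') = emb (zerosub p) - zgen * y"
    by (subst y') (simp add: algebra_simps)
  then show ?thesis using that y by metis
qed

end

section \<open>Elements of the ideal that vanish at \<open>z = 0\<close>\<close>

lemma zerosub_row_mult:
  assumes "fin_supp a"
  shows "zerosub (row_mult a N j) = row_mult (\<lambda>i. zerosub (a i)) (\<lambda>i j. zerosub (N i j)) j"
proof -
  have "finite {i. a i \<noteq> 0}" using assms by (simp add: fin_supp_def)
  then show ?thesis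
    by (subst (1 2) row_mult_sum[of "{i. a i \<noteq> 0}"]) (auto simp: zerosub_sum zerosub_mult)
qed

lemma emb_row_mult: "emb (row_mult a N j) = row_mult (\<lambda>i. emb (a i)) (emb_mat N) j"
  by (simp add: row_mult_def emb_sum emb_mult emb_mat_def)

lemma row_mult_Plus:
  assumes "fin_supp v"
  shows "row_mult v N b = row_mult (\<lambda>i. v (Inl i)) (\<lambda>i. N (Inl i)) b + row_mult (\<lambda>i. v (Inr i)) (\<lambda>i. N (Inr i)) b"
proof -
  have fin: "finite {i. v (Inl i) \<noteq> 0}" "finite {i. v (Inr i) \<noteq> 0}"
    using finite_vimageI[OF assms[unfolded fin_supp_def], of Inl]
      finite_vimageI[OF assms[unfolded fin_supp_def], of Inr] by (auto simp: vimage_def)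
  have eq: "{i. v i \<noteq> 0} = {i. v (Inl i) \<noteq> 0} <+> {i. v (Inr i) \<noteq> 0}"
  proof (rule Set.set_eqI)
    fix a show "a \<in> {i. v i \<noteq> 0} \<longleftrightarrow> a \<in> {i. v (Inl i) \<noteq> 0} <+> {i. v (Inr i) \<noteq> 0}"
      by (cases a) auto
  qed
  show ?thesis unfolding row_mult_def eq using fin by (subst sum.Plus) auto
qed

lemma fin_supp_Inl: "fin_supp v \<Longrightarrow> fin_supp (\<lambda>i. v (Inl i))"
  and fin_supp_Inr: "fin_supp v \<Longrightarrow> fin_supp (\<lambda>i. v (Inr i))"
  using finite_vimageI[of "{i. v i \<noteq> 0}" Inl] finite_vimageI[of "{i. v i \<noteq> 0}" Inr]
  by (auto simp: fin_supp_def vimage_def)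

lemma fin_supp_case_sum:
  assumes "fin_supp a" "fin_supp b"
  shows "fin_supp (case_sum a b)"
  unfolding fin_supp_def
proof (rule finite_subset)
  show "{i. case_sum a b i \<noteq> 0} \<subseteq> {i. a i \<noteq> 0} <+> {i. b i \<noteq> 0}"
  proof
    fix x assume "x \<in> {i. case_sum a b i \<noteq> 0}"
    then show "x \<in> {i. a i \<noteq> 0} <+> {i. b i \<noteq> 0}" by (cases x) auto
  qed
qed (use assms in \<open>auto simp: fin_supp_def\<close>)

lemma row_mult_zero [simp]: "row_mult (\<lambda>_. 0) N j = 0" by (simp add: row_mult_def)

lemma row_mult_diagonal:
  assumes "fin_supp v"
  shows "row_mult v (\<lambda>i j. if i = j \<and> P i then u else 0) j = (if P j then v j * u else 0)"
proof -
  have "row_mult v (\<lambda>i j. if i = j \<and> P i then u else 0) j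
    = (\<Sum>i\<in>insert j {i. v i \<noteq> 0}. v i * (if i = j \<and> P i then u else 0))"
    by (rule row_mult_sum) (use assms in \<open>auto simp: fin_supp_def\<close>)
  also have "\<dots> = (\<Sum>i\<in>insert j {i. v i \<noteq> 0}. if i = j then (if P j then v j * u else 0) else 0)"
    by (intro sum.cong) auto
  also have "\<dots> = (if P j then v j * u else 0)"
    using assms by (subst sum.delta) (auto simp: fin_supp_def)
  finally show ?thesis .
qed

lemma row_mult_diagonal_left:
  "row_mult (\<lambda>j. if i = j \<and> P then u else 0) N k = (if P then u * N i k else (0 :: 'a :: semiring_1))"
proof (cases P)
  case True
  then show ?thesis using row_mult_unit[of i u N k] by (simp add: eq_commute)
qed simp

lemma single_0_central: "Poly_Mapping.single 0 (c :: 'k::field) * p = p * Poly_Mapping.single 0 c"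
  by (induction p rule: monomial_induct) (auto simp: mult_single distrib_left distrib_right mult.commute)

context deformation
begin

lemma zerosub_gen_ideal:
  assumes "B \<subseteq> {..<m}" "p \<in> gen_ideal (h ` B)"
  shows "zerosub p \<in> gen_ideal (r ` B)"
proof -
  note ts = two_sided_gen_ideal[of "r ` B"]
  have "two_sided {p :: ('x, 'k) falgz. zerosub p \<in> gen_ideal (r ` B)}"
    by (rule two_sidedI) (auto simp: zerosub_add zerosub_mult two_sided_0[OF ts]
      two_sided_add[OF ts] two_sided_left[OF ts] two_sided_right[OF ts])
  moreover have "h ` B \<subseteq> {p. zerosub p \<in> gen_ideal (r ` B)}"
    using assms(1) by (auto simp: zerosub_h subset_iff intro: gen_ideal_base)
  ultimately have "gen_ideal (h ` B) \<subseteq> {p. zerosub p \<in> gen_ideal (r ` B)}" by (rule gen_ideal_least)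
  then show ?thesis using assms(2) by blast
qed

text \<open>In degree \<open>d\<close>, an element of the ideal is a combination \<open>\<Sum> c\<^sub>j h\<^sub>j\<close> of the relations of degree \<open>d\<close> plus
  an element of the ideal generated by the relations of smaller degree. If it vanishes at \<open>z = 0\<close>, then so does
  \<open>\<Sum> c\<^sub>j r\<^sub>j\<close> modulo the relations of smaller degree. A coefficient \<open>c\<^sub>i \<noteq> 0\<close> would put \<open>r\<^sub>i\<close> into the
  ideal generated by the other relations.\<close>

lemma zero_symbol_in_lower_ideal:
  assumes minimal: "minimal_relations m r"
    and y: "y \<in> D.J" "y \<in> wt_comp wlenz (int d)" "zerosub y = 0"
  shows "y \<in> gen_ideal (h ` {j. j < m \<and> fdeg (r j) < d})"
proof -
  define K where "K = gen_ideal (h ` {j. j < m \<and> fdeg (r j) < d})"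
  define E where "E = {j. j < m \<and> fdeg (r j) = d}"
  define high :: "('x, 'k) falgz set" where "high = {\<tau>. \<forall>w\<in>Poly_Mapping.keys \<tau>. d < wlenz w}"
  define comb :: "(nat \<Rightarrow> 'k) \<Rightarrow> ('x, 'k) falgz" where "comb = (\<lambda>c. \<Sum>j\<in>E. Poly_Mapping.single 0 (c j) * h j)"
  note K = two_sided_gen_ideal[of "h ` {j. j < m \<and> fdeg (r j) < d}", folded K_def]
  have h_E: "h j \<in> wt_comp wlenz (int d)" if "j \<in> E" for j
    using h_comp that by (auto simp: E_def)
  have comb_comp: "comb c \<in> wt_comp wlenz (int d)" for c
    unfolding comb_def
  proof (rule wt_comp_sum)
    fix j assume "j \<in> E"
    have "Poly_Mapping.single 0 (c j) \<in> wt_comp wlenz 0"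
      by (rule wt_comp_single) (simp add: wlenz.wt_0_iff)
    from wlenz.wt_comp_mult[OF this h_E[OF \<open>j \<in> E\<close>]]
    show "Poly_Mapping.single 0 (c j) * h j \<in> wt_comp wlenz (int d)" by simp
  qed
  have comb_add: "comb c + comb c' = comb (\<lambda>j. c j + c' j)" for c c'
    by (simp add: comb_def single_add distrib_right sum.distrib)
  have comb_scale: "Poly_Mapping.single 0 a * comb c = comb (\<lambda>j. a * c j)" for a c
    by (simp add: comb_def sum_distrib_left mult_single flip: mult.assoc)
  have high_add: "\<tau> + \<tau>' \<in> high" if "\<tau> \<in> high" "\<tau>' \<in> high" for \<tau> \<tau>'
    using that keys_add[of \<tau> \<tau>'] by (auto simp: high_def)
  have high_left: "Poly_Mapping.single w a * \<tau> \<in> high" if "\<tau> \<in> high" for w a \<tau>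
    unfolding high_def
  proof (intro CollectI ballI)
    fix v assume "v \<in> Poly_Mapping.keys (Poly_Mapping.single w a * \<tau>)"
    then obtain u where "u \<in> Poly_Mapping.keys \<tau>" "v = w + u"
      using keys_mult[of "Poly_Mapping.single w a" \<tau>] by (auto split: if_splits)
    then show "d < wlenz v" using that by (auto simp: high_def wlenz.wt_add)
  qed
  have high_right: "\<tau> * Poly_Mapping.single w a \<in> high" if "\<tau> \<in> high" for w a \<tau>
    unfolding high_def
  proof (intro CollectI ballI)
    fix v assume "v \<in> Poly_Mapping.keys (\<tau> * Poly_Mapping.single w a)"
    then obtain u where "u \<in> Poly_Mapping.keys \<tau>" "v = u + w"
      using keys_mult[of \<tau> "Poly_Mapping.single w a"] by (auto split: if_splits)
    then show "d < wlenz v" using that by (auto simp: high_def wlenz.wt_add)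
  qed
  have high_comp: "p \<in> high" if "p \<in> wt_comp wlenz (int e)" "d < e" for p e
    using that by (force simp: high_def wt_comp_def)
  have high_0: "0 \<in> high" by (simp add: high_def)
  have raise: "Poly_Mapping.single w a * comb c \<in> high" "comb c * Poly_Mapping.single w a \<in> high"
    if "w \<noteq> 0" for w a c
  proof -
    have w: "Poly_Mapping.single w a \<in> wt_comp wlenz (int (wlenz w))" by (rule wt_comp_single) simp
    have pos: "wlenz w > 0" using that by (metis gr0I wlenz.wt_0_iff)
    show "Poly_Mapping.single w a * comb c \<in> high"
      using wlenz.wt_comp_mult[OF w comb_comp] pos by (intro high_comp[of _ "wlenz w + d"]) auto
    show "comb c * Poly_Mapping.single w a \<in> high"
      using wlenz.wt_comp_mult[OF comb_comp w] pos by (intro high_comp[of _ "d + wlenz w"]) auto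
  qed
  \<comment> \<open>Elements of arbitrary higher degree are included to make \<open>Y\<close> an ideal: a multiple of a relation of
    degree \<open>d\<close> by a nonconstant monomial has degree above \<open>d\<close>.\<close>
  define Y where "Y = {p. \<exists>\<kappa> c \<tau>. \<kappa> \<in> K \<and> \<tau> \<in> high \<and> p = \<kappa> + comb c + \<tau>}"
  have YI: "\<kappa> + comb c + \<tau> \<in> Y" if "\<kappa> \<in> K" "\<tau> \<in> high" for \<kappa> c \<tau>
    using that by (auto simp: Y_def)
  have comb_0: "comb (\<lambda>_. 0) = 0" by (simp add: comb_def)
  have "two_sided Y"
  proof (rule wlenz.two_sidedI_monomial)
    show "0 \<in> Y" using YI[OF two_sided_0[OF K] high_0, of "\<lambda>_. 0"] by (simp add: comb_0)
  next
    fix a b assume "a \<in> Y" "b \<in> Y"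
    then obtain \<kappa> c \<tau> \<kappa>' c' \<tau>' where "\<kappa> \<in> K" "\<tau> \<in> high" "a = \<kappa> + comb c + \<tau>"
      and "\<kappa>' \<in> K" "\<tau>' \<in> high" "b = \<kappa>' + comb c' + \<tau>'" by (auto simp: Y_def)
    moreover from this have "a + b = (\<kappa> + \<kappa>') + comb (\<lambda>j. c j + c' j) + (\<tau> + \<tau>')"
      by (simp add: comb_add[symmetric] ac_simps)
    ultimately show "a + b \<in> Y" using YI[OF two_sided_add[OF K] high_add] by metis
  next
    fix w :: "'x fword \<times> nat" and a :: 'k and p assume "p \<in> Y"
    then obtain \<kappa> c \<tau> where p: "\<kappa> \<in> K" "\<tau> \<in> high" "p = \<kappa> + comb c + \<tau>" by (auto simp: Y_def)
    let ?u = "Poly_Mapping.single w a"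
    show "?u * p \<in> Y"
    proof (cases "w = 0")
      case True
      have "?u * p = ?u * \<kappa> + comb (\<lambda>j. a * c j) + ?u * \<tau>"
        using True by (simp add: p(3) distrib_left comb_scale)
      then show ?thesis using YI[OF two_sided_left[OF K p(1)] high_left[OF p(2)]] by simp
    next
      case False
      have "?u * p = ?u * \<kappa> + comb (\<lambda>_. 0) + (?u * comb c + ?u * \<tau>)"
        by (simp add: p(3) distrib_left comb_0 add.assoc)
      then show ?thesis
        using YI[OF two_sided_left[OF K p(1)] high_add[OF raise(1)[OF False] high_left[OF p(2)]]] by simp
    qed
    show "p * ?u \<in> Y"
    proof (cases "w = 0")
      case True
      then have "p * ?u = ?u * p" by (simp add: single_0_central)
      then show ?thesis using \<open>?u * p \<in> Y\<close> by simp
    next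
      case False
      have "p * ?u = \<kappa> * ?u + comb (\<lambda>_. 0) + (comb c * ?u + \<tau> * ?u)"
        by (simp add: p(3) distrib_right comb_0 add.assoc)
      then show ?thesis
        using YI[OF two_sided_right[OF K p(1)] high_add[OF raise(2)[OF False] high_right[OF p(2)]]] by simp
    qed
  qed
  moreover have "h ` {..<m} \<subseteq> Y"
  proof
    fix p assume "p \<in> h ` {..<m}"
    then obtain j where j: "j < m" "p = h j" by auto
    consider "fdeg (r j) < d" | "j \<in> E" | "fdeg (r j) > d" using j by (fastforce simp: E_def)
    then show "p \<in> Y"
    proof cases
      case 1
      then have "p \<in> K" using j by (auto simp: K_def intro!: gen_ideal_base)
      then show ?thesis using YI[OF _ high_0, of p "\<lambda>_. 0"] by (simp add: comb_0)
    next
      case 2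
      have "comb (\<lambda>i. if i = j then 1 else 0) = (\<Sum>i\<in>E. if i = j then h j else 0)"
        unfolding comb_def by (intro sum.cong) (auto simp: single_zero single_one)
      also have "\<dots> = h j" using 2 by (simp add: E_def)
      finally show ?thesis
        using YI[OF two_sided_0[OF K] high_0, of "\<lambda>i. if i = j then 1 else 0"] j by simp
    next
      case 3
      then have "p \<in> high" using h_comp[of j] j by (auto intro: high_comp)
      then show ?thesis using YI[OF two_sided_0[OF K], of p "\<lambda>_. 0"] by (simp add: comb_0)
    qed
  qed
  ultimately have "y \<in> Y" using gen_ideal_least[of Y] y(1) by blast
  then obtain \<kappa> c \<tau> where k: "\<kappa> \<in> K" "\<tau> \<in> high" "y = \<kappa> + comb c + \<tau>" by (auto simp: Y_def)
  have "hpart wlenz (int d) \<tau> = 0"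
    using k(2) by (intro poly_mapping_eqI) (auto simp: lookup_hpart when_def high_def in_keys_iff)
  moreover have "hpart wlenz (int d) y = y" "hpart wlenz (int d) (comb c) = comb c"
    using hpart_homogeneous[OF y(2)] hpart_homogeneous[OF comb_comp] by auto
  ultimately have y_eq: "y = hpart wlenz (int d) \<kappa> + comb c"
    by (metis (no_types, lifting) add.right_neutral hpart_add k(3))
  define \<kappa>' where "\<kappa>' = hpart wlenz (int d) \<kappa>"
  have \<kappa>': "\<kappa>' \<in> K"
    unfolding \<kappa>'_def K_def
  proof (rule wlenz.hpart_gen_ideal)
    show "\<exists>e. p \<in> wt_comp wlenz e" if "p \<in> h ` {j. j < m \<and> fdeg (r j) < d}" for p
      using that h_comp by auto
  qed (use k(1) K_def in simp)
  have c_0: "c i = 0" if i: "i \<in> E" for i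
  proof (rule ccontr)
    assume ci: "c i \<noteq> 0"
    let ?B = "r ` ({..<m} - {i})"
    note ts = two_sided_gen_ideal[of ?B]
    have sub: "r j \<in> gen_ideal ?B" if "j < m" "j \<noteq> i" for j
      using that by (auto intro!: gen_ideal_base)
    have "zerosub \<kappa>' \<in> gen_ideal (r ` {j. j < m \<and> fdeg (r j) < d})"
      using \<kappa>' by (intro zerosub_gen_ideal) (auto simp: K_def)
    also have "\<dots> \<subseteq> gen_ideal ?B"
      using i by (intro gen_ideal_least ts) (auto simp: E_def intro!: sub)
    finally have *: "zerosub \<kappa>' \<in> gen_ideal ?B" .
    have fin: "finite E" by (simp add: E_def)
    have "0 = zerosub \<kappa>' + (\<Sum>j\<in>E. Poly_Mapping.single 0 (c j) * r j)"
    proof -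
      have "zerosub (comb c) = (\<Sum>j\<in>E. Poly_Mapping.single 0 (c j) * r j)"
        unfolding comb_def zerosub_sum
        by (intro sum.cong) (auto simp: zerosub_mult zerosub_single zerosub_h E_def)
      then show ?thesis using y(3) y_eq by (simp add: zerosub_add \<kappa>'_def)
    qed
    also have "(\<Sum>j\<in>E. Poly_Mapping.single 0 (c j) * r j)
      = Poly_Mapping.single 0 (c i) * r i + (\<Sum>j\<in>E - {i}. Poly_Mapping.single 0 (c j) * r j)"
      using sum.remove[OF fin i] by blast
    finally have eq: "Poly_Mapping.single 0 (c i) * r i
      = - (zerosub \<kappa>' + (\<Sum>j\<in>E - {i}. Poly_Mapping.single 0 (c j) * r j))"
      by (simp add: algebra_simps eq_neg_iff_add_eq_0)
    have "(\<Sum>j\<in>E - {i}. Poly_Mapping.single 0 (c j) * r j) \<in> gen_ideal ?B"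
      by (rule two_sided_sum[OF ts]) (auto simp: E_def intro!: two_sided_left[OF ts] sub)
    then have "Poly_Mapping.single 0 (c i) * r i \<in> gen_ideal ?B"
      unfolding eq using * by (intro two_sided_uminus[OF ts] two_sided_add[OF ts])
    from two_sided_left[OF ts this, of "Poly_Mapping.single 0 (inverse (c i))"]
    have "r i \<in> gen_ideal ?B" using ci by (simp add: mult_single flip: mult.assoc)
    then show False using minimal i by (auto simp: minimal_relations_def E_def)
  qed
  have "comb c = 0" unfolding comb_def by (rule sum.neutral) (simp add: c_0)
  then show ?thesis using y_eq \<kappa>' by (simp add: \<kappa>'_def K_def)
qed

end

section \<open>The obstruction to being a complex\<close>

text \<open>The data of the theorem: \<open>H n\<close> below is the matrix of the differential of degree \<open>n\<close> in the
  sequence \<open>Q^\<close>, its rows are indexed by \<open>idx n\<close>, and \<open>\<sigma> n\<close> gives the shifts of the basis.\<close>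

locale hat_sequence = deformation m r l
  for m :: nat and r l :: "nat \<Rightarrow> ('x::finite, 'k::field) falg" +
  fixes x :: "nat \<Rightarrow> 'x"
    and t :: "nat \<Rightarrow> enat"
    and s :: "nat \<Rightarrow> nat \<Rightarrow> int"
    and M :: "nat \<Rightarrow> nat \<Rightarrow> nat \<Rightarrow> ('x, 'k) falg"
    and f :: "nat \<Rightarrow> nat \<Rightarrow> nat \<Rightarrow> ('x, 'k) falgz"
  assumes x_enum: "bij_betw x {..<CARD('x)} UNIV"
    and r_min: "minimal_relations m r"
    and t_fin: "t 0 = 1" "t 1 = enat (CARD('x))" "t 2 = enat m"
    and s_low: "s 0 0 = 0"
    and M_mat: "\<And>n. n \<ge> 1 \<Longrightarrow> row_finite_matrix (t n) (t (n - 1)) (M n)"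
    and M_deg: "\<And>n i j. n \<ge> 1 \<Longrightarrow> enat i < t n \<Longrightarrow> enat j < t (n - 1) \<Longrightarrow>
                  M n i j \<in> T_comp (s (n - 1) j - s n i)"
    and M_1: "\<And>i. i < CARD('x) \<Longrightarrow> M 1 i 0 = fgen (x i)"
    and M_2: "\<And>i. i < m \<Longrightarrow> mat_mult (M 2) (M 1) i 0 = r i"
    and Q_res: "minimal_projective_resolution (A_alg m r) (A_comp m r)
                  (Q_mod m r t s) (Q_delta m r M) (trivial_module (A_alg m r) (A_comp m r))"
    and f_mat: "\<And>n. n \<ge> 2 \<Longrightarrow> row_finite_matrix (t n) (t (n - 2)) (f n)"
    and f_deg: "\<And>n i j. n \<ge> 2 \<Longrightarrow> enat i < t n \<Longrightarrow> enat j < t (n - 2) \<Longrightarrow>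
                  f n i j \<in> Tz_comp (s (n - 2) j - s n i - 1)"
    and f_eq: "\<And>n i j. n \<ge> 2 \<Longrightarrow> enat i < t n \<Longrightarrow> enat j < t (n - 2) \<Longrightarrow>
                  pi_D m r l (mat_mult (emb_mat (M n)) (emb_mat (M (n - 1))) i j
                    - (- 1) ^ (n - 1) * zgen * f n i j) = \<zero>\<^bsub>D_alg m r l\<^esub>"
begin

definition idx :: "nat \<Rightarrow> (nat + nat) set"
  where "idx n = {i. enat i < t n} <+> (if n = 0 then {} else {i. enat i < t (n - 1)})"
definition \<sigma> :: "nat \<Rightarrow> nat + nat \<Rightarrow> int"
  where "\<sigma> n = case_sum (s n) (\<lambda>i. s (n - 1) i - 1)"
definition H :: "nat \<Rightarrow> nat + nat \<Rightarrow> nat + nat \<Rightarrow> ('x, 'k) falgz"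
  where "H = hat_mat t M f"
definition \<zeta> :: "nat \<Rightarrow> ('x, 'k) falgz" where "\<zeta> n = (- 1) ^ (n - 1) * zgen"

lemma \<zeta>_central: "p * \<zeta> n = \<zeta> n * p"
  by (cases "even (n - 1)") (simp_all add: \<zeta>_def zgen_central)

lemma H_Inl_Inl: "H n (Inl i) (Inl j) = emb (M n i j)" by (simp add: H_def hat_mat_def)
lemma H_Inr_Inl: "H n (Inr i) (Inl j) = (if i = j \<and> enat i < t (n - 1) then \<zeta> n else 0)"
  by (auto simp: H_def hat_mat_def \<zeta>_def)
lemma H_Inl_Inr: "H n (Inl i) (Inr j) = (if n \<ge> 2 then f n i j else 0)" by (simp add: H_def hat_mat_def)
lemma H_Inr_Inr: "H n (Inr i) (Inr j) = (if n \<ge> 2 then emb (M (n - 1) i j) else 0)"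
  by (simp add: H_def hat_mat_def)
lemmas H_simps = H_Inl_Inl H_Inr_Inl H_Inl_Inr H_Inr_Inr

lemma M_supp: "n \<ge> 1 \<Longrightarrow> M n i j \<noteq> 0 \<Longrightarrow> enat i < t n \<and> enat j < t (n - 1)"
  using M_mat unfolding row_finite_matrix_def by blast
lemma f_supp: "n \<ge> 2 \<Longrightarrow> f n i j \<noteq> 0 \<Longrightarrow> enat i < t n \<and> enat j < t (n - 2)"
  using f_mat unfolding row_finite_matrix_def by blast
lemma M_fin: "n \<ge> 1 \<Longrightarrow> fin_supp (M n i)"
  using M_mat unfolding row_finite_matrix_def fin_supp_def by blast
lemma emb_M_fin: "n \<ge> 1 \<Longrightarrow> fin_supp (emb_mat (M n) i)"
  using M_fin[of n i] by (simp add: fin_supp_def emb_mat_def)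
lemma f_fin: "n \<ge> 2 \<Longrightarrow> fin_supp (f n i)"
  using f_mat unfolding row_finite_matrix_def fin_supp_def by blast

lemma M_comp: "n \<ge> 1 \<Longrightarrow> enat i < t n \<Longrightarrow> enat j < t (n - 1) \<Longrightarrow> M n i j \<in> wt_comp wlen (s (n - 1) j - s n i)"
  using M_deg by (simp add: T_comp_wt)
lemma f_comp: "n \<ge> 2 \<Longrightarrow> enat i < t n \<Longrightarrow> enat j < t (n - 2) \<Longrightarrow> f n i j \<in> wt_comp wlenz (s (n - 2) j - s n i - 1)"
  using f_deg by (simp add: Tz_comp_wt)

lemma H_row_Inl: "(\<lambda>j. H n a (Inl j)) = (case a of Inl i \<Rightarrow> emb_mat (M n) i
    | Inr i \<Rightarrow> (\<lambda>j. if i = j \<and> enat i < t (n - 1) then \<zeta> n else 0))"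
  by (cases a) (auto simp: H_simps emb_mat_def)
lemma H_row_Inr: "n \<ge> 2 \<Longrightarrow> (\<lambda>j. H n a (Inr j)) = (case a of Inl i \<Rightarrow> f n i | Inr i \<Rightarrow> emb_mat (M (n - 1)) i)"
  by (cases a) (auto simp: H_simps emb_mat_def)

lemma H_fin:
  assumes "n \<ge> 1"
  shows "fin_supp (H n a)"
proof -
  have eq: "H n a = case_sum (\<lambda>j. H n a (Inl j)) (\<lambda>j. H n a (Inr j))"
    by (rule ext) (simp split: sum.split)
  have "fin_supp (\<lambda>j. H n a (Inl j))"
    unfolding H_row_Inl using emb_M_fin[OF assms]
    by (auto split: sum.splits simp: fin_supp_def intro: finite_subset[of _ "{_}"])
  moreover have "fin_supp (\<lambda>j. H n a (Inr j))"
  proof (cases "n \<ge> 2")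
    case True
    then show ?thesis unfolding H_row_Inr[OF True] using f_fin emb_M_fin[of "n - 1"] by (auto split: sum.splits)
  next
    case False
    then have "(\<lambda>j. H n a (Inr j)) = (\<lambda>_. 0)" by (cases a) (auto simp: H_simps)
    then show ?thesis by (simp add: fin_supp_def)
  qed
  ultimately show ?thesis by (subst eq) (rule fin_supp_case_sum)
qed

lemma H_supp:
  assumes "n \<ge> 1" "H n a b \<noteq> 0"
  shows "a \<in> idx n" "b \<in> idx (n - 1)"
proof -
  have "a \<in> idx n \<and> b \<in> idx (n - 1)"
    using assms M_supp[of n] f_supp[of n] M_supp[of "n - 1"]
    by (cases a; cases b) (auto simp: H_simps idx_def numeral_2_eq_2 split: if_splits)
  then show "a \<in> idx n" "b \<in> idx (n - 1)" by auto
qed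

lemma \<zeta>_comp: "\<zeta> n \<in> wt_comp wlenz 1"
  using zgen_comp wt_comp_uminus[OF zgen_comp] by (cases "even (n - 1)") (auto simp: \<zeta>_def)

lemma H_comp:
  assumes "n \<ge> 1" "a \<in> idx n" "b \<in> idx (n - 1)"
  shows "H n a b \<in> wt_comp wlenz (\<sigma> (n - 1) b - \<sigma> n a)"
proof (cases a; cases b)
  fix i j assume [simp]: "a = Inl i" "b = Inl j"
  have "M n i j \<in> wt_comp wlen (s (n - 1) j - s n i)"
    using assms by (intro M_comp) (auto simp: idx_def split: if_splits)
  then show ?thesis by (simp add: H_simps \<sigma>_def emb_comp)
next
  fix i j assume [simp]: "a = Inr i" "b = Inl j"
  show ?thesis using \<zeta>_comp by (auto simp: H_simps \<sigma>_def wt_comp_0)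
next
  fix i j assume [simp]: "a = Inl i" "b = Inr j"
  show ?thesis
  proof (cases "n \<ge> 2")
    case True
    then have "f n i j \<in> wt_comp wlenz (s (n - 2) j - s n i - 1)"
      using assms by (intro f_comp) (auto simp: idx_def numeral_2_eq_2 split: if_splits)
    then show ?thesis using True by (simp add: H_simps \<sigma>_def algebra_simps numeral_2_eq_2)
  qed (simp add: H_simps wt_comp_0)
next
  fix i j assume [simp]: "a = Inr i" "b = Inr j"
  show ?thesis
  proof (cases "n \<ge> 2")
    case True
    then have "M (n - 1) i j \<in> wt_comp wlen (s (n - 1 - 1) j - s (n - 1) i)"
      using assms by (intro M_comp) (auto simp: idx_def split: if_splits)
    then show ?thesis using True by (simp add: H_simps \<sigma>_def emb_comp)
  qed (simp add: H_simps wt_comp_0)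
qed

text \<open>The upper right block of \<open>H n * H (n - 1)\<close>, for \<open>n \<ge> 3\<close>.\<close>

definition obstruction :: "nat \<Rightarrow> nat \<Rightarrow> nat \<Rightarrow> ('x, 'k) falgz"
  where "obstruction n i j = mat_mult (emb_mat (M n)) (f (n - 1)) i j + mat_mult (f n) (emb_mat (M (n - 2))) i j"

text \<open>The signs of consecutive differentials differ; this cancels the lower left block of the product.\<close>

lemma \<zeta>_minus: "n \<ge> 2 \<Longrightarrow> \<zeta> n = - \<zeta> (n - 1)"
proof -
  assume "n \<ge> 2"
  then obtain k where "n = Suc (Suc k)" by (metis add_2_eq_Suc le_Suc_ex)
  then show ?thesis by (simp add: \<zeta>_def)
qed

lemma emb_mat_mult_outside:
  assumes "n \<ge> 2" "\<not> (enat i < t n \<and> enat j < t (n - 2))"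
  shows "mat_mult (emb_mat (M n)) (emb_mat (M (n - 1))) i j = 0"
proof -
  have "M n i k = 0 \<or> M (n - 1) k j = 0" for k
    using M_supp[of n i k] M_supp[of "n - 1" k j] assms by (force simp: numeral_2_eq_2)
  then have "M n i k * M (n - 1) k j = 0" for k
    by (metis mult_zero_left mult_zero_right)
  then have "emb (M n i k) * emb (M (n - 1) k j) = 0" for k
    by (metis emb_0 emb_mult)
  then show ?thesis by (simp add: mat_mult_def emb_mat_def)
qed

text \<open>Outside the index range both terms are zero, so the defining congruence of \<open>f n\<close> holds for all
  indices.\<close>

lemma f_eq_J: "n \<ge> 2 \<Longrightarrow> mat_mult (emb_mat (M n)) (emb_mat (M (n - 1))) i j - \<zeta> n * f n i j \<in> D.J"
proof (cases "enat i < t n \<and> enat j < t (n - 2)")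
  case True
  assume "n \<ge> 2"
  then show ?thesis using True f_eq[of n i j] by (simp add: D.\<pi>_zero_iff pi_D_eq D_alg_eq \<zeta>_def)
next
  case False
  assume n: "n \<ge> 2"
  have "f n i j = 0" using f_supp[OF n] False by blast
  then show ?thesis using emb_mat_mult_outside[OF n False] two_sided_0[OF D.two_sided_J] by simp
qed

lemma row_H_Inl:
  assumes "fin_supp v"
  shows "row_mult v (H n) (Inl j) = row_mult (\<lambda>i. v (Inl i)) (emb_mat (M n)) j
      + (if enat j < t (n - 1) then v (Inr j) * \<zeta> n else 0)"
proof -
  have "row_mult (\<lambda>i. v (Inl i)) (\<lambda>i. H n (Inl i)) (Inl j) = row_mult (\<lambda>i. v (Inl i)) (emb_mat (M n)) j"
    by (simp add: row_mult_def H_simps emb_mat_def)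
  moreover have "row_mult (\<lambda>i. v (Inr i)) (\<lambda>i. H n (Inr i)) (Inl j) = (if enat j < t (n - 1) then v (Inr j) * \<zeta> n else 0)"
    using row_mult_diagonal[OF fin_supp_Inr[OF assms], of "\<lambda>i. enat i < t (n - 1)" "\<zeta> n" j]
    by (simp add: row_mult_def H_simps)
  ultimately show ?thesis by (simp add: row_mult_Plus[OF assms])
qed

lemma row_H_Inr:
  assumes "fin_supp v" "n \<ge> 2"
  shows "row_mult v (H n) (Inr j) = row_mult (\<lambda>i. v (Inl i)) (f n) j + row_mult (\<lambda>i. v (Inr i)) (emb_mat (M (n - 1))) j"
  unfolding row_mult_Plus[OF assms(1), of "H n"]
  using assms(2) by (simp add: row_mult_def H_simps emb_mat_def)

lemma row_H_1_Inr: "row_mult v (H (Suc 0)) (Inr j) = 0"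
proof -
  have "H (Suc 0) a (Inr j) = 0" for a by (cases a) (auto simp: H_simps)
  then show ?thesis by (simp add: row_mult_def)
qed

lemma composite_Inl_Inl:
  assumes n: "n \<ge> 2"
  shows "mat_mult (H n) (H (n - 1)) (Inl i) (Inl j)
    = mat_mult (emb_mat (M n)) (emb_mat (M (n - 1))) i j - \<zeta> n * f n i j"
proof -
  have "n \<ge> 1" "n - 1 \<ge> 1" "n - 1 - 1 = n - 2" using n by auto
  moreover have "f n i j = 0" if "\<not> enat j < t (n - 2)" using f_supp[OF n, of i j] that by blast
  ultimately show ?thesis
    using n unfolding mat_mult_row row_H_Inl[OF H_fin[OF \<open>n \<ge> 1\<close>]] H_row_Inl
    by (auto simp: H_simps \<zeta>_minus[OF n] \<zeta>_central)
qed

lemma composite_Inr_Inl: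
  assumes n: "n \<ge> 2"
  shows "mat_mult (H n) (H (n - 1)) (Inr i) (Inl j) = 0"
proof -
  have le: "n \<ge> 1" "n - 1 \<ge> 1" using n by auto
  have M0: "M (n - 1) i j = 0" if "\<not> enat i < t (n - 1) \<or> \<not> enat j < t (n - 1 - 1)"
    using M_supp[OF le(2), of i j] that by blast
  show ?thesis
    using n M0 unfolding mat_mult_row row_H_Inl[OF H_fin[OF le(1)]] H_row_Inl
    by (auto simp: H_simps \<zeta>_minus[OF n] \<zeta>_central row_mult_diagonal_left emb_mat_def)
qed

lemma composite_Inl_Inr:
  assumes n: "n \<ge> 3"
  shows "mat_mult (H n) (H (n - 1)) (Inl i) (Inr j) = obstruction n i j"
proof -
  have le: "n \<ge> 1" "n \<ge> 2" "n - 1 \<ge> 2" "n - 1 - 1 = n - 2" using n by auto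
  show ?thesis
    using le unfolding mat_mult_row row_H_Inr[OF H_fin[OF le(1)] le(3)] H_row_Inl H_row_Inr[OF le(2)]
    by (simp add: obstruction_def mat_mult_row)
qed

lemma composite_Inr_Inr:
  assumes n: "n \<ge> 3"
  shows "mat_mult (H n) (H (n - 1)) (Inr i) (Inr j) \<in> D.J"
proof -
  have le: "n \<ge> 1" "n \<ge> 2" "n - 1 \<ge> 2" "n - 1 - 1 = n - 2" using n by auto
  have f0: "f (n - 1) i j = 0" if "\<not> enat i < t (n - 1)"
    using f_supp[OF le(3), of i j] that by blast
  have "mat_mult (H n) (H (n - 1)) (Inr i) (Inr j)
    = mat_mult (emb_mat (M (n - 1))) (emb_mat (M (n - 1 - 1))) i j - \<zeta> (n - 1) * f (n - 1) i j"
    using le f0 unfolding mat_mult_row row_H_Inr[OF H_fin[OF le(1)] le(3)] H_row_Inl H_row_Inr[OF le(2)]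
    by (simp add: row_mult_diagonal_left mat_mult_row \<zeta>_minus[OF le(2)])
  then show ?thesis using f_eq_J[OF le(3)] by simp
qed

lemma composite_2_Inr: "mat_mult (H 2) (H 1) a (Inr j) = 0"
  by (simp add: mat_mult_row row_H_1_Inr)

lemma composite_J:
  assumes "n \<ge> 2" "n \<ge> 3 \<Longrightarrow> \<forall>i j. a = Inl i \<and> b = Inr j \<longrightarrow> obstruction n i j \<in> D.J"
  shows "mat_mult (H n) (H (n - 1)) a b \<in> D.J"
proof (cases b)
  case (Inl j)
  then show ?thesis
    using assms(1) f_eq_J[OF assms(1)] two_sided_0[OF D.two_sided_J]
    by (cases a) (auto simp: composite_Inl_Inl composite_Inr_Inl simp del: One_nat_def)
next
  case (Inr j)
  show ?thesis
  proof (cases "n \<ge> 3")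
    case True
    then show ?thesis
      using assms(2) composite_Inl_Inr[OF True] composite_Inr_Inr[OF True] Inr by (cases a) auto
  next
    case False
    then have "n = 2" using assms(1) by simp
    then show ?thesis
      using composite_2_Inr[of a j] two_sided_0[OF D.two_sided_J] Inr by (simp add: numeral_2_eq_2)
  qed
qed

lemma H_mult_assoc:
  assumes "n \<ge> 3"
  shows "mat_mult (mat_mult (H n) (H (n - 1))) (H (n - 2)) a b = mat_mult (H n) (mat_mult (H (n - 1)) (H (n - 2))) a b"
proof -
  have "n \<ge> 1" "n - 1 \<ge> 1" using assms by auto
  then show ?thesis
    using row_mult_assoc[of "H n a" "H (n - 1)" "H (n - 2)" b] H_fin
    by (simp only: mat_mult_row)
qed

text \<open>Modulo the ideal, \<open>H n * H (n - 1)\<close> and \<open>H (n - 1) * H (n - 2)\<close> have at most an upper right block. Hence the upper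
  left block of \<open>(H n * H (n - 1)) * H (n - 2)\<close> is \<open>\<plusminus> z\<close> times the obstruction, whereas that of
  \<open>H n * (H (n - 1) * H (n - 2))\<close> is zero.\<close>

lemma zgen_obstruction:
  assumes n: "n \<ge> 3"
  shows "zgen * obstruction n i j \<in> D.J"
proof -
  note ts = D.two_sided_J
  have le: "n \<ge> 1" "n \<ge> 2" "n - 1 \<ge> 1" "n - 1 \<ge> 2" "n - 1 - 1 = n - 2" "n - 2 \<ge> 1" "n - 1 - 2 = n - 2 - 1" using n by auto
  have B0: "obstruction n i j = 0" if "\<not> enat j < t (n - 2 - 1)"
  proof -
    have "f (n - 1) k j = 0" "M (n - 2) k j = 0" for k
      using f_supp[OF le(4), of k j] M_supp[OF le(6), of k j] that le(7) by auto
    then show ?thesis by (simp add: obstruction_def mat_mult_def emb_mat_def)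
  qed
  have fin: "fin_supp (mat_mult (H n) (H (n - 1)) (Inl i))"
    unfolding mat_mult_row by (intro fin_supp_row_mult H_fin le)
  define P where "P = row_mult (\<lambda>k. mat_mult (H n) (H (n - 1)) (Inl i) (Inl k)) (emb_mat (M (n - 2))) j"
  define C where "C = (if enat j < t (n - 2 - 1) then obstruction n i j * \<zeta> (n - 2) else 0)"
  have "mat_mult (mat_mult (H n) (H (n - 1))) (H (n - 2)) (Inl i) (Inl j) = P + C"
    unfolding P_def C_def
    by (subst mat_mult_row, subst row_H_Inl[OF fin]) (simp add: composite_Inl_Inr[OF n] del: One_nat_def)
  moreover have "mat_mult (H n) (mat_mult (H (n - 1)) (H (n - 2))) (Inl i) (Inl j) \<in> D.J"
    unfolding mat_mult_row[of "H n"]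
    by (rule row_mult_in_ideal_right[OF ts]) (use composite_J[OF le(4), of _ "Inl j"] le(5) in auto)
  ultimately have "P + C \<in> D.J" using H_mult_assoc[OF n, of "Inl i" "Inl j"] by simp
  moreover have "P \<in> D.J" unfolding P_def
    by (rule row_mult_in_ideal_left[OF ts]) (use composite_J[OF le(2)] in auto)
  ultimately have "(P + C) - P \<in> D.J" by (rule two_sided_diff[OF ts])
  then have "(if enat j < t (n - 2 - 1) then obstruction n i j * \<zeta> (n - 2) else 0) \<in> D.J" by (simp add: C_def)
  then have "obstruction n i j * \<zeta> (n - 2) \<in> D.J" using B0 two_sided_0[OF ts] by (auto split: if_splits)
  from two_sided_left[OF ts this, of "(- 1) ^ (n - 2 - 1)"]
  show ?thesis by (cases "even (n - 2 - 1)") (auto simp: \<zeta>_def zgen_central)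
qed

section \<open>Exactness in degree one\<close>

definition xgen :: "nat \<Rightarrow> ('x, 'k) falgz" where "xgen i = Poly_Mapping.single (FWord [x i], 0) 1"

definition hat_row :: "nat \<Rightarrow> (nat + nat \<Rightarrow> ('x, 'k) falgz) \<Rightarrow> bool"
  where "hat_row n v \<longleftrightarrow> fin_supp v \<and> (\<forall>b. v b \<noteq> 0 \<longrightarrow> b \<in> idx n)"

lemma hat_row_add: "hat_row n v \<Longrightarrow> hat_row n w \<Longrightarrow> hat_row n (\<lambda>b. v b + w b)"
  by (auto simp: hat_row_def intro: fin_supp_add) (metis add.right_neutral)
lemma hat_row_diff: "hat_row n v \<Longrightarrow> hat_row n w \<Longrightarrow> hat_row n (\<lambda>b. v b - w b)"
  by (auto simp: hat_row_def intro: fin_supp_diff) metis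
lemma hat_row_scale: "hat_row n v \<Longrightarrow> hat_row n (\<lambda>b. u * v b)"
  by (auto simp: hat_row_def intro: fin_supp_mult) (metis mult_zero_right)
lemma hat_row_0: "hat_row n (\<lambda>_. 0)" by (simp add: hat_row_def fin_supp_def)
lemma hat_row_unit: "b \<in> idx n \<Longrightarrow> hat_row n (\<lambda>k. if k = b then u else 0)"
  using fin_supp_unit[of b u] by (auto simp: hat_row_def)
lemma hat_row_H: "n \<ge> 1 \<Longrightarrow> hat_row (n - 1) (H n a)"
  using H_fin H_supp by (auto simp: hat_row_def)
lemma hat_row_mult:
  assumes "n \<ge> 1" "fin_supp v"
  shows "hat_row (n - 1) (row_mult v (H n))"
proof -
  have "b \<in> idx (n - 1)" if "row_mult v (H n) b \<noteq> 0" for b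
  proof (rule ccontr)
    assume "b \<notin> idx (n - 1)"
    then have "H n a b = 0" for a using H_supp(2)[OF assms(1)] by blast
    then show False using that by (simp add: row_mult_def)
  qed
  then show ?thesis using fin_supp_row_mult[of v "H n"] H_fin[OF assms(1)] assms(2) by (auto simp: hat_row_def)
qed

lemma t_0: "enat j < t 0 \<longleftrightarrow> j = 0" by (simp add: t_fin enat_0_iff one_enat_def)
lemma t_1: "enat j < t (Suc 0) \<longleftrightarrow> j < CARD('x)" using t_fin(2) by simp
lemma t_2: "enat j < t 2 \<longleftrightarrow> j < m" by (simp add: t_fin)

lemma emb_M_1: "i < CARD('x) \<Longrightarrow> emb (M (Suc 0) i 0) = xgen i"
  using M_1[of i] by (simp add: xgen_def fgen_def emb_single)

lemma row_M_1:
  assumes "\<And>i. u i \<noteq> 0 \<Longrightarrow> i < CARD('x)"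
  shows "row_mult u (emb_mat (M (Suc 0))) j = (if j = 0 then \<Sum>i<CARD('x). u i * xgen i else 0)"
proof (cases "j = 0")
  case True
  have "row_mult u (emb_mat (M (Suc 0))) j = (\<Sum>i<CARD('x). u i * emb_mat (M (Suc 0)) i j)"
    by (rule row_mult_sum) (use assms in auto)
  also have "\<dots> = (\<Sum>i<CARD('x). u i * xgen i)"
    using True by (intro sum.cong) (auto simp: emb_mat_def emb_M_1)
  finally show ?thesis using True by simp
next
  case False
  have "M (Suc 0) i j = 0" for i
    using M_supp[of "Suc 0" i j] False by (auto simp: t_0)
  then show ?thesis using False by (simp add: row_mult_def emb_mat_def)
qed

lemma idx_1: "b \<in> idx (Suc 0) \<longleftrightarrow> (case b of Inl i \<Rightarrow> i < CARD('x) | Inr i \<Rightarrow> i = 0)"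
  by (cases b) (auto simp: idx_def t_0 t_1)

lemma \<zeta>_1: "\<zeta> (Suc 0) = zgen" and \<zeta>_2: "\<zeta> 2 = - zgen"
  by (simp_all add: \<zeta>_def)

lemma row_H_1:
  assumes "hat_row (Suc 0) v"
  shows "row_mult v (H (Suc 0)) (Inl 0) = (\<Sum>i<CARD('x). v (Inl i) * xgen i) + v (Inr 0) * zgen"
proof -
  have fin: "fin_supp v" and supp: "\<And>i. v (Inl i) \<noteq> 0 \<Longrightarrow> i < CARD('x)"
    using assms by (auto simp: hat_row_def idx_1)
  have "row_mult (\<lambda>i. v (Inl i)) (emb_mat (M (Suc 0))) 0 = (\<Sum>i<CARD('x). v (Inl i) * xgen i)"
    using row_M_1[of "\<lambda>i. v (Inl i)" 0] supp by simp
  then show ?thesis by (simp add: row_H_Inl[OF fin] t_0 \<zeta>_1)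
qed

definition combine :: "(nat \<Rightarrow> ('x, 'k) falgz) \<Rightarrow> ('x, 'k) falgz \<Rightarrow> nat + nat \<Rightarrow> ('x, 'k) falgz"
  where "combine u d = case_sum (\<lambda>i. if i < CARD('x) then u i else 0) (\<lambda>i. if i = 0 then d else 0)"

lemma hat_row_combine: "hat_row (Suc 0) (combine u d)"
proof -
  have "fin_supp (combine u d)" unfolding combine_def
    by (rule fin_supp_case_sum) (auto simp: fin_supp_def)
  then show ?thesis by (auto simp: hat_row_def combine_def idx_1 split: sum.splits if_splits)
qed

lemma row_combine: "row_mult (combine u d) (H (Suc 0)) (Inl 0) = (\<Sum>i<CARD('x). u i * xgen i) + d * zgen"
  by (simp add: row_H_1[OF hat_row_combine]) (simp add: combine_def)

text \<open>Split the monomials by their last letter; those without letters are powers of \<open>z\<close>.\<close>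

lemma right_decomposition:
  "\<exists>c d u. q = Poly_Mapping.single 0 c + d * zgen + (\<Sum>i<CARD('x). u i * xgen i)
     \<and> (\<forall>w\<in>Poly_Mapping.keys d. fst w = 0)"
proof (induction q rule: monomial_induct)
  case zero
  show ?case by (intro exI[of _ 0] exI[of _ "\<lambda>_. 0"]) simp
next
  case (single wi c)
  obtain w i where wi: "wi = (w, i)" by (cases wi)
  show ?case
  proof (cases "letters w" rule: rev_cases)
    case Nil
    then have w: "w = 0" by (simp add: fword_eq_0_iff)
    show ?thesis
    proof (cases i)
      case 0
      then show ?thesis using w
        by (intro exI[of _ c] exI[of _ 0] exI[of _ "\<lambda>_. 0"]) (simp add: wi zero_prod_def)
    next
      case (Suc k)
      have "Poly_Mapping.single wi c = Poly_Mapping.single (0, k) c * zgen"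
        using w Suc by (simp add: wi zgen_central zgen_single)
      then show ?thesis
        by (intro exI[of _ 0] exI[of _ "Poly_Mapping.single (0, k) c"] exI[of _ "\<lambda>_. 0"]) simp
    qed
  next
    case (snoc ls a)
    obtain k where k: "k < CARD('x)" "x k = a" using x_enum by (metis UNIV_I bij_betw_iff_bijections lessThan_iff)
    let ?u = "\<lambda>j. if j = k then Poly_Mapping.single (FWord ls, i) c else 0"
    have "(\<Sum>j<CARD('x). ?u j * xgen j) = (\<Sum>j<CARD('x). if j = k then Poly_Mapping.single (FWord ls, i) c * xgen k else 0)"
      by (intro sum.cong) auto
    also have "\<dots> = Poly_Mapping.single (FWord ls, i) c * xgen k" using k by simp
    also have "\<dots> = Poly_Mapping.single wi c"
      using snoc k by (cases w) (simp add: wi xgen_def mult_single plus_fword_def)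
    finally show ?thesis by (intro exI[of _ 0] exI[of _ ?u]) simp
  qed
next
  case (add p q)
  then obtain c d u c' d' u' where
    p: "p = Poly_Mapping.single 0 c + d * zgen + (\<Sum>i<CARD('x). u i * xgen i)" "\<forall>w\<in>Poly_Mapping.keys d. fst w = 0"
    and q: "q = Poly_Mapping.single 0 c' + d' * zgen + (\<Sum>i<CARD('x). u' i * xgen i)" "\<forall>w\<in>Poly_Mapping.keys d'. fst w = 0"
    by blast
  have "p + q = Poly_Mapping.single 0 (c + c') + (d + d') * zgen + (\<Sum>i<CARD('x). (u i + u' i) * xgen i)"
    unfolding p(1) q(1) by (simp add: single_add distrib_right sum.distrib)
  moreover have "\<forall>w\<in>Poly_Mapping.keys (d + d'). fst w = 0" using keys_add[of d d'] p(2) q(2) by blast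
  ultimately show ?case
    by (intro exI[of _ "c + c'"] exI[of _ "d + d'"] exI[of _ "\<lambda>i. u i + u' i"] conjI)
qed

lemma lookup_mult_xgen:
  "Poly_Mapping.lookup (p * xgen i) (FWord (ls @ [a]), j) = (Poly_Mapping.lookup p (FWord ls, j) when a = x i)"
proof (induction p rule: monomial_induct)
  case (single wi c)
  obtain w k where wi: "wi = (FWord w, k)" by (metis fword.exhaust prod.exhaust)
  show ?case by (auto simp: wi xgen_def mult_single lookup_single plus_fword_def when_def)
qed (auto simp: distrib_right lookup_add when_def)

lemma lookup_mult_zgen:
  "Poly_Mapping.lookup (p * zgen) (w, j) = (case j of 0 \<Rightarrow> 0 | Suc i \<Rightarrow> Poly_Mapping.lookup p (w, i))"
proof (induction p rule: monomial_induct)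
  case (single wi c)
  show ?case by (cases wi) (auto simp: zgen_central zgen_single lookup_single when_def split: nat.splits)
qed (auto simp: distrib_right lookup_add split: nat.splits)

text \<open>The coefficients can be read off, since right multiplication by distinct letters produces
  distinct monomials.\<close>

lemma right_decomposition_unique:
  assumes sum: "(\<Sum>i<CARD('x). u i * xgen i) + e * zgen = 0" and e: "\<forall>w\<in>Poly_Mapping.keys e. fst w = 0"
  shows "k < CARD('x) \<Longrightarrow> u k = 0" and "e = 0"
proof -
  have x_inj: "i < CARD('x) \<Longrightarrow> k < CARD('x) \<Longrightarrow> x k = x i \<longleftrightarrow> k = i" for i k
    using x_enum by (auto simp: bij_betw_def inj_on_def)
  have u: "u k = 0" if k: "k < CARD('x)" for k
  proof (rule poly_mapping_eqI)
    fix wi :: "'x fword \<times> nat"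
    obtain w j where wi: "wi = (FWord w, j)" by (metis fword.exhaust prod.exhaust)
    have "Poly_Mapping.lookup e (FWord (w @ [x k]), i) = 0" for i
      using e by (force simp: in_keys_iff zero_fword_def)
    then have "Poly_Mapping.lookup (e * zgen) (FWord (w @ [x k]), j) = 0"
      by (simp add: lookup_mult_zgen split: nat.splits)
    moreover have "Poly_Mapping.lookup (\<Sum>i<CARD('x). u i * xgen i) (FWord (w @ [x k]), j) = Poly_Mapping.lookup (u k) wi"
    proof -
      have "Poly_Mapping.lookup (\<Sum>i<CARD('x). u i * xgen i) (FWord (w @ [x k]), j)
        = (\<Sum>i<CARD('x). if i = k then Poly_Mapping.lookup (u k) wi else 0)"
        unfolding lookup_sum lookup_mult_xgen wi
        by (intro sum.cong) (use x_inj k in \<open>auto simp: when_def\<close>)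
      then show ?thesis using k by simp
    qed
    ultimately show "Poly_Mapping.lookup (u k) wi = Poly_Mapping.lookup 0 wi"
      using arg_cong[OF sum, of "\<lambda>p. Poly_Mapping.lookup p (FWord (w @ [x k]), j)"] by (simp add: lookup_add)
  qed
  show "k < CARD('x) \<Longrightarrow> u k = 0" by (rule u)
  have ez: "e * zgen = 0" using sum u by simp
  show "e = 0"
  proof (rule poly_mapping_eqI)
    fix wi :: "'x fword \<times> nat"
    obtain w j where wi: "wi = (w, j)" by (cases wi)
    show "Poly_Mapping.lookup e wi = Poly_Mapping.lookup 0 wi"
      using arg_cong[OF ez, of "\<lambda>p. Poly_Mapping.lookup p (w, Suc j)"] by (simp add: lookup_mult_zgen wi)
  qed
qed

text \<open>In the free algebra with central \<open>z\<close>, the only relations between \<open>x\<^sub>1, \<dots>, x\<^sub>n, z\<close> come from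
  \<open>x\<^sub>i z = z x\<^sub>i\<close>. Writing the coefficient of \<open>z\<close> as \<open>e + \<Sum> u\<^sub>i x\<^sub>i\<close> with \<open>e\<close> a polynomial in \<open>z\<close>, and moving \<open>z\<close> past
  the \<open>x\<^sub>i\<close>, unique decomposition gives \<open>e = 0\<close> and \<open>- u\<^sub>i z\<close> as the coefficient of \<open>x\<^sub>i\<close>.\<close>

lemma Koszul_syzygy:
  assumes v: "hat_row (Suc 0) v" and L0: "row_mult v (H (Suc 0)) (Inl 0) = 0"
  obtains w where "hat_row 2 w" "\<And>b. row_mult w (H 2) b = v b"
proof -
  obtain c d u where q: "v (Inr 0) = Poly_Mapping.single 0 c + d * zgen + (\<Sum>i<CARD('x). u i * xgen i)"
    and d: "\<forall>w\<in>Poly_Mapping.keys d. fst w = 0" using right_decomposition[of "v (Inr 0)"] by blast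
  define e where "e = Poly_Mapping.single 0 c + d * zgen"
  have ke: "\<forall>w\<in>Poly_Mapping.keys e. fst w = 0"
  proof
    fix wi assume wi: "wi \<in> Poly_Mapping.keys e"
    obtain w i where w: "wi = (w, i)" by (cases wi)
    have "Poly_Mapping.lookup e (w, i) = 0" if "w \<noteq> 0"
    proof -
      have "Poly_Mapping.lookup d (w, j) = 0" for j using d that by (force simp: in_keys_iff)
      then show ?thesis
        using that by (simp add: e_def lookup_add lookup_mult_zgen lookup_single zero_prod_def split: nat.split)
    qed
    then show "fst wi = 0" using wi w by (auto simp: in_keys_iff)
  qed
  have "(\<Sum>i<CARD('x). (v (Inl i) + u i * zgen) * xgen i) + e * zgen
    = (\<Sum>i<CARD('x). v (Inl i) * xgen i) + (e + (\<Sum>i<CARD('x). u i * xgen i)) * zgen"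
    by (simp add: distrib_right sum.distrib sum_distrib_right mult.assoc zgen_central[of "xgen _"])
  also have "\<dots> = 0" using L0 by (simp add: row_H_1[OF v] q e_def)
  finally have *: "(\<Sum>i<CARD('x). (v (Inl i) + u i * zgen) * xgen i) + e * zgen = 0" .
  have e0: "e = 0" by (rule right_decomposition_unique(2)[OF * ke])
  have vi: "v (Inl i) = - (u i * zgen)" if "i < CARD('x)" for i
    using right_decomposition_unique(1)[OF * ke that] by (simp add: eq_neg_iff_add_eq_0)
  define u' where "u' = (\<lambda>i. if i < CARD('x) then u i else 0)"
  define w :: "nat + nat \<Rightarrow> ('x, 'k) falgz" where "w = case_sum (\<lambda>_. 0) u'"
  have hat_row_w: "hat_row 2 w"
  proof -
    have "fin_supp u'" unfolding u'_def fin_supp_def by (rule finite_subset[of _ "{..<CARD('x)}"]) auto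
    then have "fin_supp w" unfolding w_def by (intro fin_supp_case_sum) (auto simp: fin_supp_def)
    moreover have "b \<in> idx 2" if "w b \<noteq> 0" for b
      using that by (cases b) (auto simp: w_def u'_def idx_def t_1 split: if_splits)
    ultimately show ?thesis by (simp add: hat_row_def)
  qed
  then have fin: "fin_supp w" by (simp add: hat_row_def)
  have "row_mult w (H 2) b = v b" for b
  proof (cases b)
    case (Inl j)
    have "v (Inl j) = 0" if "\<not> j < CARD('x)" using v that by (auto simp: hat_row_def idx_1)
    then show ?thesis using Inl vi[of j] row_H_Inl[OF fin, of 2 j]
      by (auto simp: w_def t_1 \<zeta>_2 u'_def)
  next
    case (Inr j)
    have "v (Inr j) = 0" if "j \<noteq> 0" using v that by (auto simp: hat_row_def idx_1)
    moreover have "(\<Sum>i<CARD('x). u' i * xgen i) = (\<Sum>i<CARD('x). u i * xgen i)" by (simp add: u'_def)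
    moreover have "row_mult u' (emb_mat (M (Suc 0))) j = (if j = 0 then \<Sum>i<CARD('x). u' i * xgen i else 0)"
      by (rule row_M_1) (simp add: u'_def split: if_splits)
    moreover have "v (Inr 0) = (\<Sum>i<CARD('x). u i * xgen i)" using q e0 by (simp add: e_def)
    ultimately show ?thesis using Inr row_H_Inr[OF fin, of 2 j] by (auto simp: w_def)
  qed
  then show ?thesis using that hat_row_w by blast
qed

text \<open>The homogeneous element \<open>r i + f 2 i 0 * z\<close> of \<open>D.J\<close>: row \<open>i\<close> of \<open>H 2\<close> applied to the generators. It lifts
  the relation \<open>r i\<close>, as \<open>h i\<close> does.\<close>

definition rel_lift :: "nat \<Rightarrow> ('x, 'k) falgz" where "rel_lift i = mat_mult (H 2) (H (Suc 0)) (Inl i) (Inl 0)"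

lemma rel_lift_eq:
  assumes "i < m"
  shows "rel_lift i = emb (r i) + f 2 i 0 * zgen"
proof -
  have "mat_mult (emb_mat (M 2)) (emb_mat (M (Suc 0))) i 0 = emb (mat_mult (M 2) (M 1) i 0)"
    by (simp add: mat_mult_row emb_row_mult emb_mat_def)
  then show ?thesis
    using composite_Inl_Inl[of 2 i 0] M_2[OF assms] by (simp add: rel_lift_def \<zeta>_2 zgen_central)
qed

lemma rel_lift_J: "rel_lift i \<in> D.J"
  using composite_J[of 2 "Inl i" "Inl 0"] by (simp add: rel_lift_def)

lemma zerosub_rel_lift: "i < m \<Longrightarrow> zerosub (rel_lift i) = r i"
  by (simp add: rel_lift_eq zerosub_add zgen_central)

lemma rel_lift_comp:
  assumes i: "i < m"
  shows "rel_lift i \<in> wt_comp wlenz (int (fdeg (r i)))"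
proof -
  have "rel_lift i \<in> wt_comp wlenz (- s 2 i)"
    unfolding rel_lift_def mat_mult_row row_mult_def
  proof (rule wt_comp_sum)
    fix b assume "b \<in> {b. H 2 (Inl i) b \<noteq> 0}"
    then have b: "Inl i \<in> idx 2" "b \<in> idx (Suc 0)" using H_supp[of 2 "Inl i" b] by auto
    have 0: "Inl 0 \<in> idx 0" by (auto simp: idx_def t_0)
    show "H 2 (Inl i) b * H (Suc 0) b (Inl 0) \<in> wt_comp wlenz (- s 2 i)"
      using wlenz.wt_comp_mult[OF H_comp[of 2 "Inl i" b] H_comp[of "Suc 0" b "Inl 0"]] b 0 s_low
      by (simp add: \<sigma>_def)
  qed
  moreover from this have "r i \<in> wt_comp wlen (- s 2 i)"
    using zerosub_hpart[of "- s 2 i" "rel_lift i"] hpart_comp[of wlen "- s 2 i" "r i"]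
    by (simp add: hpart_homogeneous zerosub_rel_lift[OF i])
  moreover have "r i \<noteq> 0" using r_hom[OF i] by (auto simp: fdeg_def)
  ultimately show ?thesis
    using hpart_homogeneous[OF r_comp[OF i], of "- s 2 i"] hpart_homogeneous[of "r i" wlen "- s 2 i" "- s 2 i"]
    by (auto simp: when_def split: if_splits)
qed

text \<open>The difference \<open>h i - rel_lift i\<close> vanishes at \<open>z = 0\<close>, so it lies in the ideal generated by the relations of
  smaller degree, to which induction applies.\<close>

lemma h_in_rel_lift_ideal: "i < m \<Longrightarrow> h i \<in> gen_ideal (rel_lift ` {..<m})"
proof (induction "fdeg (r i)" arbitrary: i rule: less_induct)
  case less
  let ?I = "gen_ideal (rel_lift ` {..<m})"
  note ts = two_sided_gen_ideal[of "rel_lift ` {..<m}"]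
  let ?low = "h ` {j. j < m \<and> fdeg (r j) < fdeg (r i)}"
  have "h i - rel_lift i \<in> gen_ideal ?low"
  proof (rule zero_symbol_in_lower_ideal[OF r_min])
    show "h i - rel_lift i \<in> D.J"
      by (rule two_sided_diff[OF D.two_sided_J _ rel_lift_J]) (use less.prems in \<open>auto intro: gen_ideal_base\<close>)
    show "h i - rel_lift i \<in> wt_comp wlenz (int (fdeg (r i)))"
      by (intro wt_comp_diff h_comp rel_lift_comp less.prems)
    show "zerosub (h i - rel_lift i) = 0" by (simp add: zerosub_diff zerosub_h zerosub_rel_lift less.prems)
  qed
  also have "gen_ideal ?low \<subseteq> ?I"
    using less.hyps by (intro gen_ideal_least ts) auto
  finally have "h i - rel_lift i \<in> ?I" .
  moreover have "rel_lift i \<in> ?I" using less.prems by (auto intro: gen_ideal_base)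
  ultimately have "(h i - rel_lift i) + rel_lift i \<in> ?I" by (rule two_sided_add[OF ts])
  then show ?case by simp
qed

lemma J_subset_rel_lift_ideal: "D.J \<subseteq> gen_ideal (rel_lift ` {..<m})"
  using h_in_rel_lift_ideal by (intro gen_ideal_least two_sided_gen_ideal) auto

lemma row_H2_H1_J:
  assumes "fin_supp w"
  shows "row_mult (row_mult w (H 2)) (H (Suc 0)) (Inl 0) \<in> D.J"
proof -
  have "row_mult (row_mult w (H 2)) (H (Suc 0)) (Inl 0) = row_mult w (mat_mult (H 2) (H (Suc 0))) (Inl 0)"
    by (rule row_mult_assoc[OF assms]) (simp add: H_fin)
  also have "\<dots> \<in> D.J"
    by (rule row_mult_in_ideal_right[OF D.two_sided_J]) (use composite_J[of 2 _ "Inl 0"] in simp)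
  finally show ?thesis .
qed

text \<open>The values on the generators of those rows that come from \<open>H 2\<close> modulo the ideal form a two-sided ideal \<open>U\<close>.
  It contains all \<open>rel_lift i\<close>, hence the whole of \<open>D.J\<close>. A cycle thus has the same value as a row
  that comes from \<open>H 2\<close>, and their difference is a syzygy of the generators in the free algebra.\<close>

lemma exact_at_hatQ_1:
  assumes v: "hat_row (Suc 0) v" and L: "row_mult v (H (Suc 0)) (Inl 0) \<in> D.J"
  obtains w where "hat_row 2 w" "\<And>b. v b - row_mult w (H 2) b \<in> D.J"
proof -
  note ts = D.two_sided_J
  define syz where "syz v \<longleftrightarrow> hat_row (Suc 0) v \<and> (\<exists>w. hat_row 2 w \<and> (\<forall>b. v b - row_mult w (H 2) b \<in> D.J))" for v
  have fin: "fin_supp w" if "hat_row n w" for n w using that by (simp add: hat_row_def)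
  have syz_add: "syz (\<lambda>b. v b + v' b)" if "syz v" "syz v'" for v v'
  proof -
    obtain w w' where w: "hat_row 2 w" "\<And>b. v b - row_mult w (H 2) b \<in> D.J"
      and w': "hat_row 2 w'" "\<And>b. v' b - row_mult w' (H 2) b \<in> D.J" using \<open>syz v\<close> \<open>syz v'\<close> by (auto simp: syz_def)
    have "v b + v' b - row_mult (\<lambda>b. w b + w' b) (H 2) b \<in> D.J" for b
      unfolding row_mult_add[OF fin[OF w(1)] fin[OF w'(1)]]
      using two_sided_add[OF ts w(2)[of b] w'(2)[of b]] by (simp add: algebra_simps)
    then show ?thesis using that hat_row_add w(1) w'(1) unfolding syz_def by blast
  qed
  have syz_scale: "syz (\<lambda>b. u * v b)" if sv: "syz v" for u v
  proof -
    obtain w where w: "hat_row 2 w" "\<And>b. v b - row_mult w (H 2) b \<in> D.J" using sv by (auto simp: syz_def)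
    have "u * v b - row_mult (\<lambda>b. u * w b) (H 2) b \<in> D.J" for b
      unfolding row_mult_scale[OF fin[OF w(1)]]
      using two_sided_left[OF ts w(2)[of b], of u] by (simp add: right_diff_distrib)
    then show ?thesis using sv hat_row_scale w(1) unfolding syz_def by blast
  qed
  have syz_J: "syz v" if "hat_row (Suc 0) v" "\<And>b. v b \<in> D.J" for v
    using that hat_row_0[of 2] unfolding syz_def by (intro conjI exI[of _ "\<lambda>_. 0"]) auto
  have syz_L: "row_mult v (H (Suc 0)) (Inl 0) \<in> D.J" if sv: "syz v" for v
  proof -
    obtain w where w: "hat_row 2 w" "\<And>b. v b - row_mult w (H 2) b \<in> D.J" using sv by (auto simp: syz_def)
    have fv: "fin_supp v" using sv fin by (auto simp: syz_def)
    have fw: "fin_supp (row_mult w (H 2))" by (intro fin_supp_row_mult fin[OF w(1)] H_fin) simp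
    have "row_mult (\<lambda>b. v b - row_mult w (H 2) b) (H (Suc 0)) (Inl 0) \<in> D.J"
      by (rule row_mult_in_ideal_left[OF ts w(2)])
    from two_sided_add[OF ts this row_H2_H1_J[OF fin[OF w(1)]]]
    show ?thesis by (simp add: row_mult_diff[OF fv fw])
  qed
  define U where "U = {row_mult v (H (Suc 0)) (Inl 0) | v. syz v}"
  have UI: "p \<in> U" if "syz v" "p = row_mult v (H (Suc 0)) (Inl 0)" for v p using that by (auto simp: U_def)
  have U_add: "a + b \<in> U" if "a \<in> U" "b \<in> U" for a b
  proof -
    obtain v v' where v: "syz v" "a = row_mult v (H (Suc 0)) (Inl 0)" and v': "syz v'" "b = row_mult v' (H (Suc 0)) (Inl 0)"
      using \<open>a \<in> U\<close> \<open>b \<in> U\<close> by (auto simp: U_def)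
    have "fin_supp v" "fin_supp v'" using v(1) v'(1) fin by (auto simp: syz_def)
    then show ?thesis
      using UI[OF syz_add[OF v(1) v'(1)]] v(2) v'(2) by (simp add: row_mult_add)
  qed
  have U_left: "u * a \<in> U" if aU: "a \<in> U" for u a
  proof -
    obtain v where v: "syz v" "a = row_mult v (H (Suc 0)) (Inl 0)" using aU by (auto simp: U_def)
    have "fin_supp v" using v(1) fin by (auto simp: syz_def)
    then show ?thesis using UI[OF syz_scale[OF v(1), of u]] v(2) by (simp add: row_mult_scale)
  qed
  have "two_sided U"
  proof (rule two_sidedI)
    show "0 \<in> U" by (rule UI[OF syz_J[OF hat_row_0]]) (simp_all add: two_sided_0[OF ts])
    fix q a assume aU: "a \<in> U"
    have aJ: "a \<in> D.J" using aU syz_L by (auto simp: U_def)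
    obtain c d u where q: "q = Poly_Mapping.single 0 c + d * zgen + (\<Sum>i<CARD('x). u i * xgen i)"
      using right_decomposition[of q] by blast
    \<comment> \<open>Up to a constant, \<open>q\<close> is a value of some row on the generators; multiplied by \<open>a\<close>, that row has all
      entries in the ideal.\<close>
    define v where "v = combine (\<lambda>i. a * u i) (a * d)"
    have "syz v"
      unfolding v_def
      by (rule syz_J[OF hat_row_combine])
        (auto simp: combine_def two_sided_0[OF ts] two_sided_right[OF ts aJ] split: sum.split)
    then have "row_mult v (H (Suc 0)) (Inl 0) \<in> U" using UI by blast
    moreover have "a * q = Poly_Mapping.single 0 c * a + row_mult v (H (Suc 0)) (Inl 0)"
      by (simp add: q v_def row_combine single_0_central distrib_left sum_distrib_left mult.assoc add.assoc add.commute)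
    ultimately show "a * q \<in> U" using U_add U_left aU by simp
  qed (use U_add U_left in auto)
  moreover have "rel_lift ` {..<m} \<subseteq> U"
  proof
    fix p assume "p \<in> rel_lift ` {..<m}"
    then obtain i where i: "i < m" "p = rel_lift i" by auto
    have "Inl i \<in> idx 2" using i by (auto simp: idx_def t_2)
    then have "hat_row 2 (\<lambda>k. if k = Inl i then 1 else 0)" by (rule hat_row_unit)
    moreover have "H 2 (Inl i) b - row_mult (\<lambda>k. if k = Inl i then 1 else 0) (H 2) b \<in> D.J" for b
      by (simp add: row_mult_unit two_sided_0[OF ts])
    moreover have "hat_row (Suc 0) (H 2 (Inl i))" using hat_row_H[of 2 "Inl i"] by simp
    ultimately have "syz (H 2 (Inl i))" unfolding syz_def by blast
    then show "p \<in> U" by (rule UI) (simp add: i rel_lift_def mat_mult_row)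
  qed
  ultimately have "D.J \<subseteq> U" using gen_ideal_least[of U] J_subset_rel_lift_ideal by blast
  then obtain v' where v': "syz v'" "row_mult v (H (Suc 0)) (Inl 0) = row_mult v' (H (Suc 0)) (Inl 0)"
    using L by (auto simp: U_def)
  have vv': "hat_row (Suc 0) v'" using v'(1) by (simp add: syz_def)
  have "row_mult (\<lambda>b. v b - v' b) (H (Suc 0)) (Inl 0) = 0"
    by (simp add: row_mult_diff[OF fin[OF v] fin[OF vv']] v'(2))
  from Koszul_syzygy[OF hat_row_diff[OF v vv'] this] obtain w0 where w0: "hat_row 2 w0" "\<And>b. row_mult w0 (H 2) b = v b - v' b"
    by blast
  have "syz (\<lambda>b. v b - v' b)"
    unfolding syz_def using hat_row_diff[OF v vv'] w0 two_sided_0[OF ts] by (intro conjI exI[of _ w0]) auto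
  from syz_add[OF this v'(1)] have "syz v" by simp
  then show ?thesis using that by (auto simp: syz_def)
qed

section \<open>Lifting cycles and regularity\<close>

lemma Q_mod_eq: "Q_mod m r t s n = A.F {i. enat i < t n} (s n)"
  by (simp add: Q_mod_def A_alg_eq A_comp_eq)
lemma Q_delta_eq: "Q_delta m r M n = right_mult A.R (\<lambda>i j. A.\<pi> (M n i j))"
  by (simp add: Q_delta_def A_alg_eq pi_A_eq)

lemma Q_exact:
  assumes "n \<ge> 1"
  shows "Q_delta m r M (n + 1) ` carrier (A.F {i. enat i < t (n + 1)} (s (n + 1))) =
       {v \<in> carrier (A.F {i. enat i < t n} (s n)). Q_delta m r M n v = (\<lambda>_. \<zero>\<^bsub>A.R\<^esub>)}"
  using Q_res assms unfolding minimal_projective_resolution_def projective_resolution_def Q_mod_eq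
  by (simp add: A_alg_eq A_comp_eq)

lemma Q_minimal:
  assumes "n \<ge> 1"
  shows "Q_delta m r M n ` carrier (A.F {i. enat i < t n} (s n))
      \<subseteq> plus_submodule A.R A.G (A.F {i. enat i < t (n - 1)} (s (n - 1)))"
  using Q_res assms unfolding minimal_projective_resolution_def Q_mod_eq
  by (simp add: A_alg_eq A_comp_eq)

text \<open>The entries of row \<open>i\<close> are the coordinates of the image of the \<open>i\<close>-th basis vector, so this is
  minimality of \<open>Q\<close>.\<close>

lemma M_no_constants:
  assumes n: "n \<ge> 1"
  shows "Poly_Mapping.lookup (M n i j) 0 = 0"
proof (cases "enat i < t n")
  case True
  let ?e = "\<lambda>k. if k = i then 1 :: ('x, 'k) falg else 0"
  have "(\<lambda>k. A.\<pi> (?e k)) \<in> carrier (A.F {i. enat i < t n} (s n))"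
    by (rule A.free_lift_closed[OF fin_supp_unit]) (use True in auto)
  then have "Q_delta m r M n (\<lambda>k. A.\<pi> (?e k)) \<in> plus_submodule A.R A.G (A.F {i. enat i < t (n - 1)} (s (n - 1)))"
    using Q_minimal[OF n] by blast
  then have "Q_delta m r M n (\<lambda>k. A.\<pi> (?e k)) j \<in> plus_ideal A.R A.G"
    unfolding A.plus_submodule_free by blast
  then show ?thesis
    unfolding Q_delta_eq A.right_mult_\<pi>[OF fin_supp_unit] row_mult_unit A.\<pi>_plus_ideal_iff by simp
next
  case False
  then have "M n i j = 0" using M_supp[OF n, of i j] by blast
  then show ?thesis by simp
qed

text \<open>Exactness of \<open>Q\<close> in terms of lifts: elements that agree at \<open>z = 0\<close> modulo \<open>A.J\<close> differ by a multiple
  of \<open>z\<close> modulo \<open>D.J\<close>.\<close>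

lemma Q_cycle_lift:
  assumes n: "n \<ge> 1" and a: "fin_supp a" "\<And>i. a i \<noteq> 0 \<Longrightarrow> enat i < t n"
    and cycle: "\<And>j. zerosub (row_mult a (emb_mat (M n)) j) \<in> A.J"
  obtains c e where "fin_supp c" "\<And>i. c i \<noteq> 0 \<Longrightarrow> enat i < t (n + 1)"
    "fin_supp e" "\<And>i. e i \<noteq> 0 \<Longrightarrow> enat i < t n"
    "\<And>i. a i - (row_mult c (emb_mat (M (n + 1))) i + zgen * e i) \<in> D.J"
proof -
  let ?p = "\<lambda>i. zerosub (a i)"
  have p: "fin_supp ?p"
    using a(1) unfolding fin_supp_def by (rule rev_finite_subset) auto
  have p_supp: "?p i = 0" if "\<not> enat i < t n" for i using a(2)[of i] that by (cases "a i = 0") auto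
  have "row_mult ?p (M n) j \<in> A.J" for j
    using cycle[of j] by (simp add: zerosub_row_mult[OF a(1)] emb_mat_def)
  then have "Q_delta m r M n (\<lambda>i. A.\<pi> (?p i)) = (\<lambda>_. \<zero>\<^bsub>A.R\<^esub>)"
    unfolding Q_delta_eq by (intro ext) (simp add: A.right_mult_\<pi>[OF p] A.\<pi>_zero_iff)
  moreover have "(\<lambda>i. A.\<pi> (?p i)) \<in> carrier (A.F {i. enat i < t n} (s n))"
    by (rule A.free_lift_closed[OF p]) (use p_supp in auto)
  ultimately have "(\<lambda>i. A.\<pi> (?p i)) \<in> Q_delta m r M (n + 1) ` carrier (A.F {i. enat i < t (n + 1)} (s (n + 1)))"
    unfolding Q_exact[OF n] by blast
  then obtain w where w: "w \<in> carrier (A.F {i. enat i < t (n + 1)} (s (n + 1)))"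
    "(\<lambda>i. A.\<pi> (?p i)) = Q_delta m r M (n + 1) w" by blast
  obtain c' where c': "fin_supp c'" "w = (\<lambda>i. A.\<pi> (c' i))" "\<And>i. i \<notin> {i. enat i < t (n + 1)} \<Longrightarrow> c' i = 0"
    using A.free_lift[OF w(1)] by blast
  define c where "c = (\<lambda>i. emb (c' i))"
  have c: "fin_supp c" using c'(1) by (simp add: c_def fin_supp_def)
  have J: "zerosub (a i - row_mult c (emb_mat (M (n + 1))) i) \<in> A.J" for i
  proof -
    have "A.\<pi> (?p i) = A.\<pi> (row_mult c' (M (n + 1)) i)"
      using fun_cong[OF w(2), of i] unfolding c'(2) Q_delta_eq A.right_mult_\<pi>[OF c'(1)] .
    then show ?thesis by (simp add: A.\<pi>_eq_iff zerosub_diff c_def flip: emb_row_mult)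
  qed
  have out: "row_mult c (emb_mat (M (n + 1))) i = 0" if "\<not> enat i < t n" for i
  proof -
    have "M (n + 1) k i = 0" for k using M_supp[of "n + 1" k i] that by auto
    then show ?thesis by (simp add: row_mult_def emb_mat_def)
  qed
  let ?B = "{i. a i \<noteq> 0} \<union> {i. row_mult c (emb_mat (M (n + 1))) i \<noteq> 0}"
  have B: "finite ?B"
    using a(1) fin_supp_row_mult[OF c, of "emb_mat (M (n + 1))"] emb_M_fin[of "n + 1"] by (simp add: fin_supp_def)
  have "\<exists>y. (a i - row_mult c (emb_mat (M (n + 1))) i) - zgen * y \<in> D.J \<and> (y \<noteq> 0 \<longrightarrow> i \<in> ?B)" for i
  proof (cases "i \<in> ?B")
    case True
    obtain y where "(a i - row_mult c (emb_mat (M (n + 1))) i) - zgen * y \<in> D.J" by (rule J_lift[OF J])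
    then show ?thesis using True by (intro exI[of _ y] conjI impI)
  next
    case False
    then show ?thesis by (intro exI[of _ 0]) (simp add: two_sided_0[OF D.two_sided_J])
  qed
  from choice[OF allI[OF this]] obtain e
    where e': "\<forall>i. (a i - row_mult c (emb_mat (M (n + 1))) i) - zgen * e i \<in> D.J \<and> (e i \<noteq> 0 \<longrightarrow> i \<in> ?B)" ..
  then have e: "(a i - row_mult c (emb_mat (M (n + 1))) i) - zgen * e i \<in> D.J"
    "e i \<noteq> 0 \<Longrightarrow> i \<in> ?B" for i by blast+
  show ?thesis
  proof (rule that[of c e])
    show "fin_supp c" by (rule c)
    show "enat i < t (n + 1)" if "c i \<noteq> 0" for i using c'(3)[of i] that by (auto simp: c_def)
    show "fin_supp e" unfolding fin_supp_def by (rule finite_subset[OF _ B]) (use e(2) in blast)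
    show "enat i < t n" if "e i \<noteq> 0" for i using e(2)[OF that] a(2)[of i] out[of i] by blast
    show "a i - (row_mult c (emb_mat (M (n + 1))) i + zgen * e i) \<in> D.J" for i
      using e(1)[of i] by (simp add: diff_diff_eq)
  qed
qed

text \<open>Only the left coordinates of the image of \<open>v\<close> have to vanish: they make the left block of \<open>v\<close> a cycle
  of \<open>Q\<close> at \<open>z = 0\<close>. Subtracting a multiple of \<open>H (n + 1)\<close> then clears that block.\<close>

lemma cycle_reduction:
  assumes n: "n \<ge> 1" and v: "hat_row n v" and cycle: "\<And>j. row_mult v (H n) (Inl j) \<in> D.J"
  obtains w b where "hat_row (n + 1) w" "fin_supp b" "\<And>i. b i \<noteq> 0 \<Longrightarrow> enat i < t (n - 1)"
    "\<And>a. v a - (row_mult w (H (n + 1)) a + case_sum (\<lambda>_. 0) b a) \<in> D.J"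
proof -
  have fv: "fin_supp v" using v by (simp add: hat_row_def)
  have "zerosub (row_mult (\<lambda>i. v (Inl i)) (emb_mat (M n)) j) \<in> A.J" for j
  proof -
    have "zerosub (row_mult v (H n) (Inl j)) \<in> A.J" by (rule zerosub_J[OF cycle])
    moreover have "zerosub (\<zeta> n * y) = 0" for y
      by (cases "even (n - 1)") (auto simp: \<zeta>_def zerosub_diff[of 0, simplified])
    ultimately show ?thesis by (simp add: row_H_Inl[OF fv] zerosub_add \<zeta>_central split: if_splits)
  qed
  moreover have "enat i < t n" if "v (Inl i) \<noteq> 0" for i
    using v that by (auto simp: hat_row_def idx_def)
  ultimately obtain c e where c: "fin_supp c" "\<And>i. c i \<noteq> 0 \<Longrightarrow> enat i < t (n + 1)"
    and e: "fin_supp e" "\<And>i. e i \<noteq> 0 \<Longrightarrow> enat i < t n"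
    and ce: "\<And>i. v (Inl i) - (row_mult c (emb_mat (M (n + 1))) i + zgen * e i) \<in> D.J"
    using Q_cycle_lift[OF n fin_supp_Inl[OF fv]] by blast
  \<comment> \<open>The lower left block of \<open>H (n + 1)\<close> is \<open>(- 1) ^ n * z\<close>; the sign makes the contribution of \<open>e\<close> equal to
    \<open>z * e\<close>.\<close>
  define w where "w = case_sum c (\<lambda>i. (- 1) ^ n * e i)"
  have fw: "fin_supp w" unfolding w_def by (intro fin_supp_case_sum c fin_supp_mult e)
  have w: "hat_row (n + 1) w"
    unfolding hat_row_def
  proof (intro conjI fw allI impI)
    fix a assume a: "w a \<noteq> 0"
    show "a \<in> idx (n + 1)"
    proof (cases a)
      case (Inl i)
      then show ?thesis using a c(2)[of i] by (auto simp: w_def idx_def)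
    next
      case (Inr i)
      then have "e i \<noteq> 0" using a by (auto simp: w_def)
      then show ?thesis using Inr e(2)[of i] by (auto simp: idx_def)
    qed
  qed
  define b where "b = (\<lambda>i. v (Inr i) - row_mult w (H (n + 1)) (Inr i))"
  have wH: "hat_row n (row_mult w (H (n + 1)))" using hat_row_mult[of "n + 1" w] fw by simp
  then have fwH: "fin_supp (row_mult w (H (n + 1)))" by (simp add: hat_row_def)
  show ?thesis
  proof (rule that[OF w])
    show "fin_supp b" unfolding b_def by (intro fin_supp_diff fin_supp_Inr fv fwH)
    show "enat i < t (n - 1)" if "b i \<noteq> 0" for i
    proof -
      have "v (Inr i) \<noteq> 0 \<or> row_mult w (H (n + 1)) (Inr i) \<noteq> 0" using that by (auto simp: b_def)
      then have "Inr i \<in> idx n" using v wH by (auto simp: hat_row_def)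
      then show ?thesis using n by (auto simp: idx_def)
    qed
    fix a
    show "v a - (row_mult w (H (n + 1)) a + case_sum (\<lambda>_. 0) b a) \<in> D.J"
    proof (cases a)
      case (Inl i)
      have "(- 1) ^ n * e i * \<zeta> (n + 1) = zgen * e i"
        by (cases "even n") (auto simp: \<zeta>_def zgen_central)
      then have "(if enat i < t (n + 1 - 1) then w (Inr i) * \<zeta> (n + 1) else 0) = zgen * e i"
        using e(2)[of i] by (cases "e i = 0") (auto simp: w_def)
      then have "row_mult w (H (n + 1)) (Inl i) = row_mult c (emb_mat (M (n + 1))) i + zgen * e i"
        unfolding row_H_Inl[OF fw] by (simp add: w_def)
      then show ?thesis using Inl ce[of i] by simp
    qed (simp add: b_def two_sided_0[OF D.two_sided_J])
  qed
qed

text \<open>Rows of \<open>H (n + 1)\<close> are cycles once the composite vanishes, so the reduction does not change the image.\<close>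

lemma reduced_image:
  assumes n: "n \<ge> 1" and v: "hat_row n v" and w: "hat_row (n + 1) w" and b: "fin_supp b"
    and eq: "\<And>a. v a - (row_mult w (H (n + 1)) a + case_sum (\<lambda>_. 0) b a) \<in> D.J"
    and comp: "\<And>a c. mat_mult (H (n + 1)) (H n) a c \<in> D.J"
  shows "row_mult v (H n) c - row_mult (case_sum (\<lambda>_. 0) b) (H n) c \<in> D.J"
proof -
  note ts = D.two_sided_J
  have fv: "fin_supp v" and fw: "fin_supp w" using v w by (auto simp: hat_row_def)
  have fwH: "fin_supp (row_mult w (H (n + 1)))" by (intro fin_supp_row_mult fw H_fin) simp
  define e :: "nat + nat \<Rightarrow> ('x, 'k) falgz" where "e = case_sum (\<lambda>_. 0) b"
  have fe: "fin_supp e" unfolding e_def by (intro fin_supp_case_sum b) (simp add: fin_supp_def)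
  have "row_mult (\<lambda>a. v a - (row_mult w (H (n + 1)) a + e a)) (H n) c \<in> D.J"
    by (rule row_mult_in_ideal_left[OF ts]) (simp only: eq e_def)
  then have "row_mult v (H n) c - (row_mult (row_mult w (H (n + 1))) (H n) c + row_mult e (H n) c) \<in> D.J"
    by (simp only: row_mult_diff[OF fv fin_supp_add[OF fwH fe]] row_mult_add[OF fwH fe])
  moreover have "row_mult (row_mult w (H (n + 1))) (H n) c = row_mult w (mat_mult (H (n + 1)) (H n)) c"
    by (rule row_mult_assoc[OF fw H_fin]) simp
  moreover have "row_mult w (mat_mult (H (n + 1)) (H n)) c \<in> D.J"
    by (rule row_mult_in_ideal_right[OF ts]) (rule comp)
  ultimately have "(row_mult v (H n) c - (row_mult w (mat_mult (H (n + 1)) (H n)) c + row_mult e (H n) c))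
      + row_mult w (mat_mult (H (n + 1)) (H n)) c \<in> D.J"
    by (intro two_sided_add[OF ts]) simp_all
  then show ?thesis by (simp add: e_def)
qed

lemma right_block_Inl:
  assumes b: "fin_supp b" "\<And>i. b i \<noteq> 0 \<Longrightarrow> enat i < t (n - 1)"
  shows "row_mult (case_sum (\<lambda>_. 0) b) (H n) (Inl j) = \<zeta> n * b j"
proof -
  have fb: "fin_supp (case_sum (\<lambda>_. 0) b)" by (intro fin_supp_case_sum b) (simp add: fin_supp_def)
  show ?thesis using b(2)[of j] by (cases "b j = 0") (auto simp: row_H_Inl[OF fb] \<zeta>_central)
qed

lemma \<zeta>_J_iff: "\<zeta> n * y \<in> D.J \<longleftrightarrow> zgen * y \<in> D.J"
  using two_sided_uminus[OF D.two_sided_J, of "zgen * y"] two_sided_uminus[OF D.two_sided_J, of "- (zgen * y)"]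
  by (cases "even (n - 1)") (auto simp: \<zeta>_def)

definition regular :: bool where "regular \<longleftrightarrow> (\<forall>y. zgen * y \<in> D.J \<longrightarrow> y \<in> D.J)"

text \<open>The ideal is homogeneous and \<open>z\<close> has degree one, so each homogeneous part of \<open>y\<close> is annihilated by \<open>z\<close> if
  \<open>y\<close> is.\<close>

lemma regularI_homogeneous:
  assumes "\<And>k y. y \<in> wt_comp wlenz (int k) \<Longrightarrow> zgen * y \<in> D.J \<Longrightarrow> y \<in> D.J"
  shows regular
  unfolding regular_def
proof (intro allI impI)
  fix y assume y: "zgen * y \<in> D.J"
  have "hpart wlenz d y \<in> D.J" for d
  proof (cases "d \<ge> 0")
    case True
    have "hpart wlenz (d + 1) (zgen * y) \<in> D.J" by (rule D.hpart_J[OF y])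
    then have "zgen * hpart wlenz d y \<in> D.J"
      by (simp add: wlenz.hpart_mult_homogeneous_left[OF zgen_comp])
    then show ?thesis using assms[of "hpart wlenz d y" "nat d"] hpart_comp[of wlenz d y] True by simp
  next
    case False
    then have "hpart wlenz d y = 0" using wt_comp_neg[OF _ hpart_comp, of d wlenz y] by simp
    then show ?thesis by (simp add: two_sided_0[OF D.two_sided_J])
  qed
  then have "(\<Sum>d\<in>{d. hpart wlenz d y \<noteq> 0}. hpart wlenz d y) \<in> D.J"
    by (intro two_sided_sum[OF D.two_sided_J])
  then show "y \<in> D.J" using hpart_decomposition[of "{d. hpart wlenz d y \<noteq> 0}" wlenz y, OF hpart_support order.refl] by simp
qed

text \<open>Induction on the degree of an element \<open>y\<close> annihilated by \<open>z\<close>. The row \<open>(0, y)\<close> is a cycle in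
  degree one, and the reduction in degree two exhibits \<open>y\<close> as \<open>\<Sum> b\<^sub>i x\<^sub>i\<close> with \<open>z * b\<^sub>i\<close> in the ideal.\<close>

lemma regular_if_obstruction_3:
  assumes B3: "\<And>i j. obstruction 3 i j \<in> D.J"
  shows regular
proof (rule regularI_homogeneous)
  note ts = D.two_sided_J
  have comp: "mat_mult (H (2 + 1)) (H 2) a c \<in> D.J" for a c
    using composite_J[of 3 a c] B3 by simp
  show "y \<in> D.J" if "y \<in> wt_comp wlenz (int k)" "zgen * y \<in> D.J" for k y
    using that
  proof (induction k arbitrary: y rule: less_induct)
    case (less k)
    define v where "v = combine (\<lambda>_. 0) y"
    have v: "hat_row (Suc 0) v" unfolding v_def by (rule hat_row_combine)
    have "row_mult v (H (Suc 0)) (Inl 0) \<in> D.J"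
      using less.prems(2) by (simp add: v_def row_combine zgen_central)
    from exact_at_hatQ_1[OF v this] obtain w where w: "hat_row 2 w" "\<And>b. v b - row_mult w (H 2) b \<in> D.J" by blast
    have "row_mult w (H 2) (Inl j) \<in> D.J" for j
      using two_sided_uminus[OF ts w(2)[of "Inl j"]] by (simp add: v_def combine_def)
    from cycle_reduction[OF _ w(1) this] obtain w' b where w': "hat_row (2 + 1) w'" and b: "fin_supp b" "\<And>i. b i \<noteq> 0 \<Longrightarrow> enat i < t (2 - 1)"
      and eq: "\<And>a. w a - (row_mult w' (H (2 + 1)) a + case_sum (\<lambda>_. 0) b a) \<in> D.J" by auto
    have img: "v c - row_mult (case_sum (\<lambda>_. 0) b) (H 2) c \<in> D.J" for c
      using two_sided_add[OF ts w(2)[of c] reduced_image[OF _ w(1) w' b(1) eq comp, of c]] by simp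
    have zb: "zgen * b j \<in> D.J" for j
    proof -
      have "\<zeta> 2 * b j \<in> D.J"
        using two_sided_uminus[OF ts img[of "Inl j"]] right_block_Inl[OF b] by (simp add: v_def combine_def)
      then show ?thesis by (simp add: \<zeta>_J_iff)
    qed
    \<comment> \<open>The coefficients need not be homogeneous, but only their parts of degree \<open>k - 1\<close> contribute to \<open>y\<close>.\<close>
    have b': "hpart wlenz (int k - 1) (b j) \<in> D.J" for j
    proof (cases "k = 0")
      case True
      then show ?thesis using wt_comp_neg[OF _ hpart_comp, of "int k - 1" wlenz "b j"] two_sided_0[OF ts] by simp
    next
      case False
      have "hpart wlenz (int k) (zgen * b j) \<in> D.J" by (rule D.hpart_J[OF zb])
      then have "zgen * hpart wlenz (int k - 1) (b j) \<in> D.J"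
        by (simp add: wlenz.hpart_mult_homogeneous_left[OF zgen_comp])
      moreover have "hpart wlenz (int k - 1) (b j) \<in> wt_comp wlenz (int (k - 1))"
        using hpart_comp[of wlenz "int k - 1" "b j"] False by (simp add: of_nat_diff)
      ultimately show ?thesis using less.IH[of "k - 1"] False by simp
    qed
    have fb: "fin_supp (case_sum (\<lambda>_. 0) b)" by (intro fin_supp_case_sum b) (simp add: fin_supp_def)
    have "row_mult (case_sum (\<lambda>_. 0) b) (H 2) (Inr 0) = (\<Sum>i<CARD('x). b i * xgen i)"
      using row_H_Inr[OF fb, of 2 0] row_M_1[of b 0] b(2) by (simp add: t_1)
    then have "y - (\<Sum>i<CARD('x). b i * xgen i) \<in> D.J"
      using img[of "Inr 0"] by (simp add: v_def combine_def)
    then have "hpart wlenz (int k) (y - (\<Sum>i<CARD('x). b i * xgen i)) \<in> D.J" by (rule D.hpart_J)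
    moreover have "hpart wlenz (int k) (b i * xgen i) = hpart wlenz (int k - 1) (b i) * xgen i" for i
      by (rule wlenz.hpart_mult_homogeneous_right) (simp add: xgen_def wt_comp_single wlenz_def)
    ultimately have y: "y - (\<Sum>i<CARD('x). hpart wlenz (int k - 1) (b i) * xgen i) \<in> D.J"
      using hpart_homogeneous[OF less.prems(1), of "int k"]
      by (simp add: hpart_diff hpart_sum)
    have "(\<Sum>i<CARD('x). hpart wlenz (int k - 1) (b i) * xgen i) \<in> D.J"
      by (intro two_sided_sum[OF ts] two_sided_right[OF ts b'])
    from two_sided_add[OF ts y this] show ?case by simp
  qed
qed

lemma obstruction_if_regular: "regular \<Longrightarrow> n \<ge> 3 \<Longrightarrow> obstruction n i j \<in> D.J"
  using zgen_obstruction by (auto simp: regular_def)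

lemma composite_if_regular: "regular \<Longrightarrow> n \<ge> 2 \<Longrightarrow> mat_mult (H n) (H (n - 1)) a b \<in> D.J"
  using composite_J obstruction_if_regular by blast

lemma exact_if_regular:
  assumes reg: regular and n: "n \<ge> 1" and v: "hat_row n v" and cycle: "\<And>c. row_mult v (H n) c \<in> D.J"
  obtains w where "hat_row (n + 1) w" "\<And>a. v a - row_mult w (H (n + 1)) a \<in> D.J"
proof -
  note ts = D.two_sided_J
  obtain w b where w: "hat_row (n + 1) w" and b: "fin_supp b" "\<And>i. b i \<noteq> 0 \<Longrightarrow> enat i < t (n - 1)"
    and eq: "\<And>a. v a - (row_mult w (H (n + 1)) a + case_sum (\<lambda>_. 0) b a) \<in> D.J"
    using cycle_reduction[OF n v cycle] by blast
  have comp: "mat_mult (H (n + 1)) (H n) a c \<in> D.J" for a c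
    using composite_if_regular[OF reg, of "n + 1" a c] n by simp
  have bJ: "b j \<in> D.J" for j
  proof -
    have "row_mult v (H n) (Inl j) - (row_mult v (H n) (Inl j) - row_mult (case_sum (\<lambda>_. 0) b) (H n) (Inl j)) \<in> D.J"
      by (rule two_sided_diff[OF ts cycle reduced_image[OF n v w b(1) eq comp]])
    then have "\<zeta> n * b j \<in> D.J" by (simp add: right_block_Inl[OF b])
    then show ?thesis using reg by (simp add: \<zeta>_J_iff regular_def)
  qed
  have "v a - row_mult w (H (n + 1)) a \<in> D.J" for a
  proof -
    have "case_sum (\<lambda>_. 0) b a \<in> D.J" using bJ two_sided_0[OF ts] by (cases a) auto
    from two_sided_add[OF ts eq[of a] this] show ?thesis by (simp add: algebra_simps)
  qed
  then show ?thesis using that w by blast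
qed

text \<open>An entry of \<open>f n\<close> with a constant term has degree zero, so the corresponding entry of \<open>M n * M (n - 1)\<close> has degree
  one. As a product of entries without constant term it must vanish, and then \<open>z\<close> annihilates the
  entry of \<open>f n\<close>.\<close>

lemma f_no_constants:
  assumes reg: regular and n: "n \<ge> 2"
  shows "Poly_Mapping.lookup (f n i j) 0 = 0"
proof (rule ccontr)
  assume nz: "Poly_Mapping.lookup (f n i j) 0 \<noteq> 0"
  then have "f n i j \<noteq> 0" by auto
  then have ij: "enat i < t n" "enat j < t (n - 2)" using f_supp[OF n] by blast+
  have deg: "s (n - 2) j - s n i = 1"
  proof -
    have "0 \<in> Poly_Mapping.keys (f n i j)" using nz by (simp add: in_keys_iff)
    then have "int (wlenz (0 :: 'x fword \<times> nat)) = s (n - 2) j - s n i - 1"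
      using f_comp[OF n ij] unfolding wt_comp_def by blast
    then show ?thesis by (simp add: wlenz_def)
  qed
  have pos: "d \<ge> 1" if p: "p \<in> wt_comp wlen d" "Poly_Mapping.lookup p 0 = 0" "p \<noteq> 0"
    for p :: "('x, 'k) falg" and d
  proof -
    have "\<exists>w. Poly_Mapping.lookup p w \<noteq> 0" using p(3) by (metis lookup_zero poly_mapping_eqI)
    then obtain w where w: "Poly_Mapping.lookup p w \<noteq> 0" ..
    then have "w \<in> Poly_Mapping.keys p" by (simp add: in_keys_iff)
    then have "int (wlen w) = d" using p(1) unfolding wt_comp_def by blast
    moreover have "w \<noteq> 0" using w p(2) by auto
    ultimately show ?thesis using wlen.wt_0_iff[of w] by simp
  qed
  have "M n i k = 0 \<or> M (n - 1) k j = 0" for k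
  proof (rule ccontr)
    assume "\<not> (M n i k = 0 \<or> M (n - 1) k j = 0)"
    then have nz1: "M n i k \<noteq> 0" and nz2: "M (n - 1) k j \<noteq> 0" by auto
    have n': "n \<ge> 1" "n - 1 \<ge> 1" "n - 1 - 1 = n - 2" using n by auto
    have k: "enat k < t (n - 1)" using M_supp[OF n'(1) nz1] by blast
    have "s (n - 1) k - s n i \<ge> 1"
      by (rule pos[OF M_comp[OF n'(1) ij(1) k] M_no_constants[OF n'(1)] nz1])
    moreover have "s (n - 2) j - s (n - 1) k \<ge> 1"
      using pos[OF M_comp[OF n'(2) k, of j] M_no_constants[OF n'(2)] nz2] ij(2) n'(3) by simp
    ultimately show False using deg by simp
  qed
  then have "emb (M n i k) * emb (M (n - 1) k j) = 0" for k by (metis emb_0 mult_zero_left mult_zero_right)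
  then have "mat_mult (emb_mat (M n)) (emb_mat (M (n - 1))) i j = 0" by (simp add: mat_mult_def emb_mat_def)
  then have "- (\<zeta> n * f n i j) \<in> D.J" using f_eq_J[OF n, of i j] by simp
  from two_sided_uminus[OF D.two_sided_J this] have "zgen * f n i j \<in> D.J" by (simp add: \<zeta>_J_iff)
  then have "f n i j \<in> D.J" using reg by (simp add: regular_def)
  then show False using nz D.J_augmentation by blast
qed

lemma H_no_constants:
  assumes reg: regular and n: "n \<ge> 1"
  shows "Poly_Mapping.lookup (H n a b) 0 = 0"
proof (cases a; cases b)
  fix i j assume [simp]: "a = Inl i" "b = Inl j"
  show ?thesis using M_no_constants[OF n] by (simp add: H_simps zero_prod_def lookup_emb)
next
  fix i j assume [simp]: "a = Inr i" "b = Inl j"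
  have "Poly_Mapping.lookup (\<zeta> n) 0 = 0"
    by (rule lookup_0_homogeneous[OF \<zeta>_comp]) (simp_all add: wlenz.wt_0_iff)
  then show ?thesis by (simp add: H_simps)
next
  fix i j assume [simp]: "a = Inl i" "b = Inr j"
  show ?thesis using f_no_constants[OF reg] by (simp add: H_simps)
next
  fix i j assume [simp]: "a = Inr i" "b = Inr j"
  show ?thesis using M_no_constants[of "n - 1"] by (simp add: H_simps zero_prod_def lookup_emb)
qed

section \<open>The sequence of graded modules\<close>

lemma hatQ_mod_eq: "hatQ_mod m r l t s n = D.F (idx n) (\<sigma> n)"
  by (simp add: hatQ_mod_def idx_def \<sigma>_def D_alg_eq D_comp_eq)

lemma hat_delta_eq: "n \<ge> 1 \<Longrightarrow> hat_delta m r l t M f n = right_mult D.R (\<lambda>a b. D.\<pi> (H n a b))"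
  by (simp add: hat_delta_def H_def D_alg_eq pi_D_eq)

lemma hat_delta_0: "hat_delta m r l t M f 0 = (\<lambda>_ _. \<zero>\<^bsub>D.R\<^esub>)"
  by (simp add: hat_delta_def D_alg_eq)

lemma hat_delta_lift:
  assumes "n \<ge> 1" "fin_supp p"
  shows "hat_delta m r l t M f n (\<lambda>a. D.\<pi> (p a)) = (\<lambda>b. D.\<pi> (row_mult p (H n) b))"
  unfolding hat_delta_eq[OF assms(1)] by (intro ext D.right_mult_\<pi> assms(2))

lemma hatQ_lift:
  assumes "v \<in> carrier (hatQ_mod m r l t s n)"
  obtains p where "hat_row n p" "v = (\<lambda>a. D.\<pi> (p a))"
proof -
  obtain p where "fin_supp p" "v = (\<lambda>i. D.\<pi> (p i))" "\<And>i. i \<notin> idx n \<Longrightarrow> p i = 0"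
    using D.free_lift[OF assms[unfolded hatQ_mod_eq]] by blast
  then show ?thesis using that by (auto simp: hat_row_def)
qed

lemma hatQ_lift_closed: "hat_row n p \<Longrightarrow> (\<lambda>a. D.\<pi> (p a)) \<in> carrier (hatQ_mod m r l t s n)"
  unfolding hatQ_mod_eq by (rule D.free_lift_closed) (auto simp: hat_row_def)

lemma composite_action:
  assumes n: "n \<ge> 2" and p: "hat_row n p"
  shows "hat_delta m r l t M f (n - 1) (hat_delta m r l t M f n (\<lambda>a. D.\<pi> (p a)))
    = (\<lambda>b. D.\<pi> (row_mult p (mat_mult (H n) (H (n - 1))) b))"
proof -
  have le: "n \<ge> 1" "n - 1 \<ge> 1" using n by auto
  have fp: "fin_supp p" using p by (simp add: hat_row_def)
  have fpH: "fin_supp (row_mult p (H n))" by (intro fin_supp_row_mult fp H_fin le)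
  have "row_mult (row_mult p (H n)) (H (n - 1)) b = row_mult p (mat_mult (H n) (H (n - 1))) b" for b
    by (rule row_mult_assoc[OF fp]) (rule H_fin[OF le(1)])
  then show ?thesis
    unfolding hat_delta_lift[OF le(1) fp] hat_delta_lift[OF le(2) fpH] by simp
qed

definition complex_at :: "nat \<Rightarrow> bool"
  where "complex_at n \<longleftrightarrow> (\<forall>q\<in>carrier (hatQ_mod m r l t s n).
    hat_delta m r l t M f (n - 1) (hat_delta m r l t M f n q) = (\<lambda>_. \<zero>\<^bsub>D_alg m r l\<^esub>))"

lemma complex_at_1: "complex_at 1"
  by (simp add: complex_at_def hat_delta_0 D_alg_eq)

lemma complex_at_if_composite:
  assumes n: "n \<ge> 2" and J: "\<And>a b. mat_mult (H n) (H (n - 1)) a b \<in> D.J"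
  shows "complex_at n"
  unfolding complex_at_def
proof
  fix q assume "q \<in> carrier (hatQ_mod m r l t s n)"
  then obtain p where p: "hat_row n p" "q = (\<lambda>a. D.\<pi> (p a))" by (rule hatQ_lift)
  have "row_mult p (mat_mult (H n) (H (n - 1))) b \<in> D.J" for b
    by (rule row_mult_in_ideal_right[OF D.two_sided_J]) (rule J)
  then show "hat_delta m r l t M f (n - 1) (hat_delta m r l t M f n q) = (\<lambda>_. \<zero>\<^bsub>D_alg m r l\<^esub>)"
    unfolding p(2) composite_action[OF n p(1)] by (simp add: fun_eq_iff D.\<pi>_zero_iff D_alg_eq)
qed

lemma complex_if_regular: "regular \<Longrightarrow> n \<ge> 1 \<Longrightarrow> complex_at n"
  using complex_at_1 complex_at_if_composite[of n] composite_if_regular[of n] by (cases "n = 1") auto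

lemma obstruction_outside:
  assumes "n \<ge> 3" "\<not> (enat i < t n \<and> enat j < t (n - 3))"
  shows "obstruction n i j = 0"
proof -
  have le: "n \<ge> 1" "n \<ge> 2" "n - 1 \<ge> 2" "n - 2 \<ge> 1" "n - 1 - 2 = n - 3" "n - 2 - 1 = n - 3" using assms by auto
  have "emb (M n i k) = 0 \<or> f (n - 1) k j = 0" for k
    using M_supp[OF le(1), of i k] f_supp[OF le(3), of k j] assms(2) unfolding le emb_eq_0_iff by blast
  then have 1: "emb (M n i k) * f (n - 1) k j = 0" for k by (metis mult_zero_left mult_zero_right)
  have "f n i k = 0 \<or> emb (M (n - 2) k j) = 0" for k
    using f_supp[OF le(2), of i k] M_supp[OF le(4), of k j] assms(2) unfolding le emb_eq_0_iff by blast
  then have 2: "f n i k * emb (M (n - 2) k j) = 0" for k by (metis mult_zero_left mult_zero_right)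
  show ?thesis using 1 2 by (simp add: obstruction_def mat_mult_def emb_mat_def)
qed

text \<open>The obstruction is the right block of the image of a basis vector of the left block.\<close>

lemma obstruction_if_complex_at_3:
  assumes "complex_at 3"
  shows "obstruction 3 i j \<in> D.J"
proof (cases "enat i < t 3")
  case True
  then have "Inl i \<in> idx 3" by (auto simp: idx_def)
  then have v: "hat_row 3 (\<lambda>k. if k = Inl i then 1 else 0)" by (rule hat_row_unit)
  have "hat_delta m r l t M f (3 - 1) (hat_delta m r l t M f 3 (\<lambda>a. D.\<pi> (if a = Inl i then 1 else 0))) = (\<lambda>_. \<zero>\<^bsub>D_alg m r l\<^esub>)"
    using assms hatQ_lift_closed[OF v] unfolding complex_at_def by blast
  then have "(\<lambda>b. D.\<pi> (row_mult (\<lambda>k. if k = Inl i then 1 else 0) (mat_mult (H 3) (H (3 - 1))) b)) = (\<lambda>_. \<zero>\<^bsub>D_alg m r l\<^esub>)"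
    by (subst (asm) composite_action[OF _ v]) simp_all
  from fun_cong[OF this, of "Inr j"] have "mat_mult (H 3) (H (3 - 1)) (Inl i) (Inr j) \<in> D.J"
    unfolding row_mult_unit by (simp add: D.\<pi>_zero_iff D_alg_eq)
  then show ?thesis using composite_Inl_Inr[of 3 i j] by simp
next
  case False
  then show ?thesis using obstruction_outside[of 3 i j] two_sided_0[OF D.two_sided_J] by simp
qed

lemma ring_regular_iff: "ring_regular (D_alg m r l) (pi_D m r l zgen) \<longleftrightarrow> regular"
proof
  assume R: "ring_regular (D_alg m r l) (pi_D m r l zgen)"
  show regular unfolding regular_def
  proof (intro allI impI)
    fix y assume "zgen * y \<in> D.J"
    then have "D.\<pi> zgen \<otimes>\<^bsub>D.R\<^esub> D.\<pi> y = \<zero>\<^bsub>D.R\<^esub>" by (simp add: D.\<pi>_zero_iff flip: D.\<pi>_mult)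
    then have "D.\<pi> y = \<zero>\<^bsub>D.R\<^esub>"
      using R D.\<pi>_closed[of y] unfolding ring_regular_def D_alg_eq pi_D_eq by blast
    then show "y \<in> D.J" by (simp add: D.\<pi>_zero_iff)
  qed
next
  assume reg: regular
  have "b = \<zero>\<^bsub>D.R\<^esub>" if b: "b \<in> carrier D.R" "D.\<pi> zgen \<otimes>\<^bsub>D.R\<^esub> b = \<zero>\<^bsub>D.R\<^esub> \<or> b \<otimes>\<^bsub>D.R\<^esub> D.\<pi> zgen = \<zero>\<^bsub>D.R\<^esub>" for b
  proof -
    obtain y where y: "b = D.\<pi> y" using b(1) unfolding D.carrier_R by blast
    have "zgen * y \<in> D.J"
      using b(2) unfolding y D.\<pi>_mult[symmetric] zgen_central D.\<pi>_zero_iff by simp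
    then show ?thesis using reg unfolding y D.\<pi>_zero_iff regular_def by blast
  qed
  then show "ring_regular (D_alg m r l) (pi_D m r l zgen)"
    unfolding ring_regular_def D_alg_eq pi_D_eq by (intro conjI ballI impI D.\<pi>_closed)
qed

lemma idx_0: "idx 0 = {Inl 0}"
  by (auto simp: idx_def t_0)

text \<open>The elements without constant term are those of the form \<open>\<Sum> u\<^sub>i x\<^sub>i + d z\<close>.\<close>

lemma image_hat_delta_1:
  "hat_delta m r l t M f 1 ` carrier (hatQ_mod m r l t s 1)
    = {v \<in> carrier (hatQ_mod m r l t s 0). v (Inl 0) \<in> plus_ideal D.R D.G}"
proof
  show "hat_delta m r l t M f 1 ` carrier (hatQ_mod m r l t s 1)
    \<subseteq> {v \<in> carrier (hatQ_mod m r l t s 0). v (Inl 0) \<in> plus_ideal D.R D.G}"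
  proof
    fix v assume "v \<in> hat_delta m r l t M f 1 ` carrier (hatQ_mod m r l t s 1)"
    then obtain q where q: "q \<in> carrier (hatQ_mod m r l t s 1)" "v = hat_delta m r l t M f 1 q" by blast
    obtain p where p: "hat_row 1 p" "q = (\<lambda>a. D.\<pi> (p a))" using hatQ_lift[OF q(1)] .
    then have fp: "fin_supp p" by (simp add: hat_row_def)
    have v: "v = (\<lambda>b. D.\<pi> (row_mult p (H 1) b))" unfolding q(2) p(2) by (rule hat_delta_lift[OF _ fp]) simp
    have "v \<in> carrier (hatQ_mod m r l t s 0)"
      unfolding v using hat_row_mult[of 1, OF _ fp] by (intro hatQ_lift_closed) simp
    moreover have "Poly_Mapping.lookup (row_mult p (H 1) (Inl 0)) 0 = 0"
    proof -
      have "Poly_Mapping.lookup (xgen i) 0 = 0" "Poly_Mapping.lookup (zgen :: ('x, 'k) falgz) 0 = 0" for i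
        by (simp_all add: xgen_def zgen_def lookup_single when_def zero_prod_def zero_fword_def)
      then show ?thesis
        using row_H_1[of p] p(1) by (simp add: lookup_add lookup_sum wlenz.lookup_mult_0)
    qed
    ultimately show "v \<in> {v \<in> carrier (hatQ_mod m r l t s 0). v (Inl 0) \<in> plus_ideal D.R D.G}"
      by (simp add: v D.\<pi>_plus_ideal_iff)
  qed
  show "{v \<in> carrier (hatQ_mod m r l t s 0). v (Inl 0) \<in> plus_ideal D.R D.G}
    \<subseteq> hat_delta m r l t M f 1 ` carrier (hatQ_mod m r l t s 1)"
  proof
    fix v assume v: "v \<in> {v \<in> carrier (hatQ_mod m r l t s 0). v (Inl 0) \<in> plus_ideal D.R D.G}"
    then obtain p where p: "hat_row 0 p" "v = (\<lambda>a. D.\<pi> (p a))" using hatQ_lift[of v 0] by blast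
    obtain c d u where q: "p (Inl 0) = Poly_Mapping.single 0 c + d * zgen + (\<Sum>i<CARD('x). u i * xgen i)"
      using right_decomposition[of "p (Inl 0)"] by blast
    have "Poly_Mapping.lookup (xgen i) 0 = 0" "Poly_Mapping.lookup (zgen :: ('x, 'k) falgz) 0 = 0" for i
      by (simp_all add: xgen_def zgen_def lookup_single when_def zero_prod_def zero_fword_def)
    then have "Poly_Mapping.lookup (p (Inl 0)) 0 = c"
      by (simp add: q lookup_add lookup_sum wlenz.lookup_mult_0)
    moreover have "Poly_Mapping.lookup (p (Inl 0)) 0 = 0"
      using v unfolding p(2) by (simp add: D.\<pi>_plus_ideal_iff)
    ultimately have "row_mult (combine u d) (H 1) (Inl 0) = p (Inl 0)"
      using row_combine[of u d] by (simp add: q add.commute)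
    moreover have "row_mult (combine u d) (H 1) b = 0" "p b = 0" if "b \<noteq> Inl 0" for b
      using hat_row_mult[of 1 "combine u d"] hat_row_combine[of u d] p(1) that by (auto simp: hat_row_def idx_0)
    ultimately have "row_mult (combine u d) (H 1) b = p b" for b by (cases "b = Inl 0") auto
    then have "v = hat_delta m r l t M f 1 (\<lambda>a. D.\<pi> (combine u d a))"
      using hat_row_combine[of u d] by (simp add: p(2) hat_delta_lift hat_row_def fun_eq_iff)
    then show "v \<in> hat_delta m r l t M f 1 ` carrier (hatQ_mod m r l t s 1)"
      using hatQ_lift_closed[of 1 "combine u d"] hat_row_combine by simp
  qed
qed

lemma augmentation:
  "\<exists>\<epsilon> \<in> graded_hom D.R (hatQ_mod m r l t s 0) (trivial_module D.R D.G).
     \<epsilon> ` carrier (hatQ_mod m r l t s 0) = carrier (trivial_module D.R D.G) \<and>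
     hat_delta m r l t M f 1 ` carrier (hatQ_mod m r l t s 1)
       = {v \<in> carrier (hatQ_mod m r l t s 0). \<epsilon> v = \<zero>\<^bsub>trivial_module D.R D.G\<^esub>}"
proof -
  let ?P = "plus_ideal D.R D.G"
  interpret P: ideal ?P D.R by (rule D.ideal_plus_ideal)
  define \<epsilon> :: "(nat + nat \<Rightarrow> ('x, 'k) falgz set) \<Rightarrow> ('x, 'k) falgz set set"
    where "\<epsilon> v = ?P +>\<^bsub>D.R\<^esub> v (Inl 0)" for v
  have hom: "(+>\<^bsub>D.R\<^esub>) ?P \<in> ring_hom D.R (D.R Quot ?P)" by (rule P.rcos_ring_hom)
  have T: "carrier (trivial_module D.R D.G) = carrier (D.R Quot ?P)"
    "\<zero>\<^bsub>trivial_module D.R D.G\<^esub> = ?P"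
    "add (trivial_module D.R D.G) = add (D.R Quot ?P)"
    "a \<odot>\<^bsub>trivial_module D.R D.G\<^esub> y = (?P +>\<^bsub>D.R\<^esub> a) \<otimes>\<^bsub>D.R Quot ?P\<^esub> y"
    "mcomp (trivial_module D.R D.G) k = (\<lambda>a. ?P +>\<^bsub>D.R\<^esub> a) ` D.G k" for a y k
    by (simp_all add: trivial_module_def Let_def FactRing_def)
  have F: "v (Inl 0) \<in> carrier D.R" if "v \<in> carrier (hatQ_mod m r l t s 0)" for v
    using that unfolding hatQ_mod_eq D.carrier_free_iff by blast
  have \<sigma>_0: "\<sigma> 0 (Inl 0) = 0" by (simp add: \<sigma>_def s_low)
  have "\<epsilon> \<in> graded_hom D.R (hatQ_mod m r l t s 0) (trivial_module D.R D.G)"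
    unfolding graded_hom_def
  proof (intro CollectI conjI ballI allI)
    show "\<epsilon> \<in> carrier (hatQ_mod m r l t s 0) \<rightarrow> carrier (trivial_module D.R D.G)"
      unfolding T using F ring_hom_closed[OF hom] by (auto simp: \<epsilon>_def)
  next
    fix v w assume "v \<in> carrier (hatQ_mod m r l t s 0)" "w \<in> carrier (hatQ_mod m r l t s 0)"
    from ring_hom_add[OF hom F[OF this(1)] F[OF this(2)]]
    show "\<epsilon> (v \<oplus>\<^bsub>hatQ_mod m r l t s 0\<^esub> w) = \<epsilon> v \<oplus>\<^bsub>trivial_module D.R D.G\<^esub> \<epsilon> w"
      unfolding T \<epsilon>_def hatQ_mod_eq D.free_simps .
  next
    fix a v assume "a \<in> carrier D.R" "v \<in> carrier (hatQ_mod m r l t s 0)"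
    from ring_hom_mult[OF hom this(1) F[OF this(2)]]
    show "\<epsilon> (a \<odot>\<^bsub>hatQ_mod m r l t s 0\<^esub> v) = a \<odot>\<^bsub>trivial_module D.R D.G\<^esub> \<epsilon> v"
      unfolding T \<epsilon>_def hatQ_mod_eq D.free_simps .
  next
    fix k
    show "\<epsilon> ` mcomp (hatQ_mod m r l t s 0) k \<subseteq> mcomp (trivial_module D.R D.G) k"
    proof
      fix y assume "y \<in> \<epsilon> ` mcomp (hatQ_mod m r l t s 0) k"
      then obtain v where v: "v \<in> mcomp (hatQ_mod m r l t s 0) k" "y = \<epsilon> v" by blast
      have "v (Inl 0) \<in> D.G (\<sigma> 0 (Inl 0) + k)"
        using v(1) unfolding hatQ_mod_eq D.mcomp_free_iff idx_0 by blast
      then have "v (Inl 0) \<in> D.G k" by (simp add: \<sigma>_0)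
      then show "y \<in> mcomp (trivial_module D.R D.G) k"
        unfolding T v(2) \<epsilon>_def by (rule imageI)
    qed
  qed
  moreover have "\<epsilon> ` carrier (hatQ_mod m r l t s 0) = carrier (trivial_module D.R D.G)"
  proof
    show "\<epsilon> ` carrier (hatQ_mod m r l t s 0) \<subseteq> carrier (trivial_module D.R D.G)"
      unfolding T using F ring_hom_closed[OF hom] by (auto simp: \<epsilon>_def)
    show "carrier (trivial_module D.R D.G) \<subseteq> \<epsilon> ` carrier (hatQ_mod m r l t s 0)"
    proof
      fix y assume "y \<in> carrier (trivial_module D.R D.G)"
      then obtain a where a: "a \<in> carrier D.R" "y = ?P +>\<^bsub>D.R\<^esub> a"
        unfolding T FactRing_def A_RCOSETS_def' by auto
      obtain p where p: "a = D.\<pi> p" using a(1) unfolding D.carrier_R by blast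
      have "hat_row 0 (\<lambda>k. if k = Inl 0 then p else 0)" by (rule hat_row_unit) (simp add: idx_0)
      from hatQ_lift_closed[OF this] show "y \<in> \<epsilon> ` carrier (hatQ_mod m r l t s 0)"
        by (rule rev_image_eqI) (simp add: \<epsilon>_def a(2) p)
    qed
  qed
  moreover have "\<epsilon> v = ?P \<longleftrightarrow> v (Inl 0) \<in> ?P" if "v \<in> carrier (hatQ_mod m r l t s 0)" for v
    unfolding \<epsilon>_def using P.a_rcos_const P.a_rcos_self[OF F[OF that]] by auto
  ultimately show ?thesis
    unfolding image_hat_delta_1 T by (intro bexI[of _ \<epsilon>] conjI) auto
qed

lemma hat_delta_hom:
  assumes n: "n \<ge> 1"
  shows "hat_delta m r l t M f n \<in> graded_hom D.R (hatQ_mod m r l t s n) (hatQ_mod m r l t s (n - 1))"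
  unfolding hatQ_mod_eq hat_delta_eq[OF n]
  by (rule D.right_mult_graded_hom[OF H_fin[OF n] H_supp(2)[OF n] H_comp[OF n]])

lemma resolution_if_regular:
  assumes reg: regular
  shows "minimal_projective_resolution D.R D.G (hatQ_mod m r l t s) (hat_delta m r l t M f) (trivial_module D.R D.G)"
  unfolding minimal_projective_resolution_def projective_resolution_def
proof (intro conjI allI impI)
  fix n :: nat
  show "graded_left_module D.R D.G (hatQ_mod m r l t s n)"
    unfolding hatQ_mod_eq by (rule D.free_graded_left_module)
  show "graded_projective D.R D.G (hatQ_mod m r l t s n)"
    unfolding hatQ_mod_eq by (rule D.free_graded_projective)
next
  fix n :: nat assume n: "1 \<le> n"
  show "hat_delta m r l t M f n \<in> graded_hom D.R (hatQ_mod m r l t s n) (hatQ_mod m r l t s (n - 1))"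
    by (rule hat_delta_hom[OF n])
  have zero: "\<zero>\<^bsub>hatQ_mod m r l t s k\<^esub> = (\<lambda>_. \<zero>\<^bsub>D.R\<^esub>)" for k by (simp add: hatQ_mod_eq)
  show "hat_delta m r l t M f (n + 1) ` carrier (hatQ_mod m r l t s (n + 1))
    = {v \<in> carrier (hatQ_mod m r l t s n). hat_delta m r l t M f n v = \<zero>\<^bsub>hatQ_mod m r l t s (n - 1)\<^esub>}"
  proof
    have "hat_delta m r l t M f (n + 1) q \<in> carrier (hatQ_mod m r l t s n)"
      "hat_delta m r l t M f n (hat_delta m r l t M f (n + 1) q) = (\<lambda>_. \<zero>\<^bsub>D.R\<^esub>)"
      if "q \<in> carrier (hatQ_mod m r l t s (n + 1))" for q
      using hat_delta_hom[of "n + 1"] complex_if_regular[OF reg, of "n + 1"] that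
      unfolding graded_hom_def complex_at_def D_alg_eq by auto
    then show "hat_delta m r l t M f (n + 1) ` carrier (hatQ_mod m r l t s (n + 1))
      \<subseteq> {v \<in> carrier (hatQ_mod m r l t s n). hat_delta m r l t M f n v = \<zero>\<^bsub>hatQ_mod m r l t s (n - 1)\<^esub>}"
      unfolding zero by blast
    show "{v \<in> carrier (hatQ_mod m r l t s n). hat_delta m r l t M f n v = \<zero>\<^bsub>hatQ_mod m r l t s (n - 1)\<^esub>}
      \<subseteq> hat_delta m r l t M f (n + 1) ` carrier (hatQ_mod m r l t s (n + 1))"
    proof
      fix v assume "v \<in> {v \<in> carrier (hatQ_mod m r l t s n). hat_delta m r l t M f n v = \<zero>\<^bsub>hatQ_mod m r l t s (n - 1)\<^esub>}"
      then have v: "v \<in> carrier (hatQ_mod m r l t s n)" "hat_delta m r l t M f n v = (\<lambda>_. \<zero>\<^bsub>D.R\<^esub>)"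
        by (simp_all add: zero)
      obtain p where p: "hat_row n p" "v = (\<lambda>a. D.\<pi> (p a))" using hatQ_lift[OF v(1)] .
      then have fp: "fin_supp p" by (simp add: hat_row_def)
      have "row_mult p (H n) c \<in> D.J" for c
        using fun_cong[OF v(2)[unfolded p(2) hat_delta_lift[OF n fp]], of c] by (simp add: D.\<pi>_zero_iff)
      then obtain w where w: "hat_row (n + 1) w" "\<And>a. p a - row_mult w (H (n + 1)) a \<in> D.J"
        using exact_if_regular[OF reg n p(1)] by blast
      then have fw: "fin_supp w" by (simp add: hat_row_def)
      have "v = hat_delta m r l t M f (n + 1) (\<lambda>a. D.\<pi> (w a))"
        unfolding p(2) hat_delta_lift[OF le_add2 fw] using w(2) by (simp add: fun_eq_iff D.\<pi>_eq_iff)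
      then show "v \<in> hat_delta m r l t M f (n + 1) ` carrier (hatQ_mod m r l t s (n + 1))"
        using hatQ_lift_closed[OF w(1)] by (rule image_eqI)
    qed
  qed
  show "hat_delta m r l t M f n ` carrier (hatQ_mod m r l t s n) \<subseteq> plus_submodule D.R D.G (hatQ_mod m r l t s (n - 1))"
  proof
    fix v assume "v \<in> hat_delta m r l t M f n ` carrier (hatQ_mod m r l t s n)"
    then obtain q where q: "q \<in> carrier (hatQ_mod m r l t s n)" "v = hat_delta m r l t M f n q" by blast
    obtain p where p: "hat_row n p" "q = (\<lambda>a. D.\<pi> (p a))" using hatQ_lift[OF q(1)] .
    then have fp: "fin_supp p" by (simp add: hat_row_def)
    have v: "v = (\<lambda>b. D.\<pi> (row_mult p (H n) b))" unfolding q(2) p(2) by (rule hat_delta_lift[OF n fp])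
    have "Poly_Mapping.lookup (row_mult p (H n) b) 0 = 0" for b
      unfolding row_mult_def using H_no_constants[OF reg n] by (simp add: lookup_sum wlenz.lookup_mult_0)
    moreover have "v \<in> carrier (hatQ_mod m r l t s (n - 1))"
      unfolding v by (rule hatQ_lift_closed[OF hat_row_mult[OF n fp]])
    ultimately show "v \<in> plus_submodule D.R D.G (hatQ_mod m r l t s (n - 1))"
      unfolding hatQ_mod_eq D.plus_submodule_free by (simp add: v D.\<pi>_plus_ideal_iff)
  qed
qed (rule augmentation)

lemma complex_if_resolution:
  assumes res: "minimal_projective_resolution D.R D.G (hatQ_mod m r l t s) (hat_delta m r l t M f) (trivial_module D.R D.G)"
    and n: "n \<ge> 1"
  shows "complex_at n"
proof (cases "n = 1")
  case True
  then show ?thesis using complex_at_1 by simp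
next
  case False
  then have n1: "n - 1 \<ge> 1" "n - 1 + 1 = n" using n by auto
  have "\<forall>k\<ge>1. hat_delta m r l t M f (k + 1) ` carrier (hatQ_mod m r l t s (k + 1))
    = {v \<in> carrier (hatQ_mod m r l t s k). hat_delta m r l t M f k v = \<zero>\<^bsub>hatQ_mod m r l t s (k - 1)\<^esub>}"
    using res unfolding minimal_projective_resolution_def projective_resolution_def by (elim conjE)
  from this[rule_format, OF n1(1)]
  have "hat_delta m r l t M f (n - 1) (hat_delta m r l t M f n q) = \<zero>\<^bsub>hatQ_mod m r l t s (n - 1 - 1)\<^esub>"
    if "q \<in> carrier (hatQ_mod m r l t s n)" for q using that unfolding n1(2) by blast
  then show ?thesis by (simp add: complex_at_def hatQ_mod_eq D_alg_eq)
qed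

lemma obstruction_3_iff: "(\<forall>i j. enat i < t 3 \<longrightarrow> enat j < t 0 \<longrightarrow>
    pi_D m r l (mat_mult (emb_mat (M 3)) (f 2) i j + mat_mult (f 3) (emb_mat (M 1)) i j) = \<zero>\<^bsub>D_alg m r l\<^esub>)
  \<longleftrightarrow> (\<forall>i j. obstruction 3 i j \<in> D.J)" (is "?L \<longleftrightarrow> ?R")
proof -
  have eq: "mat_mult (emb_mat (M 3)) (f 2) i j + mat_mult (f 3) (emb_mat (M 1)) i j = obstruction 3 i j" for i j
    by (simp add: obstruction_def)
  have "obstruction 3 i j \<in> D.J" if "\<not> (enat i < t 3 \<and> enat j < t 0)" for i j
    using obstruction_outside[of 3 i j] that two_sided_0[OF D.two_sided_J] by simp
  then show ?thesis unfolding eq pi_D_eq D_alg_eq D.\<pi>_zero_iff by blast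
qed

end

theorem theorem3p6:
  fixes x :: "nat \<Rightarrow> 'x::finite"
    and m :: nat
    and r l :: "nat \<Rightarrow> ('x, 'k::field) falg"
    and t :: "nat \<Rightarrow> enat"
    and s :: "nat \<Rightarrow> nat \<Rightarrow> int"
    and M :: "nat \<Rightarrow> nat \<Rightarrow> nat \<Rightarrow> ('x, 'k) falg"
    and f :: "nat \<Rightarrow> nat \<Rightarrow> nat \<Rightarrow> ('x, 'k) falgz"
  assumes x_enum: "bij_betw x {..<CARD('x)} UNIV"
    and r_hom: "\<And>i. i < m \<Longrightarrow> 2 \<le> fdeg (r i) \<and> r i \<in> T_comp (int (fdeg (r i)))"
    and r_min: "minimal_relations m r"
    and l_deg: "\<And>i. i < m \<Longrightarrow> fdeg (l i) < fdeg (r i)"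
    and t_fin: "t 0 = 1" "t 1 = enat (CARD('x))" "t 2 = enat m"
    and s_low: "s 0 0 = 0" "\<And>i. i < CARD('x) \<Longrightarrow> s 1 i = - 1"
    and fin_deg: "\<And>n d. finite {i. enat i < t n \<and> s n i = d}"
    and M_mat: "\<And>n. n \<ge> 1 \<Longrightarrow> row_finite_matrix (t n) (t (n - 1)) (M n)"
    and M_deg: "\<And>n i j. n \<ge> 1 \<Longrightarrow> enat i < t n \<Longrightarrow> enat j < t (n - 1) \<Longrightarrow>
                  M n i j \<in> T_comp (s (n - 1) j - s n i)"
    and M_1: "\<And>i. i < CARD('x) \<Longrightarrow> M 1 i 0 = fgen (x i)"
    and M_2: "\<And>i. i < m \<Longrightarrow> mat_mult (M 2) (M 1) i 0 = r i"
    and Q_res: "minimal_projective_resolution (A_alg m r) (A_comp m r)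
                  (Q_mod m r t s) (Q_delta m r M) (trivial_module (A_alg m r) (A_comp m r))"
    and f_mat: "\<And>n. n \<ge> 2 \<Longrightarrow> row_finite_matrix (t n) (t (n - 2)) (f n)"
    and f_deg: "\<And>n i j. n \<ge> 2 \<Longrightarrow> enat i < t n \<Longrightarrow> enat j < t (n - 2) \<Longrightarrow>
                  f n i j \<in> Tz_comp (s (n - 2) j - s n i - 1)"
    and f_eq: "\<And>n i j. n \<ge> 2 \<Longrightarrow> enat i < t n \<Longrightarrow> enat j < t (n - 2) \<Longrightarrow>
                  pi_D m r l (mat_mult (emb_mat (M n)) (emb_mat (M (n - 1))) i j
                    - (- 1) ^ (n - 1) * zgen * f n i j) = \<zero>\<^bsub>D_alg m r l\<^esub>"
  shows "let
      S1 = ring_regular (D_alg m r l) (pi_D m r l zgen);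
      S2 = (\<forall>n\<ge>1. \<forall>q\<in>carrier (hatQ_mod m r l t s n).
              hat_delta m r l t M f (n - 1) (hat_delta m r l t M f n q)
                = (\<lambda>_. \<zero>\<^bsub>D_alg m r l\<^esub>));
      S3 = (\<forall>n\<in>{1..3}. \<forall>q\<in>carrier (hatQ_mod m r l t s n).
              hat_delta m r l t M f (n - 1) (hat_delta m r l t M f n q)
                = (\<lambda>_. \<zero>\<^bsub>D_alg m r l\<^esub>));
      S4 = (\<forall>i j. enat i < t 3 \<longrightarrow> enat j < t 0 \<longrightarrow>
              pi_D m r l (mat_mult (emb_mat (M 3)) (f 2) i j
                + mat_mult (f 3) (emb_mat (M 1)) i j) = \<zero>\<^bsub>D_alg m r l\<^esub>);
      S5 = minimal_projective_resolution (D_alg m r l) (D_comp m r l)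
              (hatQ_mod m r l t s) (hat_delta m r l t M f)
              (trivial_module (D_alg m r l) (D_comp m r l))
    in (S1 \<longleftrightarrow> S2) \<and> (S1 \<longleftrightarrow> S3) \<and> (S1 \<longleftrightarrow> S4) \<and> (S1 \<longleftrightarrow> S5)"
proof -
  interpret hat_sequence m r l x t s M f
  proof
    show "M n i j \<in> T_comp (s (n - 1) j - s n i)" if "n \<ge> 1" "enat i < t n" "enat j < t (n - 1)" for n i j
      using M_deg that by blast
  qed (fact x_enum r_hom r_min l_deg t_fin s_low(1) M_mat M_1 M_2 Q_res f_mat f_deg f_eq)+
  have two: "regular \<Longrightarrow> \<forall>n\<ge>1. complex_at n" using complex_if_regular by blast
  have three: "\<forall>n\<ge>1. complex_at n \<Longrightarrow> \<forall>n\<in>{1..3}. complex_at n" by simp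
  have four: "\<forall>n\<in>{1..3}. complex_at n \<Longrightarrow> \<forall>i j. obstruction 3 i j \<in> D.J" using obstruction_if_complex_at_3 by simp
  have one: "\<forall>i j. obstruction 3 i j \<in> D.J \<Longrightarrow> regular" using regular_if_obstruction_3 by blast
  have five: "regular \<longleftrightarrow> minimal_projective_resolution D.R D.G (hatQ_mod m r l t s) (hat_delta m r l t M f)
      (trivial_module D.R D.G)"
    using resolution_if_regular complex_if_resolution three four one by blast
  show ?thesis
    unfolding Let_def complex_at_def[symmetric] ring_regular_iff obstruction_3_iff
    using two three four one five unfolding D_alg_eq D_comp_eq by blast
qed

end
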